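(* Let $m,n\ge 1$ be integers, let $q$ be an odd prime, and let $H$ be a finite group with $\gcd(m,|H|)=1$. Then $$s_{\Gamma_m(q)}^H(n)=\sum_{d\mid m}s_{\Gamma_d(q)}^H(1,n),$$ where, for each $d\mid m$, one has $s_{\Gamma_d(q)}^H(1,n)\equiv 1\pmod 2$ if and only if at least one of the following two conditions holds: (1) $q\nmid d$ and $n=2d\,(1+2(q-1)\eta)$ for some integer $\eta\ge 0$ with $\mathfrak{s}_2((q-1)\eta+1)=\mathfrak{s}_2(\eta)+\mathfrak{s}_2((q-2)\eta+1)$; or (2) $2\nmid d$, $q\nmid d$, $2\nmid |H|$, and $n=d\,(1+2(q-1)\eta)$ for some integer $\eta\ge 0$ with $\mathfrak{s}_2((q-1)\eta+1)=\mathfrak{s}_2(\eta)+\mathfrak{s}_2((q-2)\eta+1)$.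
   Context: For an odd prime $q$ and a positive integer $m$, $\Gamma_m(q)=\langle x,y\mid x^{2m}=y^{qm}=1,\ x^2=y^q\rangle$, i.e. the free product of cyclic groups of orders $2m$ and $qm$ amalgamated along their subgroups of order $m$. Put $\zeta:=x^2=y^q$, a central element of order $m$ in $\Gamma_m(q)$. For a finitely generated group $\Gamma$, a finite group $H$ and $n\ge1$, the generalized subgroup number is $$s_\Gamma^H(n)=\sum_{\Delta\le\Gamma,\ (\Gamma:\Delta)=n}|\mathrm{Hom}(\Delta,H)|.$$ Moreover, for a positive integer $d$, $$s_{\Gamma_d(q)}^H(1,n)=\sum_{\Delta}|\mathrm{Hom}(\Delta,H)|,$$ the sum being over all subgroups $\Delta\le\Gamma_d(q)$ of index $n$ with $\Delta\cap\langle\zeta\rangle=1$, where $\zeta=x^2=y^q$ is the corresponding element of $\Gamma_d(q)$. For a non-negative integer $x$, $\mathfrak{s}_2(x)$ is the sum of the digits in the binary expansion of $x$ (with $\mathfrak{s}_2(0)=0$). *)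

theory Defs
  imports
    "HOL-Algebra.Generated_Groups"
    "HOL-Number_Theory.Number_Theory"
begin

section \<open>Groups given by generators and relations\<close>

text \<open>The letter \<open>(True, g)\<close> stands for the generator \<open>g\<close> and \<open>(False, g)\<close> for its inverse.\<close>

type_synonym 'g word = "(bool \<times> 'g) list"

text \<open>\<open>word_cong R\<close> is the least congruence on words that allows free cancellation and identifies
  \<open>u\<close> with \<open>v\<close> for each defining relation \<open>u = v\<close> in \<open>R\<close>.\<close>

inductive word_cong :: "('g word \<times> 'g word) set \<Rightarrow> 'g word \<Rightarrow> 'g word \<Rightarrow> bool"
  for R :: "('g word \<times> 'g word) set" where
  rel: "(u, v) \<in> R \<Longrightarrow> word_cong R u v"
| cancel: "word_cong R [(b, g), (\<not> b, g)] []"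
| refl: "word_cong R u u"
| sym: "word_cong R u v \<Longrightarrow> word_cong R v u"
| trans: "word_cong R u v \<Longrightarrow> word_cong R v w \<Longrightarrow> word_cong R u w"
| append: "word_cong R u u' \<Longrightarrow> word_cong R v v' \<Longrightarrow> word_cong R (u @ v) (u' @ v')"

definition word_class :: "('g word \<times> 'g word) set \<Rightarrow> 'g word \<Rightarrow> 'g word set" where
  "word_class R u = {v. word_cong R u v}"

definition presented_group :: "('g word \<times> 'g word) set \<Rightarrow> 'g word set monoid" where
  "presented_group R =
    \<lparr>carrier = range (word_class R),
     monoid.mult = (\<lambda>A B. \<Union>u\<in>A. \<Union>v\<in>B. word_class R (u @ v)),
     one = word_class R []\<rparr>"

lemma word_class_eq_iff: "word_class R u = word_class R v \<longleftrightarrow> word_cong R u v"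
proof
  assume eq: "word_class R u = word_class R v"
  have "v \<in> word_class R v" by (simp add: word_class_def word_cong.refl)
  then have "v \<in> word_class R u" unfolding eq .
  then show "word_cong R u v" by (simp add: word_class_def)
next
  assume uv: "word_cong R u v"
  show "word_class R u = word_class R v"
    unfolding word_class_def
  proof (rule Collect_cong, rule iffI)
    fix w
    show "word_cong R u w \<Longrightarrow> word_cong R v w"
      by (rule word_cong.trans[OF word_cong.sym[OF uv]])
    show "word_cong R v w \<Longrightarrow> word_cong R u w"
      by (rule word_cong.trans[OF uv])
  qed
qed

lemma mult_word_class:
  "word_class R u \<otimes>\<^bsub>presented_group R\<^esub> word_class R v = word_class R (u @ v)"
proof -
  have eq: "word_class R (u' @ v') = word_class R (u @ v)"
    if "u' \<in> word_class R u" "v' \<in> word_class R v" for u' v'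
  proof -
    have "word_cong R u u'" "word_cong R v v'"
      using that by (simp_all add: word_class_def)
    then show ?thesis
      unfolding word_class_eq_iff by (intro word_cong.sym[OF word_cong.append])
  qed
  have uv: "u \<in> word_class R u" "v \<in> word_class R v"
    by (simp_all add: word_class_def word_cong.refl)
  have "(\<Union>u'\<in>word_class R u. \<Union>v'\<in>word_class R v. word_class R (u' @ v')) = word_class R (u @ v)"
    (is "?L = _")
  proof (rule subset_antisym; rule subsetI)
    fix w assume "w \<in> ?L"
    then obtain u' v' where
      "u' \<in> word_class R u" "v' \<in> word_class R v" and w: "w \<in> word_class R (u' @ v')"
      by (elim UN_E)
    then have "word_class R (u' @ v') = word_class R (u @ v)" by (intro eq)
    then show "w \<in> word_class R (u @ v)" using w by (simp only:)
  next
    fix w assume "w \<in> word_class R (u @ v)"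
    then show "w \<in> ?L" by (intro UN_I[OF uv(1)] UN_I[OF uv(2)])
  qed
  then show ?thesis
    by (simp only: presented_group_def monoid.simps)
qed

lemma one_presented_group: "\<one>\<^bsub>presented_group R\<^esub> = word_class R []"
  by (simp add: presented_group_def)

lemma carrier_presented_group: "carrier (presented_group R) = range (word_class R)"
  by (simp add: presented_group_def)

lemma word_cong_inverse:
  "word_cong R (map (\<lambda>(b, g). (\<not> b, g)) (rev u) @ u) []"
proof (induction u)
  case Nil
  show ?case by (simp add: word_cong.refl)
next
  case (Cons a u)
  obtain b g where a: "a = (b, g)" by force
  let ?i = "map (\<lambda>(b, g). (\<not> b, g)) (rev u)"
  have "word_cong R [(\<not> b, g), (b, g)] []"
    using word_cong.cancel[of R "\<not> b" g] by simp
  then have "word_cong R (?i @ [(\<not> b, g), (b, g)] @ u) (?i @ [] @ u)"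
    by (rule word_cong.append[OF word_cong.refl word_cong.append[OF _ word_cong.refl]])
  then have "word_cong R (?i @ [(\<not> b, g), (b, g)] @ u) []"
    by (rule word_cong.trans) (simp only: append_Nil Cons.IH)
  then show ?case by (simp add: a)
qed

lemma group_presented_group: "group (presented_group R)"
proof (rule groupI; unfold carrier_presented_group one_presented_group)
  show "word_class R [] \<in> range (word_class R)" by (rule rangeI)
next
  fix x y assume "x \<in> range (word_class R)" "y \<in> range (word_class R)"
  then show "x \<otimes>\<^bsub>presented_group R\<^esub> y \<in> range (word_class R)"
    by (elim rangeE) (simp only: mult_word_class rangeI)
next
  fix x y z
  assume "x \<in> range (word_class R)" "y \<in> range (word_class R)" "z \<in> range (word_class R)"
  then show "x \<otimes>\<^bsub>presented_group R\<^esub> y \<otimes>\<^bsub>presented_group R\<^esub> z =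
      x \<otimes>\<^bsub>presented_group R\<^esub> (y \<otimes>\<^bsub>presented_group R\<^esub> z)"
    by (elim rangeE) (simp only: mult_word_class append_assoc)
next
  fix x assume "x \<in> range (word_class R)"
  then show "word_class R [] \<otimes>\<^bsub>presented_group R\<^esub> x = x"
    by (elim rangeE) (simp only: mult_word_class append_Nil)
next
  fix x assume "x \<in> range (word_class R)"
  then obtain u where u: "x = word_class R u" by (elim rangeE)
  have "word_class R (map (\<lambda>(b, g). (\<not> b, g)) (rev u)) \<otimes>\<^bsub>presented_group R\<^esub> x =
      word_class R []"
    by (simp only: u mult_word_class word_class_eq_iff word_cong_inverse)
  then show "\<exists>y\<in>range (word_class R). y \<otimes>\<^bsub>presented_group R\<^esub> x = word_class R []"
    by (rule bexI[OF _ rangeI])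
qed

section \<open>The groups \<open>\<Gamma>\<^sub>m(q)\<close>\<close>

datatype generator = X | Y

definition Gamma_rels :: "nat \<Rightarrow> nat \<Rightarrow> (generator word \<times> generator word) set" where
  "Gamma_rels m q =
    {(replicate (2 * m) (True, X), []),
     (replicate (q * m) (True, Y), []),
     (replicate 2 (True, X), replicate q (True, Y))}"

definition Gamma :: "nat \<Rightarrow> nat \<Rightarrow> generator word set monoid" where
  "Gamma m q = presented_group (Gamma_rels m q)"

definition zeta :: "nat \<Rightarrow> nat \<Rightarrow> generator word set" where
  "zeta m q = word_class (Gamma_rels m q) (replicate 2 (True, X))"

lemma group_Gamma: "group (Gamma m q)"
  unfolding Gamma_def by (rule group_presented_group)

lemma zeta_in_carrier: "zeta m q \<in> carrier (Gamma m q)"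
  by (simp add: zeta_def Gamma_def carrier_presented_group)

lemma zeta_eq_Y: "zeta m q = word_class (Gamma_rels m q) (replicate q (True, Y))"
  unfolding zeta_def word_class_eq_iff
  by (rule word_cong.rel) (simp add: Gamma_rels_def)

section \<open>Generalized subgroup numbers\<close>

text \<open>The finiteness condition matters only for \<open>n = 0\<close>, as the cardinality of an infinite set
  is \<open>0\<close>.\<close>

definition subgroups_of_index :: "('a, 'b) monoid_scheme \<Rightarrow> nat \<Rightarrow> 'a set set" where
  "subgroups_of_index G n =
    {D. subgroup D G \<and> finite (rcosets\<^bsub>G\<^esub> D) \<and> card (rcosets\<^bsub>G\<^esub> D) = n}"

text \<open>Homomorphisms in \<^const>\<open>hom\<close> are unconstrained outside the carrier; restricting to
  extensional functions makes the cardinality the intended number of homomorphisms.\<close>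

definition card_Hom :: "('a, 'b) monoid_scheme \<Rightarrow> ('c, 'd) monoid_scheme \<Rightarrow> nat" where
  "card_Hom G H = card (hom G H \<inter> extensional (carrier G))"

definition gen_subgroup_number ::
    "('a, 'b) monoid_scheme \<Rightarrow> ('c, 'd) monoid_scheme \<Rightarrow> nat \<Rightarrow> nat" where
  "gen_subgroup_number G H n =
    (\<Sum>D\<in>subgroups_of_index G n. card_Hom (G\<lparr>carrier := D\<rparr>) H)"

definition gen_subgroup_number_Gamma_1 ::
    "nat \<Rightarrow> nat \<Rightarrow> ('c, 'd) monoid_scheme \<Rightarrow> nat \<Rightarrow> nat" where
  "gen_subgroup_number_Gamma_1 d q H n =
    (\<Sum>D\<in>{D \<in> subgroups_of_index (Gamma d q) n.
             D \<inter> generate (Gamma d q) {zeta d q} = {\<one>\<^bsub>Gamma d q\<^esub>}}.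
       card_Hom ((Gamma d q)\<lparr>carrier := D\<rparr>) H)"

section \<open>Binary digit sum\<close>

fun binary_digit_sum :: "nat \<Rightarrow> nat" where
  "binary_digit_sum n = (if n = 0 then 0 else n mod 2 + binary_digit_sum (n div 2))"

declare binary_digit_sum.simps [simp del]

end

(*
  Put G = Gamma_d(q) x H and K = <zeta> x H. A pair of a subgroup Delta with Delta cap <zeta> = 1 and a
  homomorphism Delta -> H is the same as a subgroup D of G with D cap K = 1, namely its graph, and
  x and y centralize K. Such a D is determined by the action of x and y on the cosets of D, a free
  K-set. Exploring this action from the trivial coset, a state has u points (up to K) whose image under x
  is still unknown, and r points remain to be found. The image under x of the next point is
  - its own K-orbit, in #{c in K. c^2 = zeta} ways, which is |K| modulo 2 by the involution c -> c^-1 zeta,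
  - the K-orbit of another open point, in (u - 1) |K| ways,
  - new with trivial y-orbit, in #{c in K. c^q = zeta} ways (odd iff q does not divide d),
  - new with a y-orbit of length q, in one way.
  A complete exploration comes from exactly one subgroup, since Gamma_d(q) is given by a presentation.
  This gives a recursion for the number p u r of completions. Let w = z + z^q w^(q-1) modulo 2. If |K| is even,
  p u is given by w^u, and the total is w^2. If |K| is odd, p (2k) is given by w^(2k) and p (2k+1) by
  w^(2k) + w^(2k+1), and the total is w + w^2. The coefficients of w are Fuss-Catalan numbers.

  The sum over all subgroups of Gamma_m(q) is split by Delta cap <zeta> = <zeta^d>; as m is prime to |H|,
  homomorphisms to H kill zeta^d, so that Delta may be replaced by its image in Gamma_m(q)/<zeta^d> = Gamma_d(q).
*)

theory Submission
  imports Defs "HOL-Library.Z2"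
begin

section \<open>Parity of binomial coefficients\<close>

text \<open>Freeness of the K-action is what makes the count local: the cosets of D become N labels
  times K, and an edge is a label together with one element of K. As y^q lies in K and q is prime, y
  permutes K-orbits in cycles of length 1 or q; as x^2 lies in K, x is an involution on K-orbits, so
  the x-image of an open point is open or new. The shape of p comes from parity. Let |K| be odd and
  q prime to d. Modulo 2, p (u+1) is p u + u p (u-1) + z p u + z^q p (u+q-1), and u+q-1 has the
  parity of u because q is odd, so the last two terms amount to multiplying p u by w. For even u the
  term p u survives and gives w^u + w^(u+1); for odd u the joining terms add up to w^u, which leaves
  w^(u+1). If q divides d, the term z drops out of the equation for w; the only power series with w
  = z^q w^(q-1) is 0, and all numbers are even. The digit condition is Kummer's theorem for the
  Fuss-Catalan coefficients of w. Both cases carry the same condition because w(z)^2 = w(z^2) in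
  characteristic 2.\<close>

lemma binary_digit_sum_0 [simp]: "binary_digit_sum 0 = 0"
  by (simp add: binary_digit_sum.simps)

lemma binary_digit_sum_double [simp]: "binary_digit_sum (2 * n) = binary_digit_sum n"
  by (cases "n = 0") (simp_all add: binary_digit_sum.simps[of "2 * n"])

lemma binary_digit_sum_Suc_double [simp]:
  "binary_digit_sum (Suc (2 * n)) = Suc (binary_digit_sum n)"
  by (simp add: binary_digit_sum.simps[of "Suc (2 * n)"])

text \<open>Adding one clears the block of trailing ones, whose length is the exponent of 2 in
  \<open>Suc n\<close>, and sets the next digit. The induction removes the last digit.\<close>

lemma binary_digit_sum_Suc:
  "binary_digit_sum (Suc n) + multiplicity 2 (Suc n) = Suc (binary_digit_sum n)"
proof (induction n rule: less_induct)
  case (less n)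
  show ?case
  proof (cases "even n")
    case True
    then obtain k where n: "n = 2 * k" by (elim evenE)
    have "multiplicity 2 (Suc n) = 0" using n by (intro not_dvd_imp_multiplicity_0) auto
    then show ?thesis using n by simp
  next
    case False
    then obtain k where n: "n = Suc (2 * k)" by (metis oddE Suc_eq_plus1)
    have e: "Suc n = 2 * Suc k" using n by simp
    have "multiplicity 2 (Suc n) = Suc (multiplicity 2 (Suc k))"
      unfolding e by (rule multiplicity_times_same) auto
    then show ?thesis using less.IH[of k] n unfolding e by (simp del: mult_Suc_right)
  qed
qed

text \<open>Legendre's formula for the prime 2, obtained by summing
  \<open>binary_digit_sum_Suc\<close> over the factors of the factorial.\<close>

lemma legendre_two: "binary_digit_sum n + multiplicity 2 (fact n :: nat) = n"
proof (induction n)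
  case (Suc n)
  have "multiplicity 2 (fact (Suc n) :: nat) = multiplicity 2 (Suc n) + multiplicity 2 (fact n :: nat)"
    unfolding fact_Suc of_nat_id by (rule prime_elem_multiplicity_mult_distrib) auto
  then show ?case using Suc binary_digit_sum_Suc[of n] by simp
qed simp

text \<open>By \<open>legendre_two\<close> the exponent of 2 in the binomial coefficient is s(a) +
  s(b) - s(a + b), with s the digit sum (Kummer's theorem for 2).\<close>

lemma odd_choose_iff_digit_sum:
  "odd ((a + b) choose a) \<longleftrightarrow>
    binary_digit_sum (a + b) = binary_digit_sum a + binary_digit_sum b"
proof -
  let ?c = "(a + b) choose a"
  have c: "fact a * fact b * ?c = (fact (a + b) :: nat)"
    using binomial_fact_lemma[of a "a + b"] by simp
  have "multiplicity 2 (fact (a + b) :: nat) =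
      multiplicity 2 (fact a :: nat) + multiplicity 2 (fact b :: nat) + multiplicity 2 ?c"
    unfolding c[symmetric]
    by (subst prime_elem_multiplicity_mult_distrib; simp)+
  moreover have "odd ?c \<longleftrightarrow> multiplicity 2 ?c = 0"
    by (subst multiplicity_eq_zero_iff) auto
  ultimately show ?thesis
    using legendre_two[of a] legendre_two[of b] legendre_two[of "a + b"] by linarith
qed

text \<open>Doubling shifts binary digits and keeps their sum. This is the coefficient form of
  squaring in characteristic 2.\<close>

lemma odd_choose_double: "odd ((2 * n) choose (2 * k)) \<longleftrightarrow> odd (n choose k)"
proof (cases "k \<le> n")
  case True
  then obtain l where n: "n = k + l" by (auto simp: le_iff_add)
  have "2 * k + 2 * l = 2 * (k + l)" by simp
  then show ?thesis
    using odd_choose_iff_digit_sum[of "2 * k" "2 * l"] odd_choose_iff_digit_sum[of k l]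
    by (simp only: n binary_digit_sum_double)
next
  case False
  then show ?thesis by (simp add: binomial_eq_0)
qed

text \<open>In the absorption identity n C(n-1, k-1) = C(n, k) k the left side is even and k is
  odd.\<close>

lemma even_choose_even_odd:
  assumes "even n" "odd k"
  shows "even (n choose k)"
proof -
  obtain k' where k: "k = Suc k'" using assms(2) by (cases k) auto
  show ?thesis
  proof (cases n)
    case (Suc n')
    have "Suc n' * (n' choose k') = (Suc n' choose Suc k') * Suc k'"
      by (rule Suc_times_binomial_eq)
    then show ?thesis using assms Suc k by (metis even_mult_iff)
  qed (simp add: k)
qed

text \<open>With \<open>t\<close> even, \<open>W t u r\<close> is the coefficient of \<open>z\<^sup>r\<close> in \<open>w\<^sup>u\<close> over the field with two
  elements, where \<open>w = z + z\<^bsup>t + 1\<^esup> w\<^sup>t\<close>. The Fuss-Catalan number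
  \<open>u / (t e + u) * ((t e + u) choose e) = ((t e + u) choose e) - t * ((t e + u - 1) choose (e - 1))\<close>
  is congruent to \<open>(t e + u) choose e\<close> modulo 2, which turns the recursion below into Pascal's rule.\<close>

definition W :: "nat \<Rightarrow> nat \<Rightarrow> nat \<Rightarrow> bit" where
  "W t u r = (if u \<le> r \<and> 2 * t dvd r - u
    then of_nat ((t * ((r - u) div (2 * t)) + u) choose ((r - u) div (2 * t))) else 0)"

lemma W_eq: "t > 0 \<Longrightarrow> W t u (u + 2 * t * e) = of_nat ((t * e + u) choose e)"
  by (simp add: W_def)

lemma W_neq_0_D:
  assumes "W t u r \<noteq> 0" shows "\<exists>e. r = u + 2 * t * e"
proof -
  have "u \<le> r" "2 * t dvd r - u" using assms by (auto simp: W_def split: if_splits)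
  then obtain e where "r - u = 2 * t * e" by (elim dvdE)
  then show ?thesis using \<open>u \<le> r\<close> by (intro exI[of _ e]) linarith
qed

text \<open>For e > 0 absorption gives C(t e, e) = t C(t e - 1, e - 1), which is even because t
  is.\<close>

lemma W_0:
  assumes "even t" "t > 0"
  shows "W t 0 r = of_bool (r = 0)"
proof (cases "\<exists>e. r = 2 * t * e \<and> e > 0")
  case True
  then obtain e where e: "r = 0 + 2 * t * Suc e" by (metis add_0 gr0_conv_Suc)
  have "Suc e * ((t * Suc e) choose Suc e) = t * Suc e * ((t * Suc e - 1) choose e)"
    using Suc_times_binomial_eq[of "t * Suc e - 1" e] assms by (simp add: mult.commute)
  then have "((t * Suc e) choose Suc e) = t * ((t * Suc e - 1) choose e)"
    by (metis mult.assoc mult.left_commute mult_cancel1 nat.distinct(1))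
  then have "even ((t * Suc e) choose Suc e)" using assms by simp
  moreover have "W t 0 r = of_nat ((t * Suc e) choose Suc e)"
    unfolding e using W_eq[of t 0 "Suc e"] assms by simp
  ultimately show ?thesis using e assms(2) by (auto elim!: evenE)
next
  case False
  then have "W t 0 r = 0" if "r \<noteq> 0" using W_neq_0_D[of t 0 r] that by fastforce
  then show ?thesis using assms W_eq[of t 0 0] by simp
qed

text \<open>Comparison of coefficients in w^(u+1) = w^u (z + z^(t+1) w^t). For r = u + 1 + 2 t e
  with e > 0 this is Pascal's rule; for r not of this form with any e all three terms
  vanish.\<close>

lemma W_Suc:
  assumes "t > 0"
  shows "W t (Suc u) r = (if 1 \<le> r then W t u (r - 1) else 0) +
    (if Suc t \<le> r then W t (u + t) (r - Suc t) else 0)"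
proof (cases "\<exists>e. r = Suc u + 2 * t * e")
  case True
  then obtain e where r: "r = Suc u + 2 * t * e" ..
  show ?thesis
  proof (cases e)
    case 0
    have "W t (Suc u) r = 1" using W_eq[OF assms, of "Suc u" 0] r 0 by simp
    moreover have "W t u (r - 1) = 1" using W_eq[OF assms, of u 0] r 0 by simp
    moreover have "\<not> u + t \<le> r - Suc t \<or> \<not> Suc t \<le> r" using r 0 assms by auto
    then have "(if Suc t \<le> r then W t (u + t) (r - Suc t) else 0) = 0" by (auto simp: W_def)
    ultimately show ?thesis using r by simp
  next
    case (Suc f)
    have 1: "W t (Suc u) r = of_nat ((t * e + Suc u) choose e)" unfolding r by (rule W_eq[OF assms])
    have 2: "W t u (r - 1) = of_nat ((t * e + u) choose e)"
      using W_eq[OF assms, of u e] r by simp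
    have "r - Suc t = (u + t) + 2 * t * f" using r Suc by (simp add: algebra_simps)
    then have 3: "W t (u + t) (r - Suc t) = of_nat ((t * e + u) choose f)"
      using W_eq[OF assms, of "u + t" f] Suc by (simp add: algebra_simps)
    have 4: "(t * e + Suc u) choose e = ((t * e + u) choose f) + ((t * e + u) choose e)"
      unfolding Suc by (simp del: mult_Suc_right)
    have "1 \<le> r" "Suc t \<le> r" using Suc r by auto
    then show ?thesis unfolding 1 2 3 4 by (simp add: add.commute)
  qed
next
  case False
  have "W t (Suc u) r = 0" using False W_neq_0_D by blast
  moreover have "1 \<le> r \<Longrightarrow> W t u (r - 1) = 0"
  proof (rule ccontr)
    assume *: "1 \<le> r" "W t u (r - 1) \<noteq> 0"
    then obtain e where "r - 1 = u + 2 * t * e" using W_neq_0_D by blast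
    then have "r = Suc u + 2 * t * e" using * by simp
    then show False using False by blast
  qed
  moreover have "Suc t \<le> r \<Longrightarrow> W t (u + t) (r - Suc t) = 0"
  proof (rule ccontr)
    assume *: "Suc t \<le> r" "W t (u + t) (r - Suc t) \<noteq> 0"
    then obtain e where "r - Suc t = u + t + 2 * t * e" using W_neq_0_D by blast
    then have "r = Suc u + 2 * t * Suc e" using * by (simp add: algebra_simps)
    then show False using False by blast
  qed
  ultimately show ?thesis by simp
qed

lemma of_nat_bit_eq_1_iff: "(of_nat n :: bit) = 1 \<longleftrightarrow> odd n"
  by (induction n) auto

lemma W_1_eq_1_iff:
  assumes "t > 0"
  shows "W t 1 n = 1 \<longleftrightarrow> (\<exists>e. n = 1 + 2 * t * e \<and> odd ((t * e + 1) choose e))"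
proof -
  have "W t 1 (1 + 2 * t * e) = 1 \<longleftrightarrow> odd ((t * e + 1) choose e)" for e
    unfolding W_eq[OF assms] of_nat_bit_eq_1_iff ..
  then show ?thesis using W_neq_0_D[of t 1 n] by (metis zero_neq_one)
qed

text \<open>Modulo 2 the square of w(z) is w(z^2). In coefficients: C(t e + 2, e) is even for odd e,
  and for e = 2 f it has the parity of C(t f + 1, f).\<close>

lemma W_2_eq_1_iff:
  assumes "t > 0" "even t"
  shows "W t 2 n = 1 \<longleftrightarrow> (\<exists>e. n = 2 * (1 + 2 * t * e) \<and> odd ((t * e + 1) choose e))"
proof
  assume *: "W t 2 n = 1"
  then obtain e where n: "n = 2 + 2 * t * e" using W_neq_0_D[of t 2 n] by auto
  have o: "odd ((t * e + 2) choose e)" using * W_eq[OF assms(1), of 2 e] n by (simp add: of_nat_bit_eq_1_iff)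
  then have "even e" using even_choose_even_odd[of "t * e + 2" e] assms by auto
  then obtain f where e: "e = 2 * f" by (elim evenE)
  have "odd ((2 * (t * f + 1)) choose (2 * f))" using o e by (simp add: algebra_simps)
  then show "\<exists>e. n = 2 * (1 + 2 * t * e) \<and> odd ((t * e + 1) choose e)"
    unfolding odd_choose_double by (intro exI[of _ f]) (simp add: n e)
next
  assume "\<exists>e. n = 2 * (1 + 2 * t * e) \<and> odd ((t * e + 1) choose e)"
  then obtain f where f: "n = 2 * (1 + 2 * t * f)" "odd ((t * f + 1) choose f)" by blast
  have "W t 2 n = of_nat ((t * (2 * f) + 2) choose (2 * f))"
    using W_eq[OF assms(1), of 2 "2 * f"] f(1) by (simp add: algebra_simps)
  moreover have "odd ((2 * (t * f + 1)) choose (2 * f))" using f(2) unfolding odd_choose_double .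
  ultimately show "W t 2 n = 1" by (simp add: algebra_simps of_nat_bit_eq_1_iff)
qed

section \<open>Counting and cosets\<close>

text \<open>Values lie in a commutative semiring so that the counting argument can be run directly
  in the field with two elements.\<close>

lemma of_nat_card_UN_const:
  assumes "finite I" and "\<And>i. i \<in> I \<Longrightarrow> finite (A i)"
    and "\<And>i. i \<in> I \<Longrightarrow> (of_nat (card (A i)) :: 'r::comm_semiring_1) = v"
    and "\<And>i j. i \<in> I \<Longrightarrow> j \<in> I \<Longrightarrow> i \<noteq> j \<Longrightarrow> A i \<inter> A j = {}"
  shows "of_nat (card (\<Union>i\<in>I. A i)) = of_nat (card I) * v"
  using assms by (subst card_UN_disjoint) auto

text \<open>A moved point and its image form a pair that can be split off, leaving a set still
  stable under f.\<close>

lemma even_card_moved_involution: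
  assumes "finite A" and "\<And>a. a \<in> A \<Longrightarrow> f a \<in> A \<and> f (f a) = a"
  shows "even (card {a \<in> A. f a \<noteq> a})"
  using assms
proof (induction A rule: finite_psubset_induct)
  case (psubset A)
  show ?case
  proof (cases "\<exists>a\<in>A. f a \<noteq> a")
    case True
    then obtain a where a: "a \<in> A" "f a \<noteq> a" by blast
    let ?B = "A - {a, f a}"
    have "even (card {b \<in> ?B. f b \<noteq> b})"
    proof (rule psubset.IH)
      show "?B \<subset> A" using a by blast
      show "f b \<in> ?B \<and> f (f b) = b" if "b \<in> ?B" for b
        using that psubset.prems a by (metis Diff_iff insert_iff empty_iff)
    qed
    moreover have "{b \<in> A. f b \<noteq> b} = insert a (insert (f a) {b \<in> ?B. f b \<noteq> b})"
      using a psubset.prems by auto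
    ultimately show ?thesis using a psubset.hyps by simp
  next
    case False
    then have "{a \<in> A. f a \<noteq> a} = {}" by blast
    then show ?thesis by (simp only: card.empty even_zero)
  qed
qed

lemma card_fixed_involution:
  assumes "finite A" and "\<And>a. a \<in> A \<Longrightarrow> f a \<in> A \<and> f (f a) = a"
  shows "even (card {a \<in> A. f a = a}) \<longleftrightarrow> even (card A)"
proof -
  have "A = {a \<in> A. f a = a} \<union> {a \<in> A. f a \<noteq> a}" by blast
  then have "card A = card {a \<in> A. f a = a} + card {a \<in> A. f a \<noteq> a}"
    using assms(1) by (subst card_Un_disjoint[symmetric]) auto
  then show ?thesis using even_card_moved_involution[OF assms] by simp
qed

lemma of_nat_bit_eq_0_iff: "(of_nat n :: bit) = 0 \<longleftrightarrow> even n"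
  using of_nat_bit_eq_1_iff[of n] by (cases "of_nat n :: bit") auto

lemma (in group) coset_cong:
  assumes "subgroup D G" "a \<in> carrier G" "b \<in> carrier G" "g \<in> carrier G"
    and "D #> a = D #> b"
  shows "D #> (a \<otimes> g) = D #> (b \<otimes> g)"
  using assms coset_mult_assoc[OF subgroup.subset] by metis

lemma (in group) coset_eq_iff_mem:
  assumes "subgroup D G" "a \<in> carrier G"
  shows "D #> a = D \<longleftrightarrow> a \<in> D"
  using coset_join1[OF _ assms(2,1)] coset_join2[OF assms(2,1)] by blast

lemma (in group) rcoset_eq_iff:
  assumes D: "subgroup D G" and ab: "a \<in> carrier G" "b \<in> carrier G"
  shows "D #> a = D #> b \<longleftrightarrow> a \<otimes> inv b \<in> D"
proof -
  note Dc = subgroup.subset[OF D]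
  have "D #> a = D #> b \<longleftrightarrow> D #> (a \<otimes> inv b) = D"
  proof
    assume "D #> a = D #> b"
    then have "D #> (a \<otimes> inv b) = D #> (b \<otimes> inv b)" by (rule coset_cong[OF D ab inv_closed[OF ab(2)]])
    then show "D #> (a \<otimes> inv b) = D" unfolding r_inv[OF ab(2)] coset_mult_one[OF Dc] .
  next
    assume e: "D #> (a \<otimes> inv b) = D"
    have "D #> a = D #> ((a \<otimes> inv b) \<otimes> b)" using ab by (simp add: m_assoc)
    also have "\<dots> = (D #> (a \<otimes> inv b)) #> b"
      by (rule coset_mult_assoc[OF Dc m_closed[OF ab(1) inv_closed[OF ab(2)]] ab(2), symmetric])
    finally show "D #> a = D #> b" unfolding e .
  qed
  also have "\<dots> \<longleftrightarrow> a \<otimes> inv b \<in> D" using ab by (intro coset_eq_iff_mem D) simp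
  finally show ?thesis .
qed

lemma (in group) coprime_pow_eq_one:
  assumes "a \<in> carrier G" "a [^] (m::nat) = \<one>" "coprime m (card (carrier G))"
  shows "a = \<one>"
proof -
  have "ord a dvd m" using pow_eq_id[OF assms(1)] assms(2) by blast
  moreover have "ord a dvd card (carrier G)"
    using ord_dvd_group_order[OF assms(1)] by (simp add: order_def)
  ultimately have "ord a dvd 1" by (rule coprime_common_divisor[OF assms(3)])
  then have "a [^] (1::nat) = \<one>" using pow_eq_id[OF assms(1)] by blast
  then show ?thesis using assms(1) by simp
qed

section \<open>Exploring the coset graph of a subgroup\<close>

text \<open>The K-equivariant extension of an edge labelling to all points (j, k). The edge label
  acts on the left, since D r_j x = D r_i c gives D r_j k x = D r_i c k; the side matters as K may
  be non-abelian.\<close>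

definition ext_label :: "('a, 'b) monoid_scheme \<Rightarrow> (nat \<Rightarrow> nat \<times> 'a) \<Rightarrow> nat \<times> 'a \<Rightarrow> nat \<times> 'a" where
  "ext_label G F p = (fst (F (fst p)), snd (F (fst p)) \<otimes>\<^bsub>G\<^esub> snd p)"

text \<open>\<open>universal\<close> is the form in which the presentation enters: labellings S and
  T for which both the square of S and the q-th power of T act as multiplication by x x come from an
  action of the whole group. The order \<open>act h (act g p)\<close> is that of a right action, as
  on right cosets. Assuming this here keeps the exploration apart from words and relations.\<close>

locale coset_exploration = group G for G (structure) +
  fixes K :: "'a set" and x y :: 'a and q :: nat
  assumes subgroup_K: "subgroup K G" and finite_K: "finite K"
    and x_closed [simp]: "x \<in> carrier G" and y_closed [simp]: "y \<in> carrier G"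
    and x_comm: "k \<in> K \<Longrightarrow> k \<otimes> x = x \<otimes> k"
    and y_comm: "k \<in> K \<Longrightarrow> k \<otimes> y = y \<otimes> k"
    and xx_in_K: "x \<otimes> x \<in> K" and y_pow_q: "y [^] q = x \<otimes> x"
    and prime_q: "Factorial_Ring.prime q"
    and generated: "generate G ({x, y} \<union> K) = carrier G"
    and universal: "\<And>N S T.
      (\<forall>j<N. fst (S j) < N \<and> snd (S j) \<in> K) \<Longrightarrow>
      (\<forall>p\<in>{..<N} \<times> K. ext_label G S (ext_label G S p) = (fst p, (x \<otimes> x) \<otimes> snd p)) \<Longrightarrow>
      (\<forall>j<N. fst (T j) < N \<and> snd (T j) \<in> K) \<Longrightarrow>
      (\<forall>p\<in>{..<N} \<times> K. (ext_label G T ^^ q) p = (fst p, (x \<otimes> x) \<otimes> snd p)) \<Longrightarrow>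
      \<exists>act. (\<forall>g\<in>carrier G. \<forall>p\<in>{..<N} \<times> K. act g p \<in> {..<N} \<times> K) \<and>
        (\<forall>g\<in>carrier G. \<forall>h\<in>carrier G. \<forall>p\<in>{..<N} \<times> K. act (g \<otimes> h) p = act h (act g p)) \<and>
        (\<forall>p\<in>{..<N} \<times> K. act x p = ext_label G S p \<and> act y p = ext_label G T p \<and>
          (\<forall>k\<in>K. act k p = (fst p, snd p \<otimes> k)))"
begin

abbreviation z where "z \<equiv> x \<otimes> x"
abbreviation pts where "pts N \<equiv> {..<N::nat} \<times> K"
abbreviation ext where "ext \<equiv> ext_label G"

definition rp :: "(nat \<Rightarrow> 'a) \<Rightarrow> nat \<times> 'a \<Rightarrow> 'a" where
  "rp rep p = rep (fst p) \<otimes> snd p"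

section \<open>The subgroup K and its free action on cosets\<close>

lemma K_closed [simp]: "k \<in> K \<Longrightarrow> k \<in> carrier G"
  using subgroup.mem_carrier[OF subgroup_K] .

lemma K_mult [simp]: "k \<in> K \<Longrightarrow> k' \<in> K \<Longrightarrow> k \<otimes> k' \<in> K"
  using subgroup.m_closed[OF subgroup_K] .

lemma K_inv [simp]: "k \<in> K \<Longrightarrow> inv k \<in> K"
  using subgroup.m_inv_closed[OF subgroup_K] .

lemma K_one [simp]: "\<one> \<in> K"
  using subgroup.one_closed[OF subgroup_K] .

lemma K_pow [simp]: "k \<in> K \<Longrightarrow> k [^] (n::nat) \<in> K"
  by (induction n) simp_all

lemma z_in_K [simp]: "z \<in> K" by (rule xx_in_K)

lemma z_comm: "k \<in> K \<Longrightarrow> k \<otimes> z = z \<otimes> k"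
  using x_comm by (metis K_closed m_assoc x_closed)

lemma q_pos [simp]: "0 < q" using prime_q by (rule prime_gt_0_nat)

lemma q_gt_1: "1 < q" using prime_q by (rule prime_gt_1_nat)

lemma card_K_pos: "0 < card K"
  using finite_K K_one card_gt_0_iff by blast

lemma y_pow_comm: "k \<in> K \<Longrightarrow> k \<otimes> y [^] (n::nat) = y [^] n \<otimes> k"
proof (induction n)
  case (Suc n)
  have "k \<otimes> (y [^] n \<otimes> y) = y [^] n \<otimes> (k \<otimes> y)"
    using Suc by (metis K_closed m_assoc nat_pow_closed y_closed)
  also have "\<dots> = y [^] n \<otimes> y \<otimes> k"
    using Suc.prems by (simp add: y_comm m_assoc)
  finally show ?case by simp
qed simp

text \<open>The generators x and y centralize K and the remaining ones lie in K. Centrality would be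
  too much to ask, because H may be non-abelian.\<close>

lemma K_normal:
  assumes "g \<in> carrier G" "k \<in> K" shows "g \<otimes> k \<otimes> inv g \<in> K"
proof -
  have fix1: "h \<otimes> k \<otimes> inv h = k" if "h \<in> {x, y}" "k \<in> K" for h k
    using that x_comm[of k] y_comm[of k] by (auto simp: m_assoc simp flip: x_comm y_comm)
  have fix2: "inv h \<otimes> k \<otimes> inv (inv h) = k" if "h \<in> {x, y}" "k \<in> K" for h k
    using that x_comm[of k] y_comm[of k] by (auto simp: m_assoc x_comm y_comm)
      (simp_all flip: m_assoc)
  have "g \<in> generate G ({x, y} \<union> K)" using assms generated by simp
  then show ?thesis using assms(2)
  proof (induction arbitrary: k)
    case (incl h) then show ?case using fix1 by (cases "h \<in> {x, y}") auto
  next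
    case (inv h) then show ?case using fix2 by (cases "h \<in> {x, y}") auto
  next
    case (eng h1 h2)
    have c: "h1 \<in> carrier G" "h2 \<in> carrier G" using eng.hyps generated by auto
    have "h1 \<otimes> h2 \<otimes> k \<otimes> inv (h1 \<otimes> h2) = h1 \<otimes> (h2 \<otimes> k \<otimes> inv h2) \<otimes> inv h1"
      using c eng.prems by (simp add: m_assoc inv_mult_group)
    then show ?case using eng by simp
  qed simp
qed

text \<open>Equality of the cosets puts g k k'^-1 g^-1 into D, and normality puts it into K.\<close>

lemma coset_K_free:
  assumes D: "subgroup D G" "D \<inter> K = {\<one>}" and "g \<in> carrier G" and k: "k \<in> K" "k' \<in> K"
    and eq: "D #> (g \<otimes> k) = D #> (g \<otimes> k')"
  shows "k = k'"
proof -
  let ?a = "g \<otimes> (k \<otimes> inv k') \<otimes> inv g"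
  have "?a = g \<otimes> k \<otimes> inv (g \<otimes> k')" using assms(3) k by (simp add: m_assoc inv_mult_group)
  then have "?a \<in> D" using rcoset_eq_iff[OF D(1), of "g \<otimes> k" "g \<otimes> k'"] eq assms(3) k by simp
  moreover have "?a \<in> K" using assms by (intro K_normal) auto
  ultimately have "?a \<in> D \<inter> K" by (rule IntI)
  then have "?a = \<one>" unfolding D(2) by (rule singletonD)
  moreover have "g \<otimes> (k \<otimes> inv k') = ?a \<otimes> g" using assms(3) k by (simp add: m_assoc)
  ultimately have "g \<otimes> (k \<otimes> inv k') = g" using assms(3) by simp
  then have "k \<otimes> inv k' = \<one>" using assms(3) k by simp
  then have "k \<otimes> inv k' \<otimes> k' = k'" using k by simp
  then show ?thesis using k by (simp add: m_assoc)
qed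

text \<open>A state: \<open>N\<close> coset representatives \<open>rep\<close> (up to \<open>K\<close>), the set \<open>U\<close> of those whose image
  under \<open>x\<close> is unknown, and labels with \<open>S j = (i, c)\<close> meaning \<open>D (rep j) x = D (rep i) c\<close>,
  similarly \<open>T\<close> for \<open>y\<close>. The values of \<open>S\<close> on \<open>U\<close> are junk. The representatives are abstract
  labels \<open>j < N\<close>, so that no normal form theorem is needed to keep them apart.\<close>

definition valid where
  "valid N U rep S T \<longleftrightarrow> U \<subseteq> {..<N} \<and> (\<forall>j<N. rep j \<in> carrier G) \<and>
    (\<forall>j<N. j \<notin> U \<longrightarrow> fst (S j) < N \<and> fst (S j) \<notin> U \<and> snd (S j) \<in> K \<and>
      S (fst (S j)) = (j, z \<otimes> inv (snd (S j)))) \<and>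
    (\<forall>j<N. fst (T j) < N \<and> snd (T j) \<in> K) \<and>
    (\<forall>p\<in>pts N. (ext T ^^ q) p = (fst p, z \<otimes> snd p))"

text \<open>A spanning tree whose edges carry the label one. In a complete state it forces
  \<open>rep j\<close> to carry the base point (0, 1) to (j, 1), so that the representatives fit the
  action built from the labels.\<close>

definition tree where
  "tree N U rep S T \<longleftrightarrow> 0 < (N::nat) \<and> rep (0::nat) = \<one> \<and>
    (\<forall>j<N. 0 < j \<longrightarrow> (\<exists>i<j. (i \<notin> U \<and> S i = (j, \<one>) \<and> rep j = rep i \<otimes> x) \<or>
      (T i = (j, \<one>) \<and> rep j = rep i \<otimes> y)))"

text \<open>Injectivity says that the N |K| known points are distinct cosets; D may have further
  cosets not met so far.\<close>

definition sat where
  "sat D N U rep S T \<longleftrightarrow> subgroup D G \<and> D \<inter> K = {\<one>} \<and> inj_on (\<lambda>p. D #> rp rep p) (pts N) \<and>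
    (\<forall>j<N. j \<notin> U \<longrightarrow> D #> (rep j \<otimes> x) = D #> rp rep (S j)) \<and>
    (\<forall>j<N. D #> (rep j \<otimes> y) = D #> rp rep (T j))"

lemma validD:
  assumes "valid N U rep S T"
  shows "U \<subseteq> {..<N}" "j < N \<Longrightarrow> rep j \<in> carrier G"
    "j < N \<Longrightarrow> j \<notin> U \<Longrightarrow> fst (S j) < N" "j < N \<Longrightarrow> j \<notin> U \<Longrightarrow> fst (S j) \<notin> U"
    "j < N \<Longrightarrow> j \<notin> U \<Longrightarrow> snd (S j) \<in> K"
    "j < N \<Longrightarrow> j \<notin> U \<Longrightarrow> S (fst (S j)) = (j, z \<otimes> inv (snd (S j)))"
    "j < N \<Longrightarrow> fst (T j) < N" "j < N \<Longrightarrow> snd (T j) \<in> K"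
    "p \<in> pts N \<Longrightarrow> (ext T ^^ q) p = (fst p, z \<otimes> snd p)"
  using assms unfolding valid_def by blast+

lemma satD:
  assumes "sat D N U rep S T"
  shows "subgroup D G" "D \<inter> K = {\<one>}" "inj_on (\<lambda>p. D #> rp rep p) (pts N)"
    "j < N \<Longrightarrow> j \<notin> U \<Longrightarrow> D #> (rep j \<otimes> x) = D #> rp rep (S j)"
    "j < N \<Longrightarrow> D #> (rep j \<otimes> y) = D #> rp rep (T j)"
  using assms unfolding sat_def by blast+

lemma rp_closed:
  assumes "valid N U rep S T" "p \<in> pts N" shows "rp rep p \<in> carrier G"
  using validD(2)[OF assms(1)] assms(2) by (auto simp: rp_def)

lemma ext_Y_closed:
  assumes "valid N U rep S T" "p \<in> pts N" shows "ext T p \<in> pts N"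
  using validD(7,8)[OF assms(1)] assms(2) by (auto simp: ext_label_def)

lemma sat_y:
  assumes v: "valid N U rep S T" and s: "sat D N U rep S T" and p: "p \<in> pts N"
  shows "D #> (rp rep p \<otimes> y) = D #> rp rep (ext T p)"
proof -
  obtain j k where jk: "p = (j, k)" "j < N" "k \<in> K" using p by auto
  note c = validD(2)[OF v jk(2)] validD(2)[OF v validD(7)[OF v jk(2)]] validD(8)[OF v jk(2)]
  have "D #> (rp rep p \<otimes> y) = D #> (rep j \<otimes> y \<otimes> k)"
    using jk c by (simp add: rp_def m_assoc y_comm)
  also have "\<dots> = D #> (rp rep (T j) \<otimes> k)"
    by (rule coset_cong[OF satD(1)[OF s]]) (use jk c satD(5)[OF s] in \<open>auto simp: rp_def\<close>)
  also have "rp rep (T j) \<otimes> k = rp rep (ext T p)"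
    using jk c by (simp add: rp_def ext_label_def m_assoc)
  finally show ?thesis .
qed

lemma sat_x:
  assumes v: "valid N U rep S T" and s: "sat D N U rep S T" and p: "p \<in> pts N" "fst p \<notin> U"
  shows "D #> (rp rep p \<otimes> x) = D #> rp rep (ext S p)"
proof -
  obtain j k where jk: "p = (j, k)" "j < N" "k \<in> K" "j \<notin> U" using p by auto
  note c = validD(2)[OF v jk(2)] validD(2)[OF v validD(3)[OF v jk(2,4)]] validD(5)[OF v jk(2,4)]
  have "D #> (rp rep p \<otimes> x) = D #> (rep j \<otimes> x \<otimes> k)"
    using jk c by (simp add: rp_def m_assoc x_comm)
  also have "\<dots> = D #> (rp rep (S j) \<otimes> k)"
    by (rule coset_cong[OF satD(1)[OF s]]) (use jk c satD(4)[OF s] in \<open>auto simp: rp_def\<close>)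
  also have "rp rep (S j) \<otimes> k = rp rep (ext S p)"
    using jk c by (simp add: rp_def ext_label_def m_assoc)
  finally show ?thesis .
qed

section \<open>Cosets met so far\<close>

definition explored where "explored D N rep = (\<lambda>p. D #> rp rep p) ` pts N"

lemma explored_K:
  assumes "valid N U rep S T" "sat D N U rep S T" "a \<in> carrier G" "k \<in> K"
    and "D #> a \<in> explored D N rep"
  shows "D #> (a \<otimes> k) \<in> explored D N rep"
proof -
  obtain p where p: "p \<in> pts N" "D #> a = D #> rp rep p" using assms(5) by (auto simp: explored_def)
  have "D #> (a \<otimes> k) = D #> (rp rep p \<otimes> k)"
    by (rule coset_cong) (use assms p satD rp_closed in auto)
  also have "rp rep p \<otimes> k = rp rep (fst p, snd p \<otimes> k)"
    using p assms validD(2)[OF assms(1)] by (auto simp: rp_def m_assoc)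
  finally show ?thesis using p assms by (auto simp: explored_def)
qed

lemma explored_y:
  assumes "valid N U rep S T" "sat D N U rep S T" "a \<in> carrier G"
    and "D #> a \<in> explored D N rep"
  shows "D #> (a \<otimes> y) \<in> explored D N rep"
proof -
  obtain p where p: "p \<in> pts N" "D #> a = D #> rp rep p" using assms(4) by (auto simp: explored_def)
  have "D #> (a \<otimes> y) = D #> (rp rep p \<otimes> y)"
    by (rule coset_cong) (use assms p satD rp_closed in auto)
  also have "\<dots> = D #> rp rep (ext T p)" using sat_y assms p by blast
  finally show ?thesis using ext_Y_closed[OF assms(1) p(1)] by (auto simp: explored_def)
qed

lemma explored_y_pow:
  assumes "valid N U rep S T" "sat D N U rep S T" "a \<in> carrier G"
    and "D #> a \<in> explored D N rep"
  shows "D #> (a \<otimes> y [^] (n::nat)) \<in> explored D N rep"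
proof (induction n)
  case (Suc n)
  then show ?case using explored_y[OF assms(1,2), of "a \<otimes> y [^] n"] assms(3) by (simp add: m_assoc)
qed (use assms in simp)

text \<open>Forward closure is enough: remove k, continue by y^(q-i) to the coset of a z, and remove
  z, which lies in K.\<close>

lemma explored_y_back:
  assumes "valid N U rep S T" "sat D N U rep S T" "a \<in> carrier G" "k \<in> K" "i < q"
    and "D #> (a \<otimes> y [^] i \<otimes> k) \<in> explored D N rep"
  shows "D #> a \<in> explored D N rep"
proof -
  have "D #> (a \<otimes> y [^] i \<otimes> k \<otimes> inv k) \<in> explored D N rep"
    by (rule explored_K) (use assms in auto)
  then have "D #> (a \<otimes> y [^] i) \<in> explored D N rep" using assms by (simp add: m_assoc)
  then have "D #> (a \<otimes> y [^] i \<otimes> y [^] (q - i)) \<in> explored D N rep"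
    using explored_y_pow[OF assms(1,2), of "a \<otimes> y [^] i" "q - i"] assms by simp
  then have "D #> (a \<otimes> z) \<in> explored D N rep"
    using assms by (simp add: m_assoc nat_pow_mult y_pow_q)
  then have "D #> (a \<otimes> z \<otimes> inv z) \<in> explored D N rep"
    using explored_K[OF assms(1,2), of "a \<otimes> z" "inv z"] assms by simp
  then show ?thesis using assms by (simp add: m_assoc)
qed

section \<open>Joining two open points by an x-edge\<close>

text \<open>The reverse label is forced: D r_j x = D r_i c gives D r_j z = D r_i x c. For i = j the
  second update overwrites the first, which does no harm because c c = z makes the two labels
  equal.\<close>

definition join where
  "join S j i c = S(j := (i, c), i := (j, z \<otimes> inv c))"

lemma z_inv_inv: "c \<in> K \<Longrightarrow> z \<otimes> inv (z \<otimes> inv c) = c"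
proof -
  assume c: "c \<in> K"
  have "z \<otimes> inv (z \<otimes> inv c) = z \<otimes> (c \<otimes> inv z)" using c by (simp add: inv_mult_group)
  also have "\<dots> = (z \<otimes> c) \<otimes> inv z" using c by (simp add: m_assoc del: inv_mult_group)
  also have "\<dots> = (c \<otimes> z) \<otimes> inv z" using z_comm[OF c] by simp
  also have "\<dots> = c \<otimes> (z \<otimes> inv z)" by (rule m_assoc) (use c in auto)
  also have "\<dots> = c" using c r_inv[of z] by simp
  finally show ?thesis .
qed

lemma z_inv_square:
  assumes "c \<in> K" "c \<otimes> c = z" shows "z \<otimes> inv c = c"
  unfolding assms(2)[symmetric] using assms(1) by (simp add: m_assoc)

lemma valid_join:
  assumes v: "valid N U rep S T" and ji: "j \<in> U" "i \<in> U" and c: "c \<in> K" "i = j \<Longrightarrow> c \<otimes> c = z"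
  shows "valid N (U - {i, j}) rep (join S j i c) T"
proof -
  have lt: "j < N" "i < N" using validD(1)[OF v] ji by auto
  have *: "fst (join S j i c l) < N \<and> fst (join S j i c l) \<notin> U - {i, j} \<and>
      snd (join S j i c l) \<in> K \<and>
      join S j i c (fst (join S j i c l)) = (l, z \<otimes> inv (snd (join S j i c l)))"
    if l: "l < N" "l \<notin> U - {i, j}" for l
  proof (cases "l = i \<or> l = j")
    case True
    then show ?thesis using lt c z_inv_inv[OF c(1)] z_inv_square[OF c(1)]
      by (cases "i = j") (auto simp: join_def)
  next
    case False
    then have "l \<notin> U" using l by auto
    note D = validD(3-6)[OF v l(1) this]
    have ne: "fst (S l) \<noteq> i" "fst (S l) \<noteq> j" using D(2) ji by auto
    then show ?thesis using False D by (auto simp: join_def)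
  qed
  then show ?thesis using v unfolding valid_def by auto
qed

text \<open>Tree edges along x start outside U, where \<open>join\<close> leaves S
  unchanged.\<close>

lemma tree_join:
  assumes "tree N U rep S T" "j \<in> U" "i \<in> U"
  shows "tree N (U - {i, j}) rep (join S j i c) T"
proof -
  have "join S j i c l = S l" if "l \<notin> U" for l using that assms by (auto simp: join_def)
  then show ?thesis using assms(1) unfolding tree_def by (metis DiffD1)
qed

text \<open>A join imposes one condition, not two: multiplying the equation at j by x c^-1 yields
  the one at i (\<open>back_x\<close>).\<close>

lemma sat_join:
  assumes v: "valid N U rep S T" and ji: "j \<in> U" "i \<in> U" and c: "c \<in> K" "i = j \<Longrightarrow> c \<otimes> c = z"
  shows "sat D N (U - {i, j}) rep (join S j i c) T \<longleftrightarrow>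
    sat D N U rep S T \<and> D #> (rep j \<otimes> x) = D #> (rep i \<otimes> c)"
proof -
  have lt: "j < N" "i < N" using validD(1)[OF v] ji by auto
  have cl: "rep j \<in> carrier G" "rep i \<in> carrier G" using validD(2)[OF v] lt by auto
  have old: "join S j i c l = S l" if "l \<notin> U" for l using that ji by (auto simp: join_def)
  have j: "rp rep (join S j i c j) = rep i \<otimes> c"
    using z_inv_square[OF c(1)] c by (auto simp: join_def rp_def)
  have i: "rp rep (join S j i c i) = rep j \<otimes> (z \<otimes> inv c)"
    by (auto simp: join_def rp_def)
  have back_x: "D #> (rep i \<otimes> x) = D #> (rep j \<otimes> (z \<otimes> inv c))"
    if "subgroup D G" and eq: "D #> (rep j \<otimes> x) = D #> (rep i \<otimes> c)"
  proof -
    have "D #> (rep j \<otimes> x \<otimes> (x \<otimes> inv c)) = D #> (rep i \<otimes> c \<otimes> (x \<otimes> inv c))"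
      by (rule coset_cong[OF that(1) _ _ _ eq]) (use cl c in auto)
    moreover have "rep i \<otimes> c \<otimes> (x \<otimes> inv c) = rep i \<otimes> x"
    proof -
      have "rep i \<otimes> c \<otimes> (x \<otimes> inv c) = rep i \<otimes> ((c \<otimes> x) \<otimes> inv c)"
        using cl c(1) by (simp add: m_assoc)
      also have "\<dots> = rep i \<otimes> x" using cl c(1) unfolding x_comm[OF c(1)] by (simp add: m_assoc)
      finally show ?thesis .
    qed
    moreover have "rep j \<otimes> x \<otimes> (x \<otimes> inv c) = rep j \<otimes> (z \<otimes> inv c)"
      using cl c(1) by (simp add: m_assoc)
    ultimately show ?thesis by simp
  qed
  show ?thesis
  proof
    assume s: "sat D N (U - {i, j}) rep (join S j i c) T"
    have "D #> (rep l \<otimes> x) = D #> rp rep (S l)" if "l < N" "l \<notin> U" for l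
      using satD(4)[OF s, of l] old[of l] that by auto
    moreover have "D #> (rep j \<otimes> x) = D #> (rep i \<otimes> c)"
      using satD(4)[OF s, of j] lt unfolding j by auto
    ultimately show "sat D N U rep S T \<and> D #> (rep j \<otimes> x) = D #> (rep i \<otimes> c)"
      using s unfolding sat_def by blast
  next
    assume *: "sat D N U rep S T \<and> D #> (rep j \<otimes> x) = D #> (rep i \<otimes> c)"
    then have s: "sat D N U rep S T" and e: "D #> (rep j \<otimes> x) = D #> (rep i \<otimes> c)" by auto
    have "D #> (rep l \<otimes> x) = D #> rp rep (join S j i c l)" if l: "l < N" "l \<notin> U - {i, j}" for l
    proof -
      consider "l = j" | "l = i" | "l \<notin> U" using l by auto
      then show ?thesis
      proof cases
        case 1 show ?thesis unfolding 1 j by (rule e)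
      next
        case 2 show ?thesis unfolding 2 i by (rule back_x[OF satD(1)[OF s] e])
      next
        case 3 then show ?thesis using satD(4)[OF s l(1)] old by simp
      qed
    qed
    then show "sat D N (U - {i, j}) rep (join S j i c) T" using s unfolding sat_def by blast
  qed
qed

section \<open>Attaching a new y-orbit\<close>

definition add_rep where "add_rep N rep g l = (if l < N then rep l else g \<otimes> y [^] (l - N :: nat))"

text \<open>With g y^i representing the i-th new point, all labels on the cycle are one except the
  closing label c. For s = 1 the cycle is a loop at N.\<close>

definition add_cycle where
  "add_cycle N T s c l = (if l < N then T l else if Suc l < N + s then (Suc l, \<one>) else (N, c))"

text \<open>The parameter F lets the same notation serve \<open>valid\<close>, \<open>tree\<close>,
  \<open>sat D\<close> and \<open>sats I\<close>. \<open>visit\<close> is \<open>attach\<close> with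
  g = \<open>rep j\<close> x followed by joining j to N; the label is one because g itself
  represents N.\<close>

abbreviation (input) attach where
  "attach F N U rep S T g s c \<equiv>
    F (N + s) (U \<union> {N..<N + s}) (add_rep N rep g) S (add_cycle N T s c)"

abbreviation (input) visit where
  "visit F N U rep S T j s c \<equiv>
    F (N + s) (U \<union> {N..<N + s} - {N, j}) (add_rep N rep (rep j \<otimes> x)) (join S j N \<one>) (add_cycle N T s c)"

text \<open>The two ways in which y^q can act as z on such a cycle: q turns around a loop contribute
  c^q, one turn around a q-cycle contributes c.\<close>

definition cycle_label where "cycle_label s c \<longleftrightarrow> c \<in> K \<and> (s = 1 \<and> c [^] q = z \<or> s = q \<and> c = z)"

lemma cycle_labelD:
  assumes "cycle_label s c" shows "c \<in> K" "0 < s" "s \<le> q"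
  using assms Suc_leI[OF q_pos] unfolding cycle_label_def by auto

lemma ext_add_cycle_pow:
  assumes "\<And>j. j < N \<Longrightarrow> fst (T j) < N \<and> snd (T j) \<in> K" "p \<in> pts N"
  shows "(ext (add_cycle N T s c) ^^ n) p = (ext T ^^ n) p \<and> (ext T ^^ n) p \<in> pts N"
proof (induction n)
  case (Suc n)
  obtain j k where jk: "(ext T ^^ n) p = (j, k)" "j < N" "k \<in> K" using Suc by auto
  then have "(ext (add_cycle N T s c) ^^ n) p = (j, k)" using Suc by simp
  moreover have "ext (add_cycle N T s c) (j, k) = ext T (j, k)" "ext T (j, k) \<in> pts N"
    using assms(1)[OF jk(2)] jk by (simp_all add: ext_label_def add_cycle_def)
  ultimately show ?case using jk(1) by simp
qed (use assms(2) in simp)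

lemma ext_new_cycle:
  assumes c: "cycle_label s c" and p: "N \<le> fst p" "fst p < N + s" "snd p \<in> K"
  shows "(ext (add_cycle N T s c) ^^ q) p = (fst p, z \<otimes> snd p)"
proof -
  let ?f = "ext (add_cycle N T s c)"
  have cK: "c \<in> K" using c by (rule cycle_labelD)
  have up: "(?f ^^ i) (N, k) = (N + i, k)" if "i < s" "k \<in> K" for i k
    using that
  proof (induction i)
    case (Suc i) then show ?case by (simp add: ext_label_def add_cycle_def)
  qed simp
  have around: "(?f ^^ s) (N, k) = (N, c \<otimes> k)" if "k \<in> K" for k
  proof -
    obtain s' where s: "s = Suc s'" using cycle_labelD(2)[OF c] by (cases s) auto
    show ?thesis using up[of s' k] that s by (simp add: ext_label_def add_cycle_def)
  qed
  have base: "(?f ^^ q) (N, k) = (N, z \<otimes> k)" if k: "k \<in> K" for k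
  proof (cases "s = q \<and> c = z")
    case True then show ?thesis using around[OF k] by simp
  next
    case False
    then have s1: "s = 1" and cq: "c [^] q = z" using c by (auto simp: cycle_label_def)
    have "(?f ^^ n) (N, k) = (N, c [^] n \<otimes> k)" for n
    proof (induction n)
      case (Suc n)
      have "?f (N, c [^] n \<otimes> k) = (N, c \<otimes> (c [^] n \<otimes> k))"
        using around[of "c [^] n \<otimes> k"] s1 cK k by simp
      also have "c \<otimes> (c [^] n \<otimes> k) = c [^] Suc n \<otimes> k"
        using cK k nat_pow_Suc2[of c n] by (simp add: m_assoc del: nat_pow_Suc)
      finally show ?case using Suc by simp
    qed (use k in simp)
    then show ?thesis using cq by simp
  qed
  define i where "i = fst p - N"
  have i: "i < s" "p = (N + i, snd p)" using p by (auto simp: i_def prod_eq_iff)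
  \<comment> \<open>The point p is the i-th iterate of (N, snd p), and iterates commute, so the
    start of the cycle decides.\<close>
  have "(?f ^^ q) p = (?f ^^ q) ((?f ^^ i) (N, snd p))" using up[OF i(1) p(3)] i(2) by simp
  also have "\<dots> = (?f ^^ i) ((?f ^^ q) (N, snd p))"
    by (metis add.commute comp_apply funpow_add)
  also have "\<dots> = (N + i, z \<otimes> snd p)" using base up[OF i(1)] p(3) by simp
  finally show ?thesis using i by (metis fst_conv)
qed

lemma valid_add:
  assumes v: "valid N U rep S T" and g: "g \<in> carrier G" and c: "cycle_label s c"
  shows "attach valid N U rep S T g s c"
proof -
  have "(ext (add_cycle N T s c) ^^ q) p = (fst p, z \<otimes> snd p)" if p: "p \<in> pts (N + s)" for p
  proof (cases "fst p < N")
    case True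
    then have "p \<in> pts N" using p by auto
    then show ?thesis using validD(7,8,9)[OF v] ext_add_cycle_pow[where N = N and T = T and p = p and s = s and c = c and n = q] by simp
  next
    case False
    then show ?thesis using p by (intro ext_new_cycle[OF c]) auto
  qed
  moreover have "fst (add_cycle N T s c j) < N + s \<and> snd (add_cycle N T s c j) \<in> K" if "j < N + s" for j
    using that validD(7,8)[OF v, of j] cycle_labelD[OF c] by (auto simp: add_cycle_def)
  moreover have "fst (S j) < N + s \<and> fst (S j) \<notin> U \<union> {N..<N + s}"
    if "j < N + s" "j \<notin> U \<union> {N..<N + s}" for j
    using that validD(3,4)[OF v, of j] by auto
  ultimately show ?thesis
    using validD[OF v] g unfolding valid_def by (auto simp: add_rep_def subset_eq)
qed

lemma rp_add_old:
  assumes "p \<in> pts N" shows "rp (add_rep N rep g) p = rp rep p"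
  using assms by (auto simp: rp_def add_rep_def)

text \<open>The inner y-edges hold by the choice of the representatives g y^i, so the new conditions
  are the closing edge and the distinctness of the new points.\<close>

lemma sat_add:
  assumes v: "valid N U rep S T" and g: "g \<in> carrier G" and c: "cycle_label s c"
  shows "attach (sat D) N U rep S T g s c \<longleftrightarrow>
    sat D N U rep S T \<and> inj_on (\<lambda>p. D #> rp (add_rep N rep g) p) (pts (N + s)) \<and>
    D #> (g \<otimes> y [^] s) = D #> (g \<otimes> c)" (is "?L \<longleftrightarrow> ?R")
proof -
  have repold: "add_rep N rep g l = rep l" if "l < N" for l using that by (simp add: add_rep_def)
  have Told: "rp (add_rep N rep g) (add_cycle N T s c l) = rp rep (T l)" if "l < N" for l
    using that rp_add_old[of "T l" N rep g] validD(7,8)[OF v that] by (auto simp: add_cycle_def mem_Times_iff)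
  have Sold: "rp (add_rep N rep g) (S l) = rp rep (S l)" if "l < N" "l \<notin> U" for l
    using that rp_add_old[of "S l" N rep g] validD(3,5)[OF v that] by (auto simp: mem_Times_iff)
  have sub: "pts N \<subseteq> pts (N + s)" by auto
  have last: "add_rep N rep g (N + (s - 1)) \<otimes> y = g \<otimes> y [^] s"
  proof -
    obtain s' where "s = Suc s'" using cycle_labelD(2)[OF c] by (cases s) auto
    then show ?thesis using g by (simp add: add_rep_def m_assoc)
  qed
  have lastc: "rp (add_rep N rep g) (add_cycle N T s c (N + (s - 1))) = g \<otimes> c"
    using cycle_labelD(2)[OF c] g by (auto simp: add_cycle_def rp_def add_rep_def)
  have mid: "add_rep N rep g l \<otimes> y = rp (add_rep N rep g) (add_cycle N T s c l)"
    if "N \<le> l" "Suc l < N + s" for l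
  proof -
    have "Suc l - N = Suc (l - N)" using that by simp
    then show ?thesis using that g by (simp add: add_cycle_def rp_def add_rep_def m_assoc)
  qed
  show ?thesis
  proof
    assume s: ?L
    have "inj_on (\<lambda>p. D #> rp (add_rep N rep g) p) (pts N)"
      using inj_on_subset[OF satD(3)[OF s] sub] .
    then have "inj_on (\<lambda>p. D #> rp rep p) (pts N)"
      by (rule inj_on_cong[THEN iffD1, rotated]) (simp add: rp_add_old)
    moreover have "D #> (rep l \<otimes> x) = D #> rp rep (S l)" if "l < N" "l \<notin> U" for l
      using satD(4)[OF s, of l] that repold Sold by simp
    moreover have "D #> (rep l \<otimes> y) = D #> rp rep (T l)" if "l < N" for l
      using satD(5)[OF s, of l] that repold Told by simp
    moreover have "D #> (g \<otimes> y [^] s) = D #> (g \<otimes> c)"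
      using satD(5)[OF s, of "N + (s - 1)"] cycle_labelD(2)[OF c] unfolding last lastc by simp
    ultimately show ?R using satD(1,2,3)[OF s] unfolding sat_def by blast
  next
    assume r: ?R
    then have s: "sat D N U rep S T" by blast
    have "D #> (add_rep N rep g l \<otimes> x) = D #> rp (add_rep N rep g) (S l)"
      if "l < N + s" "l \<notin> U \<union> {N..<N + s}" for l
      using satD(4)[OF s, of l] that repold[of l] Sold[of l] by auto
    moreover have "D #> (add_rep N rep g l \<otimes> y) = D #> rp (add_rep N rep g) (add_cycle N T s c l)"
      if l: "l < N + s" for l
    proof -
      consider "l < N" | "N \<le> l" "Suc l < N + s" | "l = N + (s - 1)" using l cycle_labelD(2)[OF c] by linarith
      then show ?thesis
      proof cases
        case 1 then show ?thesis using satD(5)[OF s 1] repold Told by simp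
      next
        case 2 then show ?thesis using mid by simp
      next
        case 3 show ?thesis unfolding 3 last lastc using r by blast
      qed
    qed
    ultimately show ?L using r satD(1,2)[OF s] unfolding sat_def by blast
  qed
qed

lemma tree_add_join:
  assumes v: "valid N U rep S T" and t: "tree N U rep S T" and j: "j \<in> U" and c: "cycle_label s c"
  shows "visit tree N U rep S T j s c"
proof -
  let ?rep = "add_rep N rep (rep j \<otimes> x)" and ?T = "add_cycle N T s c" and ?S = "join S j N \<one>"
  have jN: "j < N" and rj: "rep j \<in> carrier G" using validD(1,2)[OF v] j by auto
  have "\<exists>i<l. (i \<notin> U \<union> {N..<N + s} - {N, j} \<and> ?S i = (l, \<one>) \<and> ?rep l = ?rep i \<otimes> x) \<or>
      (?T i = (l, \<one>) \<and> ?rep l = ?rep i \<otimes> y)" if l: "l < N + s" "0 < l" for l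
  proof -
    consider "l < N" | "l = N" | "N < l" by linarith
    then show ?thesis
    proof cases
      case 1
      then obtain i where i: "i < l" "(i \<notin> U \<and> S i = (l, \<one>) \<and> rep l = rep i \<otimes> x) \<or>
        (T i = (l, \<one>) \<and> rep l = rep i \<otimes> y)" using t l(2) unfolding tree_def by blast
      have "?S i = S i" if "i \<notin> U" using that i 1 j by (auto simp: join_def)
      moreover have "?T i = T i" "?rep i = rep i" "?rep l = rep l" using i 1 by (auto simp: add_cycle_def add_rep_def)
      ultimately show ?thesis using i 1 by (intro exI[of _ i]) auto
    next
      case 2
      then show ?thesis using jN rj by (intro exI[of _ j]) (auto simp: join_def add_rep_def)
    next
      case 3
      then obtain l' where l': "l = Suc l'" "N \<le> l'" by (cases l) auto
      have "Suc l' - N = Suc (l' - N)" using l' by simp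
      then show ?thesis using l l' rj by (intro exI[of _ l']) (simp add: add_cycle_def add_rep_def m_assoc)
    qed
  qed
  then show ?thesis using t jN unfolding tree_def by (auto simp: add_rep_def)
qed

lemma tree_initial:
  assumes c: "cycle_label s c"
  shows "tree s {0..<s} (add_rep 0 rep \<one>) S (add_cycle 0 T s c)"
  unfolding tree_def
proof (intro conjI allI impI)
  fix l :: nat assume l: "l < s" "0 < l"
  then obtain l' where "l = Suc l'" by (cases l) auto
  then show "\<exists>i<l. (i \<notin> {0..<s} \<and> S i = (l, \<one>) \<and> add_rep 0 rep \<one> l = add_rep 0 rep \<one> i \<otimes> x) \<or>
      (add_cycle 0 T s c i = (l, \<one>) \<and> add_rep 0 rep \<one> l = add_rep 0 rep \<one> i \<otimes> y)"
    using l by (intro exI[of _ l']) (simp add: add_cycle_def add_rep_def)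
qed (use cycle_labelD[OF c] in \<open>auto simp: add_rep_def\<close>)

text \<open>Otherwise y^e would preserve the K-orbit of the coset of g for some 0 < e < q. As q is
  prime, e a = q b + 1 for suitable a and b, and y^q lies in K; so y itself would preserve it,
  against \<open>new\<close>.\<close>

lemma y_orbit_free:
  assumes D: "subgroup D G" "D \<inter> K = {\<one>}" and g: "g \<in> carrier G"
    and new: "\<And>c. c \<in> K \<Longrightarrow> D #> (g \<otimes> y) \<noteq> D #> (g \<otimes> c)"
    and i: "i < i'" "i' < q" and k: "k \<in> K" "k' \<in> K"
  shows "D #> (g \<otimes> y [^] i \<otimes> k) \<noteq> D #> (g \<otimes> y [^] i' \<otimes> k')"
proof
  assume eq: "D #> (g \<otimes> y [^] i \<otimes> k) = D #> (g \<otimes> y [^] i' \<otimes> k')"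
  define e where "e = i' - i"
  have i': "i' = i + e" using i by (simp add: e_def)
  have e: "0 < e" "e < q" using i by (auto simp: e_def)
  \<comment> \<open>Multiplication by \<open>?h\<close> moves the coincidence to the start of the
    orbit; the K-part \<open>?k\<close> remains and commutes with powers of y.\<close>
  let ?h = "inv k \<otimes> inv (y [^] i)" and ?k = "k' \<otimes> inv k"
  have kK: "?k \<in> K" using k by simp
  have "D #> (g \<otimes> y [^] i \<otimes> k \<otimes> ?h) = D #> (g \<otimes> y [^] i' \<otimes> k' \<otimes> ?h)"
    by (rule coset_cong[OF D(1) _ _ _ eq]) (use g k in auto)
  moreover have "g \<otimes> y [^] i \<otimes> k \<otimes> ?h = g"
  proof -
    have "g \<otimes> y [^] i \<otimes> k \<otimes> ?h = g \<otimes> (y [^] i \<otimes> ((k \<otimes> inv k) \<otimes> inv (y [^] i)))"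
      using g k by (simp only: m_assoc m_closed nat_pow_closed y_closed K_closed K_inv inv_closed)
    also have "\<dots> = g" using g k by simp
    finally show ?thesis .
  qed
  moreover have "g \<otimes> y [^] i' \<otimes> k' \<otimes> ?h = g \<otimes> y [^] e \<otimes> ?k"
  proof -
    have "g \<otimes> y [^] i' \<otimes> k' \<otimes> ?h = g \<otimes> (y [^] i' \<otimes> (?k \<otimes> inv (y [^] i)))"
      using g k by (simp add: m_assoc)
    also have "\<dots> = g \<otimes> (y [^] e \<otimes> y [^] i \<otimes> (?k \<otimes> inv (y [^] i)))"
      by (simp add: i' nat_pow_mult add.commute)
    also have "g \<otimes> (y [^] e \<otimes> y [^] i \<otimes> (?k \<otimes> inv (y [^] i))) =
        g \<otimes> (y [^] e \<otimes> ((y [^] i \<otimes> ?k) \<otimes> inv (y [^] i)))"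
      using g kK by (simp only: m_assoc m_closed nat_pow_closed y_closed K_closed inv_closed)
    also have "y [^] i \<otimes> ?k = ?k \<otimes> y [^] i" using y_pow_comm[OF kK] by simp
    also have "(?k \<otimes> y [^] i) \<otimes> inv (y [^] i) = ?k" using kK by (simp only: m_assoc r_inv nat_pow_closed y_closed inv_closed K_closed r_one)
    finally show ?thesis using g kK by (simp only: m_assoc nat_pow_closed y_closed K_closed)
  qed
  ultimately have step: "D #> g = D #> (g \<otimes> y [^] e \<otimes> ?k)" by simp
  have iter: "\<exists>c\<in>K. D #> g = D #> (g \<otimes> y [^] (e * n) \<otimes> c)" for n
  proof (induction n)
    case 0
    show ?case using g by (intro bexI[of _ \<one>]) auto
  next
    case (Suc n)
    then obtain c where c: "c \<in> K" "D #> g = D #> (g \<otimes> y [^] (e * n) \<otimes> c)" by blast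
    let ?w = "y [^] (e * n) \<otimes> c"
    have "D #> (g \<otimes> ?w) = D #> (g \<otimes> y [^] e \<otimes> ?k \<otimes> ?w)"
      by (rule coset_cong[OF D(1) _ _ _ step]) (use g k c in auto)
    also have "g \<otimes> y [^] e \<otimes> ?k \<otimes> ?w = g \<otimes> (y [^] e \<otimes> ((?k \<otimes> y [^] (e * n)) \<otimes> c))"
      using g kK c(1) by (simp only: m_assoc m_closed nat_pow_closed y_closed K_closed)
    also have "?k \<otimes> y [^] (e * n) = y [^] (e * n) \<otimes> ?k" by (rule y_pow_comm[OF kK])
    also have "g \<otimes> (y [^] e \<otimes> ((y [^] (e * n) \<otimes> ?k) \<otimes> c)) = g \<otimes> ((y [^] e \<otimes> y [^] (e * n)) \<otimes> (?k \<otimes> c))"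
      using g kK c(1) by (simp only: m_assoc m_closed nat_pow_closed y_closed K_closed)
    also have "y [^] e \<otimes> y [^] (e * n) = y [^] (e * Suc n)" by (simp add: nat_pow_mult)
    finally have "D #> g = D #> (g \<otimes> y [^] (e * Suc n) \<otimes> (?k \<otimes> c))"
      using c g kK by (simp only: m_assoc nat_pow_closed y_closed K_closed K_mult)
    then show ?case using kK c(1) K_mult by blast
  qed
  have "coprime e q"
    using prime_q e by (metis coprime_commute nat_dvd_not_less prime_imp_coprime)
  then obtain a where "[e * a = 1] (mod q)" using cong_solve_coprime_nat by auto
  then have "e * a mod q = 1" using q_gt_1 by (simp add: cong_def)
  then obtain b where b: "e * a = q * b + 1" by (metis mult_div_mod_eq)
  obtain c where c: "c \<in> K" "D #> g = D #> (g \<otimes> y [^] (e * a) \<otimes> c)" using iter by blast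
  let ?c = "z [^] b \<otimes> c"
  have cK: "?c \<in> K" using c(1) by simp
  have "g \<otimes> y [^] (e * a) \<otimes> c = g \<otimes> y \<otimes> ?c"
  proof -
    have "y [^] (e * a) = y \<otimes> (y [^] q) [^] b" unfolding b using nat_pow_Suc2[OF y_closed, of "q * b"] by (simp add: nat_pow_pow)
    also have "\<dots> = y \<otimes> z [^] b" using y_pow_q by simp
    finally have e: "y [^] (e * a) = y \<otimes> z [^] b" .
    show ?thesis unfolding e using g c(1) K_closed[OF K_pow[OF z_in_K]] by (simp only: m_assoc m_closed y_closed K_closed z_in_K)
  qed
  then have "D #> g = D #> (g \<otimes> y \<otimes> ?c)" using c(2) by simp
  then have "D #> (g \<otimes> inv ?c) = D #> (g \<otimes> y \<otimes> ?c \<otimes> inv ?c)"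
    by (rule coset_cong[OF D(1), rotated 3]) (use g K_closed[OF cK] in auto)
  also have "g \<otimes> y \<otimes> ?c \<otimes> inv ?c = g \<otimes> y"
    using g K_closed[OF cK] by (simp only: m_assoc m_closed y_closed inv_closed r_inv r_one)
  finally show False using new[of "inv ?c"] K_inv[OF cK] by metis
qed

text \<open>If y sends the coset of g to that of g c with c in K, then y^q = z and freeness give c^q
  = z. Otherwise \<open>y_orbit_free\<close> yields q distinct K-orbits, closed by y^q = z. They
  avoid the old points by \<open>explored_y_back\<close>.\<close>

lemma add_cycle_exhaustive:
  assumes v: "valid N U rep S T" and s: "sat D N U rep S T" and g: "g \<in> carrier G"
    and new: "D #> g \<notin> explored D N rep"
  shows "\<exists>s c. cycle_label s c \<and>
    attach (sat D) N U rep S T g s c"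
proof -
  note D = satD(1,2)[OF s]
  let ?rep = "add_rep N rep g" and ?r = "\<lambda>p. D #> rp (add_rep N rep g) p"
  have rnew: "rp ?rep (N + i, k) = g \<otimes> y [^] i \<otimes> k" for i k by (simp add: rp_def add_rep_def)
  have fresh: "D #> (g \<otimes> y [^] i \<otimes> k) \<notin> explored D N rep" if "i < q" "k \<in> K" for i k
    using explored_y_back[OF v s g that(2,1)] new by blast
  have inj: "inj_on ?r (pts (N + s))"
    if "s \<le> q" and free: "\<And>i i' k k'. i < i' \<Longrightarrow> i' < s \<Longrightarrow> k \<in> K \<Longrightarrow> k' \<in> K \<Longrightarrow>
      D #> (g \<otimes> y [^] i \<otimes> k) \<noteq> D #> (g \<otimes> y [^] i' \<otimes> k')" for s
  proof -
    have old: "?r p = D #> rp rep p" if "p \<in> pts N" for p using rp_add_old[OF that] by simp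
    have inj_old: "inj_on ?r (pts N)"
      by (rule inj_on_cong[THEN iffD2, OF _ satD(3)[OF s]]) (rule old)
    have "inj_on ?r ({N..<N + s} \<times> K)"
    proof (rule inj_onI)
      fix p p' assume p: "p \<in> {N..<N + s} \<times> K" "p' \<in> {N..<N + s} \<times> K" "?r p = ?r p'"
      define i i' where "i = fst p - N" and "i' = fst p' - N"
      have i: "p = (N + i, snd p)" "p' = (N + i', snd p')" "i < s" "i' < s" "snd p \<in> K" "snd p' \<in> K"
        using p by (auto simp: i_def i'_def)
      have e: "D #> (g \<otimes> y [^] i \<otimes> snd p) = D #> (g \<otimes> y [^] i' \<otimes> snd p')"
        using p(3) i(1,2) rnew by metis
      have "i = i'" using free i e by (metis linorder_neqE_nat)
      moreover have "snd p = snd p'"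
        by (rule coset_K_free[OF D _ i(5,6)]) (use e \<open>i = i'\<close> g in auto)
      ultimately show "p = p'" using i by simp
    qed
    moreover have "?r ` pts N \<inter> ?r ` ({N..<N + s} \<times> K) = {}"
    proof -
      have "?r p \<noteq> ?r p'" if p: "p \<in> pts N" "p' \<in> {N..<N + s} \<times> K" for p p'
      proof -
        obtain i k where "p' = (N + i, k)" "i < s" "k \<in> K"
          using p(2) by (metis SigmaE atLeastLessThan_iff le_Suc_ex nat_add_left_cancel_less)
        then have "?r p' \<notin> explored D N rep" using fresh[of i k] rnew[of i k] that(1) \<open>s \<le> q\<close> by simp
        moreover have "?r p \<in> explored D N rep" using old[OF p(1)] p(1) by (auto simp: explored_def)
        ultimately show ?thesis by metis
      qed
      then show ?thesis by blast
    qed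
    moreover have "pts (N + s) = pts N \<union> {N..<N + s} \<times> K" by auto
    ultimately show ?thesis using inj_old by (simp add: inj_on_Un) blast
  qed
  show ?thesis
  proof (cases "\<exists>c\<in>K. D #> (g \<otimes> y) = D #> (g \<otimes> c)")
    case True
    then obtain c where c: "c \<in> K" "D #> (g \<otimes> y) = D #> (g \<otimes> c)" by blast
    have pow: "D #> (g \<otimes> y [^] n) = D #> (g \<otimes> c [^] n)" for n :: nat
    proof (induction n)
      case (Suc n)
      have "D #> (g \<otimes> y [^] n \<otimes> y) = D #> (g \<otimes> c [^] n \<otimes> y)"
        by (rule coset_cong[OF D(1) _ _ _ Suc.IH]) (use g c in auto)
      also have "g \<otimes> c [^] n \<otimes> y = g \<otimes> y \<otimes> c [^] n"
        using g c(1) y_comm[of "c [^] n"] by (simp add: m_assoc)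
      also have "D #> (g \<otimes> y \<otimes> c [^] n) = D #> (g \<otimes> c \<otimes> c [^] n)"
        by (rule coset_cong[OF D(1) _ _ _ c(2)]) (use g c in auto)
      also have "g \<otimes> c \<otimes> c [^] n = g \<otimes> c [^] Suc n"
        using g c(1) nat_pow_Suc2[of c n] by (simp add: m_assoc del: nat_pow_Suc)
      finally show ?case using g by (simp add: m_assoc)
    qed simp
    have "c [^] q = z"
      by (rule coset_K_free[OF D g]) (use c(1) pow[of q] y_pow_q in auto)
    then have l: "cycle_label 1 c" using c(1) by (simp add: cycle_label_def)
    moreover have "inj_on ?r (pts (N + 1))" by (rule inj) (use Suc_leI[OF q_pos] in auto)
    moreover have "D #> (g \<otimes> y [^] (1::nat)) = D #> (g \<otimes> c)" using c(2) by simp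
    ultimately show ?thesis using sat_add[OF v g l] s by blast
  next
    case False
    have l: "cycle_label q z" by (simp add: cycle_label_def)
    have "inj_on ?r (pts (N + q))"
      by (rule inj) (use y_orbit_free[OF D g] False in auto)
    moreover have "D #> (g \<otimes> y [^] q) = D #> (g \<otimes> z)" using y_pow_q by simp
    ultimately show ?thesis using sat_add[OF v g l] s l by blast
  qed
qed

text \<open>Whether y keeps the K-orbit of the coset of g decides s: a loop with label b and a
  q-cycle together would make (N, b) and (N + 1, 1) the same coset. For a loop, freeness then
  decides c.\<close>

lemma add_cycle_unique:
  assumes v: "valid N U rep S T" and g: "g \<in> carrier G"
    and c: "cycle_label s c" "cycle_label s' c'"
    and s: "attach (sat D) N U rep S T g s c"
    and s': "sat D (N + s') (U' \<union> {N..<N + s'}) (add_rep N rep g) S' (add_cycle N T s' c')"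
  shows "s = s' \<and> c = c'"
proof -
  note D = satD(1,2)[OF s]
  have first: "D #> (g \<otimes> y) = D #> (g \<otimes> b)"
    if "sat D (N + 1) A (add_rep N rep g) B (add_cycle N T 1 b)" for b A B
    using satD(5)[OF that, of N] g by (simp add: add_rep_def add_cycle_def rp_def)
  have second: "D #> (g \<otimes> y) = D #> rp (add_rep N rep g) (Suc N, \<one>)"
    if "sat D (N + q) A (add_rep N rep g) B (add_cycle N T q z)" for A B
    using satD(5)[OF that, of N] q_gt_1 g by (simp add: add_rep_def add_cycle_def)
  have clash: False if 1: "sat D (N + 1) A (add_rep N rep g) B (add_cycle N T 1 b)"
    and 2: "sat D (N + q) A' (add_rep N rep g) B' (add_cycle N T q z)" and b: "b \<in> K" for A B A' B' b
  proof -
    have "D #> rp (add_rep N rep g) (N, b) = D #> rp (add_rep N rep g) (Suc N, \<one>)"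
    proof -
      have "rp (add_rep N rep g) (N, b) = g \<otimes> b" using g by (simp add: rp_def add_rep_def)
      then show ?thesis using first[OF 1] second[OF 2] by metis
    qed
    then have "(N, b) = (Suc N, \<one>)"
      by (rule inj_onD[OF satD(3)[OF 2]]) (use b q_gt_1 in auto)
    then show False by simp
  qed
  consider "s = 1" "s' = 1" | "s = 1" "s' = q" "c' = z" | "s = q" "c = z" "s' = 1" | "s = q" "s' = q" "c = z" "c' = z"
    using c by (auto simp: cycle_label_def)
  then show ?thesis
  proof cases
    case 1
    have "c = c'"
      by (rule coset_K_free[OF D g cycle_labelD(1)[OF c(1)] cycle_labelD(1)[OF c(2)]])
        (use first[of _ _ c] first[of _ _ c'] s s' 1 in metis)
    then show ?thesis using 1 by simp
  next
    case 2 then show ?thesis using clash s s' cycle_labelD(1)[OF c(1)] by metis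
  next
    case 3 then show ?thesis using clash s s' cycle_labelD(1)[OF c(2)] by metis
  qed auto
qed

section \<open>Complete explorations\<close>

definition sats where
  "sats I N U rep S T = {D. sat D N U rep S T \<and> finite (rcosets D) \<and> card (rcosets D) = I}"

lemma sats_card_le:
  assumes v: "valid N U rep S T" and D: "D \<in> sats I N U rep S T"
  shows "N * card K \<le> I"
proof -
  have s: "sat D N U rep S T" and f: "finite (rcosets D)" and I: "card (rcosets D) = I"
    using D by (auto simp: sats_def)
  have "card ((\<lambda>p. D #> rp rep p) ` pts N) = N * card K"
    using card_image[OF satD(3)[OF s]] by (simp add: card_cartesian_product)
  moreover have "(\<lambda>p. D #> rp rep p) ` pts N \<subseteq> rcosets D"
    using rp_closed[OF v] by (auto simp: RCOSETS_def)
  ultimately show ?thesis using card_mono[OF f] I by metis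
qed

text \<open>Existence: \<open>universal\<close> turns the labels into an action, transitive by the
  tree, and the stabilizer \<open>D0\<close> of (0, 1) realizes the state. Uniqueness: for every D
  satisfying the state, right multiplication on its cosets copies this action
  (\<open>follow\<close>), so D is the stabilizer too.\<close>

lemma terminal:
  assumes v: "valid N {} rep S T" and t: "tree N {} rep S T"
  shows "\<exists>D. {D. sat D N {} rep S T} = {D} \<and> finite (rcosets D) \<and> card (rcosets D) = N * card K"
proof -
  have N0: "0 < N" and rep0: "rep 0 = \<one>" using t by (auto simp: tree_def)
  have eX: "\<forall>p\<in>pts N. ext S (ext S p) = (fst p, z \<otimes> snd p)"
  proof
    fix p assume p: "p \<in> pts N"
    then obtain j k where jk: "p = (j, k)" "j < N" "k \<in> K" by auto
    define i c where "i = fst (S j)" and "c = snd (S j)"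
    have c: "S j = (i, c)" "c \<in> K" "S i = (j, z \<otimes> inv c)"
      using validD(5,6)[OF v jk(2)] by (auto simp: i_def c_def)
    have "z \<otimes> inv c \<otimes> (c \<otimes> k) = z \<otimes> ((inv c \<otimes> c) \<otimes> k)"
      using c(2) jk(3) K_closed[OF z_in_K] by (simp only: m_assoc m_closed K_closed K_inv)
    also have "\<dots> = z \<otimes> k" using c(2) jk(3) by simp
    finally show "ext S (ext S p) = (fst p, z \<otimes> snd p)" using jk c by (simp add: ext_label_def)
  qed
  have "\<exists>act. (\<forall>g\<in>carrier G. \<forall>p\<in>pts N. act g p \<in> pts N) \<and>
        (\<forall>g\<in>carrier G. \<forall>h\<in>carrier G. \<forall>p\<in>pts N. act (g \<otimes> h) p = act h (act g p)) \<and>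
        (\<forall>p\<in>pts N. act x p = ext S p \<and> act y p = ext T p \<and>
          (\<forall>k\<in>K. act k p = (fst p, snd p \<otimes> k)))"
    by (rule universal[OF _ eX]) (use validD(3,5,7,8,9)[OF v] in blast)+
  then obtain act
    where A: "\<forall>g\<in>carrier G. \<forall>p\<in>pts N. act g p \<in> pts N"
      and B: "\<forall>g\<in>carrier G. \<forall>h\<in>carrier G. \<forall>p\<in>pts N. act (g \<otimes> h) p = act h (act g p)"
      and C: "\<forall>p\<in>pts N. act x p = ext S p \<and> act y p = ext T p \<and>
        (\<forall>k\<in>K. act k p = (fst p, snd p \<otimes> k))"
    by (elim exE conjE)
  have act_in: "act g p \<in> pts N" if "g \<in> carrier G" "p \<in> pts N" for g p
    using A that by blast
  have act_mult: "act (g \<otimes> h) p = act h (act g p)"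
    if "g \<in> carrier G" "h \<in> carrier G" "p \<in> pts N" for g h p
    using B that by blast
  have act_x: "act x p = ext S p" if "p \<in> pts N" for p
    using bspec[OF C that] by (elim conjE)
  have act_y: "act y p = ext T p" if "p \<in> pts N" for p
    using bspec[OF C that] by (elim conjE)
  have act_K: "act k p = (fst p, snd p \<otimes> k)" if "p \<in> pts N" "k \<in> K" for p k
    using bspec[OF C that(1)] that(2) by simp
  have act_one: "act \<one> p = p" if "p \<in> pts N" for p using act_K[OF that, of \<one>] that by auto
  have act_inv: "act (inv g) (act g p) = p" "act g (act (inv g) p) = p" if "g \<in> carrier G" "p \<in> pts N" for g p
    using act_mult[of g "inv g" p] act_mult[of "inv g" g p] that act_one by auto
  let ?o = "(0::nat, \<one>)"
  have o: "?o \<in> pts N" using N0 by simp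
  have rp0: "rp rep ?o = \<one>" by (simp add: rp_def rep0)
  define D0 where "D0 = {g \<in> carrier G. act g ?o = ?o}"
  have follow: "D #> (rp rep p \<otimes> g) = D #> rp rep (act g p)"
    if s: "sat D N {} rep S T" and g: "g \<in> carrier G" and p: "p \<in> pts N" for D g p
  proof -
    note subD = satD(1)[OF s]
    have "g \<in> generate G ({x, y} \<union> K)" using g generated by simp
    then show ?thesis using p
    proof (induction arbitrary: p)
      case one
      have "rp rep p \<otimes> \<one> = rp rep p" using rp_closed[OF v one] by simp
      then show ?case using act_one[OF one] by simp
    next
      case (incl h)
      consider "h = x" | "h = y" | "h \<in> K" using incl by auto
      then show ?case
      proof cases
        case 1 then show ?thesis using sat_x[OF v s incl(2)] act_x[OF incl(2)] by simp
      next
        case 2 then show ?thesis using sat_y[OF v s incl(2)] act_y[OF incl(2)] by simp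
      next
        case 3
        have "rp rep p \<otimes> h = rp rep (act h p)"
          using 3 incl(2) act_K[OF incl(2) 3] validD(2)[OF v] by (auto simp: rp_def m_assoc)
        then show ?thesis by simp
      qed
    next
      case (inv h)
      have h: "h \<in> carrier G" using inv by auto
      \<comment> \<open>Labels record forward edges only, so an inverse letter is treated at the
        preimage p' and then cancelled.\<close>
      define p' where "p' = act (inv h) p"
      have p': "p' \<in> pts N" "act h p' = p" using act_in act_inv(2) inv(2) h by (auto simp: p'_def)
      have "D #> (rp rep p' \<otimes> h) = D #> rp rep p"
      proof -
        consider "h = x" | "h = y" | "h \<in> K" using inv by auto
        then show ?thesis
        proof cases
          case 1 then show ?thesis using sat_x[OF v s p'(1)] act_x[OF p'(1)] p'(2) by simp
        next
          case 2 then show ?thesis using sat_y[OF v s p'(1)] act_y[OF p'(1)] p'(2) by simp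
        next
          case 3
          have "rp rep p' \<otimes> h = rp rep (act h p')"
            using 3 p'(1) act_K[OF p'(1) 3] validD(2)[OF v] by (auto simp: rp_def m_assoc)
          then show ?thesis using p'(2) by simp
        qed
      qed
      then have "D #> (rp rep p' \<otimes> h \<otimes> inv h) = D #> (rp rep p \<otimes> inv h)"
        by (rule coset_cong[OF subD, rotated 3]) (use rp_closed[OF v] p'(1) inv(2) h in auto)
      moreover have "rp rep p' \<otimes> h \<otimes> inv h = rp rep p'" using rp_closed[OF v p'(1)] h by (simp add: m_assoc)
      ultimately show ?case by (simp add: p'_def)
    next
      case (eng h1 h2)
      have h: "h1 \<in> carrier G" "h2 \<in> carrier G" using eng.hyps generated by auto
      have "D #> (rp rep p \<otimes> h1 \<otimes> h2) = D #> (rp rep (act h1 p) \<otimes> h2)"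
        by (rule coset_cong[OF subD _ _ _ eng.IH(1)[OF eng.prems]])
          (use rp_closed[OF v] act_in eng.prems h in auto)
      also have "\<dots> = D #> rp rep (act h2 (act h1 p))" using eng.IH(2) act_in h eng.prems by simp
      finally show ?case using act_mult h eng.prems rp_closed[OF v eng.prems] by (simp add: m_assoc)
    qed
  qed
  have follow0: "D #> g = D #> rp rep (act g ?o)"
    if "sat D N {} rep S T" "g \<in> carrier G" for D g
    using follow[OF that o] that(2) unfolding rp0 by simp
  have uniq: "D = D0" if s: "sat D N {} rep S T" for D
  proof -
    have "g \<in> D \<longleftrightarrow> g \<in> D0" if g: "g \<in> carrier G" for g
    proof -
      have D1: "D #> rp rep ?o = D" unfolding rp0 using satD(1)[OF s] by (simp add: coset_mult_one subgroup.subset)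
      have "g \<in> D \<longleftrightarrow> D #> g = D" using coset_eq_iff_mem[OF satD(1)[OF s] g] by simp
      also have "\<dots> \<longleftrightarrow> D #> rp rep (act g ?o) = D #> rp rep ?o" unfolding follow0[OF s g] D1 ..
      also have "\<dots> \<longleftrightarrow> act g ?o = ?o"
        using inj_on_eq_iff[OF satD(3)[OF s] act_in[OF g o] o] .
      finally show ?thesis using g by (simp add: D0_def)
    qed
    then show ?thesis using subgroup.subset[OF satD(1)[OF s]] by (auto simp: D0_def)
  qed
  \<comment> \<open>Tree edges carry the label one, so no factor from K accumulates on the path from
    0 to j.\<close>
  have reach: "act (rep j) ?o = (j, \<one>)" if "j < N" for j
    using that
  proof (induction j rule: less_induct)
    case (less j)
    show ?case
    proof (cases "j = 0")
      case True then show ?thesis using rep0 act_one[OF o] by simp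
    next
      case False
      then obtain i where i: "i < j" "(S i = (j, \<one>) \<and> rep j = rep i \<otimes> x) \<or> (T i = (j, \<one>) \<and> rep j = rep i \<otimes> y)"
        using t less.prems unfolding tree_def by blast
      have iN: "i < N" "rep i \<in> carrier G" using i(1) less.prems validD(2)[OF v] by auto
      have iP: "(i, \<one>) \<in> pts N" using iN by simp
      from i(2) show ?thesis
      proof
        assume "S i = (j, \<one>) \<and> rep j = rep i \<otimes> x"
        then show ?thesis using act_mult[OF iN(2) x_closed o] less.IH[OF i(1) iN(1)] act_x[OF iP]
          by (simp add: ext_label_def)
      next
        assume "T i = (j, \<one>) \<and> rep j = rep i \<otimes> y"
        then show ?thesis using act_mult[OF iN(2) y_closed o] less.IH[OF i(1) iN(1)] act_y[OF iP]
          by (simp add: ext_label_def)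
      qed
    qed
  qed
  have reach_rp: "act (rp rep p) ?o = p" if "p \<in> pts N" for p
    using that act_mult[of "rep (fst p)" "snd p" ?o] reach[of "fst p"] validD(2)[OF v, of "fst p"]
      act_K[of "(fst p, \<one>)" "snd p"] o by (auto simp: rp_def)
  have subD0: "subgroup D0 G"
  proof (rule subgroupI)
    show "D0 \<noteq> {}" using act_one[OF o] by (auto simp: D0_def)
    show "inv a \<in> D0" if "a \<in> D0" for a
      using that act_inv(1)[of a ?o] o by (auto simp: D0_def)
    show "a \<otimes> b \<in> D0" if "a \<in> D0" "b \<in> D0" for a b
      using that act_mult[OF _ _ o] by (auto simp: D0_def)
  qed (auto simp: D0_def)
  have coset0: "D0 #> a = D0 #> b \<longleftrightarrow> act a ?o = act b ?o" if ab: "a \<in> carrier G" "b \<in> carrier G" for a b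
  proof -
    have "D0 #> a = D0 #> b \<longleftrightarrow> a \<otimes> inv b \<in> D0" by (rule rcoset_eq_iff[OF subD0 ab])
    also have "\<dots> \<longleftrightarrow> act (inv b) (act a ?o) = ?o" using ab act_mult[OF _ _ o] by (simp add: D0_def)
    also have "\<dots> \<longleftrightarrow> act a ?o = act b ?o"
      using act_inv(1)[OF ab(2) o] act_inv(2)[OF ab(2) act_in[OF ab(1) o]] by metis
    finally show ?thesis .
  qed
  have sat0: "sat D0 N {} rep S T"
    unfolding sat_def
  proof (intro conjI allI impI)
    show "subgroup D0 G" by (rule subD0)
    show "D0 \<inter> K = {\<one>}"
      using act_K[OF o] act_one[OF o] by (auto simp: D0_def)
    show "inj_on (\<lambda>p. D0 #> rp rep p) (pts N)"
    proof (rule inj_onI)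
      fix p p' assume p: "p \<in> pts N" "p' \<in> pts N" and e: "D0 #> rp rep p = D0 #> rp rep p'"
      show "p = p'" using coset0[OF rp_closed[OF v p(1)] rp_closed[OF v p(2)]] e reach_rp[OF p(1)] reach_rp[OF p(2)] by simp
    qed
  next
    fix j assume j: "j < N"
    have jP: "(j, \<one>) \<in> pts N" and rj: "rep j \<in> carrier G" using j validD(2)[OF v] by auto
    have SP: "S j \<in> pts N" and TP: "T j \<in> pts N"
      using validD(3,5,7,8)[OF v j] by (auto simp: mem_Times_iff)
    have "act (rep j \<otimes> x) ?o = act (rp rep (S j)) ?o"
      using reach[OF j] reach_rp[OF SP] act_mult[OF rj x_closed o] act_x[OF jP] SP
      by (auto simp: ext_label_def)
    then show "D0 #> (rep j \<otimes> x) = D0 #> rp rep (S j)"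
      using coset0[OF _ rp_closed[OF v SP]] rj by simp
    have "act (rep j \<otimes> y) ?o = act (rp rep (T j)) ?o"
      using reach[OF j] reach_rp[OF TP] act_mult[OF rj y_closed o] act_y[OF jP] TP
      by (auto simp: ext_label_def)
    then show "D0 #> (rep j \<otimes> y) = D0 #> rp rep (T j)"
      using coset0[OF _ rp_closed[OF v TP]] rj by simp
  qed
  have "rcosets D0 = (\<lambda>p. D0 #> rp rep p) ` pts N"
  proof
    show "rcosets D0 \<subseteq> (\<lambda>p. D0 #> rp rep p) ` pts N"
    proof
      fix C assume "C \<in> rcosets D0"
      then obtain g where g: "g \<in> carrier G" "C = D0 #> g" by (auto simp: RCOSETS_def)
      then show "C \<in> (\<lambda>p. D0 #> rp rep p) ` pts N"
        using follow0[OF sat0 g(1)] act_in[OF g(1) o] by (intro image_eqI[of _ _ "act g ?o"]) auto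
    qed
    show "(\<lambda>p. D0 #> rp rep p) ` pts N \<subseteq> rcosets D0"
      using rp_closed[OF v] by (auto simp: RCOSETS_def)
  qed
  moreover have "card ((\<lambda>p. D0 #> rp rep p) ` pts N) = N * card K"
    using card_image[OF satD(3)[OF sat0]] by (simp add: card_cartesian_product)
  moreover have "finite ((\<lambda>p. D0 #> rp rep p) ` pts N)" using finite_K by simp
  ultimately have "finite (rcosets D0)" "card (rcosets D0) = N * card K" by simp_all
  then show ?thesis using sat0 uniq by (intro exI[of _ D0]) blast
qed

section \<open>One step of the exploration\<close>

text \<open>The x-edge from j to N costs nothing, because N is represented by \<open>rep j\<close> x
  itself.\<close>

lemma sat_explore:
  assumes v: "valid N U rep S T" and j: "j \<in> U" and c: "cycle_label s c"
  shows "visit (sat D) N U rep S T j s c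
    \<longleftrightarrow> attach (sat D) N U rep S T (rep j \<otimes> x) s c"
proof -
  have jN: "j < N" and rj: "rep j \<in> carrier G" using validD(1,2)[OF v] j by auto
  have "attach valid N U rep S T (rep j \<otimes> x) s c"
    by (rule valid_add[OF v _ c]) (use rj in simp)
  moreover have "N \<in> U \<union> {N..<N + s}" "j \<in> U \<union> {N..<N + s}"
    using j cycle_labelD(2)[OF c] by auto
  moreover have "N = j \<Longrightarrow> \<one> \<otimes> \<one> = z" using jN by simp
  ultimately show ?thesis using sat_join[of "N + s" "U \<union> {N..<N + s}" _ S _ j N \<one> D] jN rj
    by (simp add: add_rep_def)
qed

lemma valid_explore:
  assumes v: "valid N U rep S T" and j: "j \<in> U" and c: "cycle_label s c"
  shows "visit valid N U rep S T j s c"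
proof -
  have jN: "j < N" and rj: "rep j \<in> carrier G" using validD(1,2)[OF v] j by auto
  have "attach valid N U rep S T (rep j \<otimes> x) s c"
    by (rule valid_add[OF v _ c]) (use rj in simp)
  then show ?thesis
    by (rule valid_join) (use j jN cycle_labelD(2)[OF c] in auto)
qed

definition joins where
  "joins U j = {j} \<times> {c \<in> K. c \<otimes> c = z} \<union> (U - {j}) \<times> K"

definition cycles where
  "cycles = {1} \<times> {c \<in> K. c [^] q = z} \<union> {(q, z)}"

lemma cycles_iff: "(s, c) \<in> cycles \<longleftrightarrow> cycle_label s c"
  by (auto simp: cycles_def cycle_label_def)

lemma joinsD:
  assumes "(i, c) \<in> joins U j" "j \<in> U"
  shows "i \<in> U" "c \<in> K" "i = j \<Longrightarrow> c \<otimes> c = z"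
  using assms by (auto simp: joins_def)

lemma sat_joins:
  assumes v: "valid N U rep S T" and j: "j \<in> U" and ic: "(i, c) \<in> joins U j"
  shows "sat D N (U - {i, j}) rep (join S j i c) T \<longleftrightarrow>
      sat D N U rep S T \<and> D #> (rep j \<otimes> x) = D #> rp rep (i, c)"
  using sat_join[OF v j joinsD[OF ic j]] by (simp add: rp_def)

text \<open>An old point naming the coset of \<open>rep j\<close> x would coincide with the new
  point (N, 1), against injectivity.\<close>

lemma sat_exploreD:
  assumes v: "valid N U rep S T" and j: "j \<in> U" and cl: "cycle_label s c"
    and s': "visit (sat D) N U rep S T j s c"
  shows "sat D N U rep S T" "D #> (rep j \<otimes> x) \<notin> explored D N rep"
proof -
  have rjx: "rep j \<otimes> x \<in> carrier G" using validD(1,2)[OF v] j by auto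
  have s: "attach (sat D) N U rep S T (rep j \<otimes> x) s c"
    using s' sat_explore[OF v j cl] by blast
  show "sat D N U rep S T" using s sat_add[OF v rjx cl] by blast
  show "D #> (rep j \<otimes> x) \<notin> explored D N rep"
  proof
    assume "D #> (rep j \<otimes> x) \<in> explored D N rep"
    then obtain p where p: "p \<in> pts N" "D #> (rep j \<otimes> x) = D #> rp rep p" by (auto simp: explored_def)
    have "rp (add_rep N rep (rep j \<otimes> x)) (N, \<one>) = rep j \<otimes> x" using rjx by (simp add: rp_def add_rep_def)
    then have "D #> rp (add_rep N rep (rep j \<otimes> x)) (N, \<one>) = D #> rp (add_rep N rep (rep j \<otimes> x)) p"
      using p rp_add_old[OF p(1)] by metis
    then have "(N, \<one>) = p"
      by (rule inj_onD[OF satD(3)[OF s]]) (use p(1) cycle_labelD(2)[OF cl] in auto)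
    then show False using p(1) by auto
  qed
qed

text \<open>The split is by the coset of \<open>rep j\<close> x: among the explored ones (a join) or
  not (a new y-orbit).\<close>

lemma sats_split:
  assumes v: "valid N U rep S T" and j: "j \<in> U"
  shows "sats I N U rep S T =
    (\<Union>(i, c)\<in>joins U j. sats I N (U - {i, j}) rep (join S j i c) T) \<union>
    (\<Union>(s, c)\<in>cycles. visit (sats I) N U rep S T j s c)" (is "?L = ?J \<union> ?C")
proof -
  have jN: "j < N" and rj: "rep j \<in> carrier G" using validD(1,2)[OF v] j by auto
  have rjx: "rep j \<otimes> x \<in> carrier G" using rj by simp
  show "?L = ?J \<union> ?C"
  proof
    show "?J \<union> ?C \<subseteq> ?L"
    proof (intro Un_least subsetI)
      fix D assume "D \<in> ?J"
      then obtain i c where "(i, c) \<in> joins U j" "D \<in> sats I N (U - {i, j}) rep (join S j i c) T" by blast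
      then show "D \<in> ?L" using sat_joins[OF v j] by (simp add: sats_def)
    next
      fix D assume "D \<in> ?C"
      then obtain s c where c: "(s, c) \<in> cycles" "D \<in> visit (sats I) N U rep S T j s c" by blast
      then show "D \<in> ?L" using sat_exploreD(1)[OF v j] cycles_iff by (auto simp: sats_def)
    qed
    show "?L \<subseteq> ?J \<union> ?C"
    proof
      fix D assume D: "D \<in> ?L"
      then have s: "sat D N U rep S T" by (simp add: sats_def)
      note subD = satD(1,2)[OF s]
      show "D \<in> ?J \<union> ?C"
      proof (cases "D #> (rep j \<otimes> x) \<in> explored D N rep")
        case True
        then obtain i c where ic: "(i, c) \<in> pts N" and e: "D #> (rep j \<otimes> x) = D #> rp rep (i, c)"
          by (auto simp: explored_def)
        have i: "i < N" "rep i \<in> carrier G" and c: "c \<in> K" using ic validD(2)[OF v] by auto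
        have e': "D #> (rep j \<otimes> z) = D #> (rp rep (i, c) \<otimes> x)"
        proof -
          have "D #> (rep j \<otimes> x \<otimes> x) = D #> (rp rep (i, c) \<otimes> x)"
            by (rule coset_cong[OF subD(1) _ _ _ e]) (use rj rp_closed[OF v ic] in auto)
          then show ?thesis using rj by (simp add: m_assoc)
        qed
        \<comment> \<open>Applying x once more leads back to the K-orbit of j, whereas x-edges of
          closed points end at closed points.\<close>
        have "i \<in> U"
        proof (rule ccontr)
          assume iU: "i \<notin> U"
          have "D #> rp rep (j, z) = D #> rp rep (ext S (i, c))"
            using e' sat_x[OF v s ic] iU by (simp add: rp_def[of rep "(j, z)"])
          moreover have "ext S (i, c) \<in> pts N"
            using validD(3,5)[OF v i(1) iU] c by (auto simp: ext_label_def)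
          ultimately have "(j, z) = ext S (i, c)"
            using inj_onD[OF satD(3)[OF s], of "(j, z)" "ext S (i, c)"] jN by auto
          then have "j = fst (S i)" by (simp add: ext_label_def)
          then show False using validD(4)[OF v i(1) iU] j by simp
        qed
        \<comment> \<open>Going along the loop twice gives the label c c, while x x = z; freeness
          compares the two.\<close>
        moreover have "c \<otimes> c = z" if "i = j"
        proof -
          have "rp rep (i, c) \<otimes> x = rep j \<otimes> x \<otimes> c"
            using that rj c x_comm[OF c] by (simp add: rp_def m_assoc)
          then have "D #> (rep j \<otimes> z) = D #> (rep j \<otimes> x \<otimes> c)" using e' by simp
          also have "\<dots> = D #> (rp rep (i, c) \<otimes> c)"
            by (rule coset_cong[OF subD(1) _ _ _ e]) (use rj c rp_closed[OF v ic] in auto)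
          also have "rp rep (i, c) \<otimes> c = rep j \<otimes> (c \<otimes> c)" using that rj c by (simp add: rp_def m_assoc)
          finally have "z = c \<otimes> c"
            by (rule coset_K_free[OF subD rj, rotated 2]) (use c in auto)
          then show ?thesis by simp
        qed
        ultimately have "(i, c) \<in> joins U j" using c by (auto simp: joins_def)
        then have "D \<in> sats I N (U - {i, j}) rep (join S j i c) T"
          using sat_joins[OF v j] e s D by (simp add: sats_def)
        then show ?thesis using \<open>(i, c) \<in> joins U j\<close> by blast
      next
        case False
        then obtain s' c where c: "cycle_label s' c"
          "attach (sat D) N U rep S T (rep j \<otimes> x) s' c"
          using add_cycle_exhaustive[OF v s rjx] by blast
        have sc: "(s', c) \<in> cycles" using c(1) cycles_iff by blast
        have "D \<in> visit (sats I) N U rep S T j s' c"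
          using sat_explore[OF v j c(1)] c(2) D by (simp add: sats_def)
        then show ?thesis using sc by blast
      qed
    qed
  qed
qed

lemma sats_join_disjoint:
  assumes v: "valid N U rep S T" and j: "j \<in> U"
    and ic: "(i, c) \<in> joins U j" "(i', c') \<in> joins U j" "(i, c) \<noteq> (i', c')"
  shows "sats I N (U - {i, j}) rep (join S j i c) T \<inter> sats I N (U - {i', j}) rep (join S j i' c') T = {}"
proof -
  have "(i, c) \<in> pts N" "(i', c') \<in> pts N"
    using joinsD[OF ic(1) j] joinsD[OF ic(2) j] validD(1)[OF v] by auto
  then have False
    if "sat D N U rep S T" "D #> rp rep (i, c) = D #> rp rep (i', c')" for D
    using inj_onD[OF satD(3)[OF that(1)] that(2)] ic(3) by blast
  then have False
    if "sat D N (U - {i, j}) rep (join S j i c) T" "sat D N (U - {i', j}) rep (join S j i' c') T" for D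
    using that sat_joins[OF v j ic(1)] sat_joins[OF v j ic(2)] by metis
  then show ?thesis unfolding sats_def by blast
qed

lemma sats_join_explore_disjoint:
  assumes v: "valid N U rep S T" and j: "j \<in> U"
    and ic: "(i, c) \<in> joins U j" and c': "(s, c') \<in> cycles"
  shows "sats I N (U - {i, j}) rep (join S j i c) T \<inter>
    visit (sats I) N U rep S T j s c' = {}"
proof -
  have p: "(i, c) \<in> pts N" using joinsD[OF ic j] validD(1)[OF v] by auto
  have "D #> (rep j \<otimes> x) \<in> explored D N rep" if "D \<in> sats I N (U - {i, j}) rep (join S j i c) T" for D
  proof -
    have "D #> (rep j \<otimes> x) = D #> rp rep (i, c)" using that sat_joins[OF v j ic] by (simp add: sats_def)
    then show ?thesis unfolding explored_def by (rule image_eqI[OF _ p])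
  qed
  moreover have "cycle_label s c'" using c' cycles_iff by blast
  ultimately show ?thesis using sat_exploreD(2)[OF v j] unfolding sats_def by blast
qed

lemma sats_explore_disjoint:
  assumes v: "valid N U rep S T" and j: "j \<in> U"
    and c: "(s, c) \<in> cycles" "(s', c') \<in> cycles" "(s, c) \<noteq> (s', c')"
  shows "visit (sats I) N U rep S T j s c
    \<inter> visit (sats I) N U rep S T j s' c' = {}"
proof -
  have l: "cycle_label s c" "cycle_label s' c'" using c cycles_iff by blast+
  have rjx: "rep j \<otimes> x \<in> carrier G" using validD(1,2)[OF v] j by auto
  show ?thesis
    unfolding sats_def sat_explore[OF v j l(1)] sat_explore[OF v j l(2)]
    using add_cycle_unique[OF v rjx l] c(3) by blast
qed

section \<open>The recursion for the number of completions\<close>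

text \<open>Lexicographic induction on (M - N, |U|): a new y-orbit lowers the first component, a
  join keeps N and lowers the second. At u = 0 the truncated \<open>u - 1\<close> is harmless since
  its coefficient is 0. Finiteness is proved along with the count because \<open>card\<close> of an
  infinite set is 0.\<close>

theorem count_sats:
  fixes p :: "nat \<Rightarrow> nat \<Rightarrow> 'r::comm_semiring_1"
  assumes p_0: "\<And>r. p 0 r = of_bool (r = 0)"
    and p_Suc: "\<And>u r. p (Suc u) r = of_nat (card {c \<in> K. c \<otimes> c = z}) * p u r +
      of_nat (u * card K) * p (u - 1) r +
      (of_nat (card {c \<in> K. c [^] q = z}) * (if 1 \<le> r then p u (r - 1) else 0) +
      (if q \<le> r then p (u + q - 1) (r - q) else 0))"
    and v: "valid N U rep S T" and t: "tree N U rep S T" and N: "N \<le> M"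
  shows "finite (sats (M * card K) N U rep S T) \<and>
    of_nat (card (sats (M * card K) N U rep S T)) = p (card U) (M - N)"
  using v t N
proof (induction "(M - N, card U)" arbitrary: N U rep S T
    rule: wf_induct_rule[OF wf_lex_prod[OF wf_less_than wf_less_than]])
  case 1
  note v = "1.prems"(1) and t = "1.prems"(2) and N = "1.prems"(3)
  have IH: "finite (sats (M * card K) N' U' rep' S' T') \<and>
      of_nat (card (sats (M * card K) N' U' rep' S' T')) = p (card U') (M - N')"
    if "M - N' < M - N \<or> N' = N \<and> card U' < card U" "valid N' U' rep' S' T'" "tree N' U' rep' S' T'" "N' \<le> M"
    for N' U' rep' S' T'
    using that "1.hyps"[of N' U'] by auto
  let ?I = "M * card K"
  have fU: "finite U" using validD(1)[OF v] finite_subset by blast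
  show ?case
  proof (cases "U = {}")
    case True
    obtain D where D: "{D. sat D N {} rep S T} = {D}" "finite (rcosets D)" "card (rcosets D) = N * card K"
      using terminal v t True by metis
    have "sat E N {} rep S T \<longleftrightarrow> E = D" for E using D(1) by blast
    \<comment> \<open>A complete state fixes the index as N |K|, so it counts only if no points
      remain to be found.\<close>
    then have "sats ?I N U rep S T = (if N = M then {D} else {})"
      using D(2,3) card_K_pos unfolding sats_def True by auto
    then show ?thesis using True N by (auto simp: p_0)
  next
    case False
    then obtain j where j: "j \<in> U" by blast
    obtain u where u: "card U = Suc u" using False fU by (metis card_eq_0_iff not0_implies_Suc)
    have jN: "j < N" using validD(1)[OF v] j by auto
    define FA where "FA = (\<lambda>(i, c). sats ?I N (U - {i, j}) rep (join S j i c) T)"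
    define FC where "FC = (\<lambda>(s, c). visit (sats ?I) N U rep S T j s c)"
    have A: "finite (FA ic) \<and> of_nat (card (FA ic)) = p (card (U - {fst ic, j})) (M - N)"
      if "ic \<in> joins U j" for ic
    proof -
      obtain i c where ic: "ic = (i, c)" by force
      note d = joinsD[OF that[unfolded ic] j]
      have "card (U - {i, j}) < card U" using j by (intro psubset_card_mono[OF fU]) auto
      then show ?thesis unfolding ic FA_def using valid_join[OF v j d] tree_join[OF t j d(1)] N IH by simp
    qed
    have C: "finite (FC sc) \<and> of_nat (card (FC sc)) =
        (if fst sc \<le> M - N then p (u + fst sc - 1) (M - N - fst sc) else 0)"
      if "sc \<in> cycles" for sc
    proof -
      obtain s c where sc: "sc = (s, c)" by force
      have l: "cycle_label s c" using that sc cycles_iff by blast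
      note vC = valid_explore[OF v j l] and tC = tree_add_join[OF v t j l]
      show ?thesis
      proof (cases "s \<le> M - N")
        case True
        \<comment> \<open>Of the u + 1 old and s new open points, j and N have just been
          joined.\<close>
        have "card (U \<union> {N..<N + s} - {N, j}) = card (U \<union> {N..<N + s}) - card {N, j}"
          using j cycle_labelD(2)[OF l] by (intro card_Diff_subset) auto
        also have "card (U \<union> {N..<N + s}) = Suc u + s"
          using fU validD(1)[OF v] u by (subst card_Un_disjoint) auto
        finally have "card (U \<union> {N..<N + s} - {N, j}) = u + s - 1" using jN by simp
        then show ?thesis unfolding sc FC_def
          using IH[OF _ vC tC] True N cycle_labelD(2)[OF l] by (simp add: diff_diff_add)
      next
        case False
        \<comment> \<open>An orbit with more points than remain would exceed the index; this matches
          the default 0 in the recursion.\<close>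
        have "D \<notin> FC sc" for D
        proof
          assume "D \<in> FC sc"
          have "(N + s) * card K \<le> ?I"
            by (rule sats_card_le[OF vC]) (use \<open>D \<in> FC sc\<close> sc FC_def in simp)
          then show False using False N card_K_pos by simp
        qed
        then have e: "FC sc = {}" by blast
        show ?thesis unfolding e using False unfolding sc by simp
      qed
    qed
    let ?J1 = "{j} \<times> {c \<in> K. c \<otimes> c = z}" and ?J2 = "(U - {j}) \<times> K"
    let ?C1 = "{1::nat} \<times> {c \<in> K. c [^] q = z}" and ?C2 = "{(q, z)}"
    have J: "joins U j = ?J1 \<union> ?J2" and CC: "cycles = ?C1 \<union> ?C2"
      by (simp_all add: joins_def cycles_def)
    have inJ: "a \<in> joins U j" if "a \<in> ?J1 \<or> a \<in> ?J2" for a using that unfolding J by blast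
    have inC: "a \<in> cycles" if "a \<in> ?C1 \<or> a \<in> ?C2" for a using that unfolding CC by blast
    have dA: "FA a \<inter> FA b = {}" if "a \<in> joins U j" "b \<in> joins U j" "a \<noteq> b" for a b
    proof -
      obtain i c i' c' where ab: "a = (i, c)" "b = (i', c')" by (metis surj_pair)
      show ?thesis unfolding ab FA_def prod.case
        by (rule sats_join_disjoint[OF v j]) (use that ab in simp_all)
    qed
    have dC: "FC a \<inter> FC b = {}" if "a \<in> cycles" "b \<in> cycles" "a \<noteq> b" for a b
    proof -
      obtain s c s' c' where ab: "a = (s, c)" "b = (s', c')" by (metis surj_pair)
      show ?thesis unfolding ab FC_def prod.case
        by (rule sats_explore_disjoint[OF v j]) (use that ab in simp_all)
    qed
    have dAC: "FA a \<inter> FC b = {}" if "a \<in> joins U j" "b \<in> cycles" for a b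
    proof -
      obtain i c s c' where ab: "a = (i, c)" "b = (s, c')" by (metis surj_pair)
      show ?thesis unfolding ab FA_def FC_def prod.case
        by (rule sats_join_explore_disjoint[OF v j]) (use that ab in simp_all)
    qed
    have fJ: "finite ?J1" "finite ?J2" "finite ?C1" using finite_K fU by auto
    have c1: "of_nat (card (\<Union>a\<in>?J1. FA a)) = of_nat (card ?J1) * p u (M - N)"
    proof (rule of_nat_card_UN_const[OF fJ(1)])
      fix a assume a: "a \<in> ?J1"
      then have "fst a = j" by auto
      then have "card (U - {fst a, j}) = u" using u j by simp
      then show "of_nat (card (FA a)) = p u (M - N)" using A[OF inJ, of a] a by simp
    qed (use A dA inJ in blast)+
    have c2: "of_nat (card (\<Union>a\<in>?J2. FA a)) = of_nat (card ?J2) * p (u - 1) (M - N)"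
    proof (rule of_nat_card_UN_const[OF fJ(2)])
      fix a assume a: "a \<in> ?J2"
      then have "card (U - {fst a, j}) = card U - card {fst a, j}"
        using j fU by (intro card_Diff_subset) auto
      moreover have "fst a \<noteq> j" using a by auto
      then have "card {fst a, j} = 2" by simp
      ultimately have "card (U - {fst a, j}) = u - 1" using u by simp
      then show "of_nat (card (FA a)) = p (u - 1) (M - N)" using A[OF inJ, of a] a by simp
    qed (use A dA inJ in blast)+
    have c3: "of_nat (card (\<Union>a\<in>?C1. FC a)) = of_nat (card ?C1) * (if 1 \<le> M - N then p u (M - N - 1) else 0)"
    proof (rule of_nat_card_UN_const[OF fJ(3)])
      fix a assume a: "a \<in> ?C1"
      then have "fst a = 1" by auto
      then show "of_nat (card (FC a)) = (if 1 \<le> M - N then p u (M - N - 1) else 0)"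
        using C[OF inC, of a] a by simp
    qed (use C dC inC in blast)+
    have c4: "of_nat (card (\<Union>a\<in>?C2. FC a)) = (if q \<le> M - N then p (u + q - 1) (M - N - q) else 0)"
      using C[OF inC, of "(q, z)"] by simp
    have q1: "?C1 \<inter> ?C2 = {}" using q_gt_1 by auto
    have fin: "finite (\<Union>a\<in>?J1. FA a)" "finite (\<Union>a\<in>?J2. FA a)" "finite (\<Union>a\<in>?C1. FC a)" "finite (\<Union>a\<in>?C2. FC a)"
      using fJ A[OF inJ] C[OF inC] by (intro finite_UN_I; blast)+
    have dis: "(\<Union>a\<in>?J1. FA a) \<inter> (\<Union>a\<in>?J2. FA a) = {}"
      "(\<Union>a\<in>?C1. FC a) \<inter> (\<Union>a\<in>?C2. FC a) = {}"
      "((\<Union>a\<in>?J1. FA a) \<union> (\<Union>a\<in>?J2. FA a)) \<inter> ((\<Union>a\<in>?C1. FC a) \<union> (\<Union>a\<in>?C2. FC a)) = {}"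
    proof -
      have "\<And>a b. a \<in> ?J1 \<Longrightarrow> b \<in> ?J2 \<Longrightarrow> FA a \<inter> FA b = {}" using dA inJ by blast
      then show "(\<Union>a\<in>?J1. FA a) \<inter> (\<Union>a\<in>?J2. FA a) = {}" by blast
      have "\<And>a b. a \<in> ?C1 \<Longrightarrow> b \<in> ?C2 \<Longrightarrow> FC a \<inter> FC b = {}" using dC inC q1 by blast
      then show "(\<Union>a\<in>?C1. FC a) \<inter> (\<Union>a\<in>?C2. FC a) = {}" by blast
      have "\<And>a b. a \<in> ?J1 \<union> ?J2 \<Longrightarrow> b \<in> ?C1 \<union> ?C2 \<Longrightarrow> FA a \<inter> FC b = {}" using dAC inJ inC by blast
      then show "((\<Union>a\<in>?J1. FA a) \<union> (\<Union>a\<in>?J2. FA a)) \<inter> ((\<Union>a\<in>?C1. FC a) \<union> (\<Union>a\<in>?C2. FC a)) = {}" by blast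
    qed
    have split: "sats ?I N U rep S T =
        ((\<Union>a\<in>?J1. FA a) \<union> (\<Union>a\<in>?J2. FA a)) \<union> ((\<Union>a\<in>?C1. FC a) \<union> (\<Union>a\<in>?C2. FC a))"
      using sats_split[OF v j, of ?I, folded FA_def FC_def] unfolding J CC UN_Un .
    have "card (sats ?I N U rep S T) = (card (\<Union>a\<in>?J1. FA a) + card (\<Union>a\<in>?J2. FA a)) +
        (card (\<Union>a\<in>?C1. FC a) + card (\<Union>a\<in>?C2. FC a))"
      unfolding split card_Un_disjoint[OF finite_UnI[OF fin(1,2)] finite_UnI[OF fin(3,4)] dis(3)]
        card_Un_disjoint[OF fin(1,2) dis(1)] card_Un_disjoint[OF fin(3,4) dis(2)] ..
    then have "of_nat (card (sats ?I N U rep S T)) =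
        (of_nat (card ?J1) * p u (M - N) + of_nat (card ?J2) * p (u - 1) (M - N)) +
        (of_nat (card ?C1) * (if 1 \<le> M - N then p u (M - N - 1) else 0) +
         (if q \<le> M - N then p (u + q - 1) (M - N - q) else 0))"
      using c1 c2 c3 c4 by (simp only: of_nat_add)
    also have "\<dots> = p (card U) (M - N)"
    proof -
      have "card ?J1 = card {c \<in> K. c \<otimes> c = z}" "card ?C1 = card {c \<in> K. c [^] q = z}"
        by (simp_all add: card_cartesian_product)
      moreover have "card ?J2 = u * card K" using u j fU by (simp add: card_cartesian_product)
      ultimately show ?thesis unfolding u p_Suc by simp
    qed
    finally show ?thesis using fin split by simp
  qed
qed

text \<open>The exploration starts from the empty state by attaching the y-orbit of the trivial
  coset. All its points are open, hence the terms \<open>p 1\<close> and \<open>p q\<close>.\<close>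

theorem count_complements:
  fixes p :: "nat \<Rightarrow> nat \<Rightarrow> 'r::comm_semiring_1" and M :: nat
  assumes p_0: "\<And>r. p 0 r = of_bool (r = 0)"
    and p_Suc: "\<And>u r. p (Suc u) r = of_nat (card {c \<in> K. c \<otimes> c = z}) * p u r +
      of_nat (u * card K) * p (u - 1) r +
      (of_nat (card {c \<in> K. c [^] q = z}) * (if 1 \<le> r then p u (r - 1) else 0) +
      (if q \<le> r then p (u + q - 1) (r - q) else 0))"
  defines "A \<equiv> {D. subgroup D G \<and> D \<inter> K = {\<one>} \<and> finite (rcosets D) \<and> card (rcosets D) = M * card K}"
  shows "finite A"
    and "of_nat (card A) = of_nat (card {c \<in> K. c [^] q = z}) * (if 1 \<le> M then p 1 (M - 1) else 0) +
      (if q \<le> M then p q (M - q) else 0)"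
proof -
  \<comment> \<open>With N = 0 there are no points, so these three functions are arbitrary
    fillers.\<close>
  define rep :: "nat \<Rightarrow> 'a" where "rep = (\<lambda>_. \<one>)"
  define S T :: "nat \<Rightarrow> nat \<times> 'a" where "S = (\<lambda>j. (j, \<one>))" and "T = (\<lambda>j. (j, \<one>))"
  have v0: "valid 0 {} rep S T" by (simp add: valid_def)
  have sat0: "sat D 0 {} rep S T \<longleftrightarrow> subgroup D G \<and> D \<inter> K = {\<one>}" for D by (simp add: sat_def)
  let ?I = "M * card K"
  define FC where "FC = (\<lambda>(s, c). sats ?I s {0..<s} (add_rep 0 rep \<one>) S (add_cycle 0 T s c))"
  let ?C1 = "{1::nat} \<times> {c \<in> K. c [^] q = z}" and ?C2 = "{(q, z)}"
  have split: "A = (\<Union>a\<in>?C1. FC a) \<union> (\<Union>a\<in>?C2. FC a)"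
  proof -
    have "A = (\<Union>a\<in>cycles. FC a)"
    proof
      show "(\<Union>a\<in>cycles. FC a) \<subseteq> A"
      proof
        fix D assume "D \<in> (\<Union>a\<in>cycles. FC a)"
        then obtain a where a: "a \<in> cycles" "D \<in> FC a" by (elim UN_E)
        obtain s c where "a = (s, c)" by force
        then have "cycle_label s c" "D \<in> FC (s, c)" using a cycles_iff by simp_all
        then show "D \<in> A" unfolding A_def sats_def FC_def
          using sat_add[OF v0 one_closed, where s = s and c = c and D = D] sat0[of D] by simp
      qed
      show "A \<subseteq> (\<Union>a\<in>cycles. FC a)"
      proof
        fix D assume D: "D \<in> A"
        then have "sat D 0 {} rep S T" unfolding sat0 by (simp add: A_def)
        then obtain s c where c: "cycle_label s c"
          "sat D (0 + s) ({} \<union> {0..<0 + s}) (add_rep 0 rep \<one>) S (add_cycle 0 T s c)"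
          using add_cycle_exhaustive[OF v0 _ one_closed, of D] unfolding explored_def by blast
        then have "D \<in> FC (s, c)" using D by (simp add: A_def sats_def FC_def)
        moreover have "(s, c) \<in> cycles" using c(1) cycles_iff by simp
        ultimately show "D \<in> (\<Union>a\<in>cycles. FC a)" by (rule UN_I[rotated])
      qed
    qed
    then show ?thesis unfolding cycles_def UN_Un .
  qed
  have C: "finite (FC sc) \<and> of_nat (card (FC sc)) = (if fst sc \<le> M then p (fst sc) (M - fst sc) else 0)"
    if "sc \<in> cycles" for sc
  proof -
    obtain s c where sc: "sc = (s, c)" by force
    have l: "cycle_label s c" using that sc cycles_iff by blast
    have vC: "valid s {0..<s} (add_rep 0 rep \<one>) S (add_cycle 0 T s c)"
      using valid_add[OF v0 one_closed l] by simp
    show ?thesis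
    proof (cases "s \<le> M")
      case True
      show ?thesis unfolding sc FC_def
        using count_sats[OF p_0 p_Suc vC tree_initial[OF l] True] True by simp
    next
      case False
      have "D \<notin> FC sc" for D
      proof
        assume "D \<in> FC sc"
        have "s * card K \<le> ?I"
          by (rule sats_card_le[OF vC]) (use \<open>D \<in> FC sc\<close> sc FC_def in simp)
        then show False using False card_K_pos by simp
      qed
      then have e: "FC sc = {}" by blast
      show ?thesis unfolding e using False unfolding sc by simp
    qed
  qed
  have dC: "FC a \<inter> FC b = {}" if "a \<in> cycles" "b \<in> cycles" "a \<noteq> b" for a b
  proof -
    obtain s c s' c' where ab: "a = (s, c)" "b = (s', c')" by (metis surj_pair)
    have l: "cycle_label s c" "cycle_label s' c'" using that ab cycles_iff by blast+
    have False if "sat D s {0..<s} (add_rep 0 rep \<one>) S (add_cycle 0 T s c)"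
      "sat D s' {0..<s'} (add_rep 0 rep \<one>) S (add_cycle 0 T s' c')" for D
      using add_cycle_unique[OF v0 one_closed l, where D = D and U' = "{}" and S' = S] that \<open>a \<noteq> b\<close> ab by simp
    then show ?thesis unfolding ab sats_def FC_def by auto
  qed
  have fC: "finite ?C1" using finite_K by simp
  have inC: "a \<in> cycles" if "a \<in> ?C1 \<or> a \<in> ?C2" for a using that unfolding cycles_def by blast
  have c1: "of_nat (card (\<Union>a\<in>?C1. FC a)) = of_nat (card ?C1) * (if 1 \<le> M then p 1 (M - 1) else 0)"
  proof (rule of_nat_card_UN_const[OF fC])
    fix a assume a: "a \<in> ?C1"
    then have "fst a = 1" by auto
    then show "of_nat (card (FC a)) = (if 1 \<le> M then p 1 (M - 1) else 0)"
      using C[OF inC, of a] a by simp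
  qed (use C dC inC in blast)+
  have c2: "of_nat (card (\<Union>a\<in>?C2. FC a)) = (if q \<le> M then p q (M - q) else 0)"
    using C[OF inC, of "(q, z)"] by simp
  have fin: "finite (\<Union>a\<in>?C1. FC a)" "finite (\<Union>a\<in>?C2. FC a)"
    using fC C[OF inC] by (intro finite_UN_I; blast)+
  have dis: "(\<Union>a\<in>?C1. FC a) \<inter> (\<Union>a\<in>?C2. FC a) = {}"
  proof -
    have "?C1 \<inter> ?C2 = {}" using q_gt_1 by auto
    then have "\<And>a b. a \<in> ?C1 \<Longrightarrow> b \<in> ?C2 \<Longrightarrow> FC a \<inter> FC b = {}" using dC inC by blast
    then show ?thesis by blast
  qed
  show "finite A" unfolding split using fin by (rule finite_UnI)
  have "card ?C1 = card {c \<in> K. c [^] q = z}" by (simp add: card_cartesian_product)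
  then show "of_nat (card A) = of_nat (card {c \<in> K. c [^] q = z}) * (if 1 \<le> M then p 1 (M - 1) else 0) +
      (if q \<le> M then p q (M - q) else 0)"
    unfolding split card_Un_disjoint[OF fin dis] of_nat_add c1 c2 by simp
qed

section \<open>Divisibility of the index and parity of the count\<close>

text \<open>The cosets of D split into K-orbits, and freeness gives each of them |K|
  elements.\<close>

lemma card_K_dvd_index:
  assumes D: "subgroup D G" "D \<inter> K = {\<one>}" and f: "finite (rcosets D)"
  shows "card K dvd card (rcosets D)"
proof -
  define orb where "orb g = (\<lambda>k. D #> (g \<otimes> k)) ` K" for g
  have sub: "\<Union>(orb ` carrier G) = rcosets D"
  proof
    show "\<Union>(orb ` carrier G) \<subseteq> rcosets D" using rcosetsI[OF subgroup.subset[OF D(1)]] by (auto simp: orb_def)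
    show "rcosets D \<subseteq> \<Union>(orb ` carrier G)"
    proof
      fix C assume "C \<in> rcosets D"
      then obtain g where g: "g \<in> carrier G" "C = D #> g" by (auto simp: RCOSETS_def)
      then have "C \<in> orb g" unfolding orb_def by (intro image_eqI[of _ _ \<one>]) auto
      then show "C \<in> \<Union>(orb ` carrier G)" using g by blast
    qed
  qed
  have "card K * card (orb ` carrier G) = card (\<Union>(orb ` carrier G))"
  proof (rule card_partition)
    show "finite (\<Union>(orb ` carrier G))" unfolding sub by (rule f)
    then show "finite (orb ` carrier G)" by (rule finite_UnionD)
    show "card C = card K" if "C \<in> orb ` carrier G" for C
      using that coset_K_free[OF D] by (auto simp: orb_def intro!: card_image inj_onI)
    show "C \<inter> C' = {}" if C: "C \<in> orb ` carrier G" "C' \<in> orb ` carrier G" "C \<noteq> C'" for C C'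
    proof (rule ccontr)
      assume "C \<inter> C' \<noteq> {}"
      obtain g g' where gg: "g \<in> carrier G" "g' \<in> carrier G" "C = orb g" "C' = orb g'"
        using C(1,2) by blast
      obtain E where E: "E \<in> orb g" "E \<in> orb g'" using \<open>C \<inter> C' \<noteq> {}\<close> gg(3,4) by blast
      have orbE: "\<exists>k\<in>K. E = D #> (h \<otimes> k)" if "E \<in> orb h" for E h
        using that unfolding orb_def by (rule imageE) (rule bexI)
      obtain k k' where k: "k \<in> K" "k' \<in> K" and e: "D #> (g \<otimes> k) = D #> (g' \<otimes> k')"
        using orbE[OF E(1)] orbE[OF E(2)] by metis
      note g = gg k
      have sub: "orb a \<subseteq> orb b" if a: "a \<in> carrier G" "b \<in> carrier G" "k \<in> K" "k' \<in> K"
        and e: "D #> (a \<otimes> k) = D #> (b \<otimes> k')" for a b k k'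
      proof
        fix E assume "E \<in> orb a"
        then obtain l where l: "l \<in> K" "E = D #> (a \<otimes> l)" using orbE by metis
        have "D #> (a \<otimes> k \<otimes> (inv k \<otimes> l)) = D #> (b \<otimes> k' \<otimes> (inv k \<otimes> l))"
          by (rule coset_cong[OF D(1) _ _ _ e]) (use a l in auto)
        moreover have "a \<otimes> k \<otimes> (inv k \<otimes> l) = a \<otimes> l"
        proof -
          have "a \<otimes> k \<otimes> (inv k \<otimes> l) = a \<otimes> ((k \<otimes> inv k) \<otimes> l)"
            using a l(1) by (simp only: m_assoc m_closed K_closed K_inv)
          then show ?thesis using a l(1) by simp
        qed
        moreover have "b \<otimes> k' \<otimes> (inv k \<otimes> l) = b \<otimes> (k' \<otimes> (inv k \<otimes> l))"
          using a l(1) by (simp only: m_assoc m_closed K_closed K_inv)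
        ultimately have "E = D #> (b \<otimes> (k' \<otimes> (inv k \<otimes> l)))" using l(2) by simp
        then show "E \<in> orb b" unfolding orb_def
          by (rule image_eqI) (use a l(1) in simp)
      qed
      show False using sub[OF g(1,2,5,6) e] sub[OF g(2,1,6,5) e[symmetric]] C(3) g(3,4) by blast
    qed
  qed
  then show ?thesis unfolding sub by (metis dvd_triv_left)
qed

lemma even_card_square_roots: "even (card {c \<in> K. c \<otimes> c = z}) \<longleftrightarrow> even (card K)"
proof -
  have inv2: "inv (inv k \<otimes> z) \<otimes> z = k" if k: "k \<in> K" for k
  proof -
    have "inv (inv k \<otimes> z) \<otimes> z = inv z \<otimes> (k \<otimes> z)"
      using k K_closed[OF z_in_K] by (simp add: inv_mult_group m_assoc del: z_in_K)
    also have "k \<otimes> z = z \<otimes> k" by (rule z_comm[OF k])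
    also have "inv z \<otimes> (z \<otimes> k) = (inv z \<otimes> z) \<otimes> k"
      by (rule m_assoc[symmetric]) (use k in auto)
    also have "\<dots> = k" using k l_inv[of z] by simp
    finally show ?thesis .
  qed
  have "{c \<in> K. c \<otimes> c = z} = {c \<in> K. inv c \<otimes> z = c}"
  proof (rule Collect_cong, rule conj_cong[OF HOL.refl])
    fix c assume c: "c \<in> K"
    then show "c \<otimes> c = z \<longleftrightarrow> inv c \<otimes> z = c"
      using inv_solve_left'[of c c z] by (metis K_closed z_in_K)
  qed
  moreover have "even (card {c \<in> K. inv c \<otimes> z = c}) \<longleftrightarrow> even (card K)"
    using inv2 by (intro card_fixed_involution finite_K) auto
  ultimately show ?thesis by simp
qed

theorem odd_card_complements_iff:
  fixes M :: nat
  assumes "odd q"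
  defines "A \<equiv> {D. subgroup D G \<and> D \<inter> K = {\<one>} \<and> finite (rcosets D) \<and> card (rcosets D) = M * card K}"
  shows "finite A"
    and "odd (card A) \<longleftrightarrow> odd (card {c \<in> K. c [^] q = z}) \<and>
      ((\<exists>e. M = 2 * (1 + 2 * (q - 1) * e) \<and> odd (((q - 1) * e + 1) choose e)) \<or>
       (odd (card K) \<and> (\<exists>e. M = 1 + 2 * (q - 1) * e \<and> odd (((q - 1) * e + 1) choose e))))"
proof -
  define t where "t = q - 1"
  have t: "even t" "t > 0" "Suc t = q" using assms(1) q_gt_1 by (auto simp: t_def)
  define \<beta> where "\<beta> = card {c \<in> K. c [^] q = z}"
  \<comment> \<open>V u r stands for the coefficient of w^u. For even \<open>\<beta>\<close> the
    equation of w loses its linear term and w = 0, which leaves only w^0 = 1.\<close>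
  define V where "V u r = (if odd \<beta> then W t u r else of_bool (u = 0 \<and> r = 0))" for u r
  have V_0: "V 0 r = of_bool (r = 0)" for r using W_0[OF t(1,2)] by (simp add: V_def)
  have V_Suc: "V (Suc u) r = of_nat \<beta> * (if 1 \<le> r then V u (r - 1) else 0) +
      (if q \<le> r then V (u + q - 1) (r - q) else 0)" for u r
  proof -
    have "u + q - 1 = u + t" using t(3) by simp
    moreover have "(of_nat \<beta> :: bit) = of_bool (odd \<beta>)"
      using of_nat_bit_eq_1_iff[of \<beta>] of_nat_bit_eq_0_iff[of \<beta>] by simp
    ultimately show ?thesis using W_Suc[OF t(2), of u r] t(2,3) unfolding V_def by simp
  qed
  define p where "p u r = (if odd (card K) \<and> odd u then V (u - 1) r + V u r else V u r)" for u r
  have p_0: "p 0 r = of_bool (r = 0)" for r by (simp add: p_def V_0)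
  have sq: "(of_nat (card {c \<in> K. c \<otimes> c = z}) :: bit) = of_nat (card K)"
    using even_card_square_roots of_nat_bit_eq_1_iff of_nat_bit_eq_0_iff
    by (cases "even (card K)") metis+
  have p_Suc: "p (Suc u) r = of_nat (card {c \<in> K. c \<otimes> c = z}) * p u r +
      of_nat (u * card K) * p (u - 1) r +
      (of_nat (card {c \<in> K. c [^] q = z}) * (if 1 \<le> r then p u (r - 1) else 0) +
      (if q \<le> r then p (u + q - 1) (r - q) else 0))" for u r
  proof (cases "even (card K)")
    case True
    then have p: "p = V" by (intro ext) (simp add: p_def)
    have "(of_nat (card K) :: bit) = 0" using True of_nat_bit_eq_0_iff by blast
    then show ?thesis unfolding p sq V_Suc[of u r] \<beta>_def of_nat_mult by simp
  next
    case False
    then have K: "(of_nat (card K) :: bit) = 1" using of_nat_bit_eq_1_iff by blast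
    show ?thesis
    proof (cases "even u")
      case True
      have u0: "(of_nat u :: bit) = 0" using True of_nat_bit_eq_0_iff by blast
      have "even (u + q - 1)" using True assms(1) by simp
      then show ?thesis unfolding sq of_nat_mult K u0 using V_Suc[of u r] True False
        by (simp add: p_def \<beta>_def)
    next
      case odd: False
      then obtain v where v: "u = Suc v" by (cases u) auto
      have u1: "(of_nat u :: bit) = 1" using odd of_nat_bit_eq_1_iff by blast
      have q1: "odd (u + q - 1)" "u + q - 1 - 1 = v + q - 1" using odd assms(1) v q_gt_1 by auto
      have p: "p (Suc u) r = V (Suc u) r" "p u s = V v s + V u s" "p (u - 1) s = V v s"
        "p (u + q - 1) s = V (v + q - 1) s + V (u + q - 1) s" for s
        using odd False v q1 by (auto simp: p_def)
      have 1: "x + x = 0" for x :: bit by (cases x) auto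
      define f where "f w = (if 1 \<le> r then V w (r - 1) else 0)" for w
      define g where "g w = (if q \<le> r then V (w + q - 1) (r - q) else 0)" for w
      have Vu: "V u r = of_nat \<beta> * f v + g v" unfolding v f_def g_def by (rule V_Suc)
      have VS: "V (Suc u) r = of_nat \<beta> * f u + g u" unfolding f_def g_def by (rule V_Suc)
      have fg: "(if 1 \<le> r then V v (r - 1) + V u (r - 1) else 0) = f v + f u"
        "(if q \<le> r then V (v + q - 1) (r - q) + V (u + q - 1) (r - q) else 0) = g v + g u"
        by (simp_all add: f_def g_def)
      \<comment> \<open>The two copies of \<open>V v r\<close> cancel, and \<open>V u r\<close>
        cancels against its own recursion; what is left is the recursion for
        \<open>V (Suc u) r\<close>.\<close>
      have "(V v r + V u r) + V v r + (of_nat \<beta> * (f v + f u) + (g v + g u)) =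
          (V v r + V v r) + (V u r + (of_nat \<beta> * f v + g v)) + (of_nat \<beta> * f u + g u)"
        by (simp only: distrib_left add_ac)
      also have "\<dots> = V (Suc u) r" unfolding Vu[symmetric] VS[symmetric] 1 by simp
      finally have "V (Suc u) r = (V v r + V u r) + V v r +
         (of_nat \<beta> * (if 1 \<le> r then V v (r - 1) + V u (r - 1) else 0) +
          (if q \<le> r then V (v + q - 1) (r - q) + V (u + q - 1) (r - q) else 0))"
        unfolding fg by (rule HOL.sym)
      then show ?thesis unfolding sq of_nat_mult K u1 p \<beta>_def by simp
    qed
  qed
  note cnt = count_complements[OF p_0 p_Suc, where M = M, folded A_def]
  show "finite A" by (rule cnt(1))
  have c: "of_nat (card A) = (if odd (card K) then V 1 M + V 2 M else V 2 M)"
  proof -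
    \<comment> \<open>The contribution of the first y-orbit to w^u is the right side of
      \<open>V_Suc\<close>; reading that recursion backwards raises w^u to w^(u+1).\<close>
    define f where "f u = (if 1 \<le> M then V u (M - 1) else 0)" for u
    define g where "g u = (if q \<le> M then V u (M - q) else 0)" for u
    have V1: "V 1 M = of_nat \<beta> * f 0 + g (q - 1)"
      using V_Suc[of 0 M] by (simp only: f_def g_def One_nat_def add_0)
    have "1 + q - 1 = q" "Suc 1 = 2" by simp_all
    then have V2: "V 2 M = of_nat \<beta> * f 1 + g q"
      using V_Suc[of 1 M] by (simp only: f_def g_def)
    have card_A: "of_nat (card A) = of_nat \<beta> * (if 1 \<le> M then p 1 (M - 1) else 0) +
      (if q \<le> M then p q (M - q) else 0)" unfolding \<beta>_def by (rule cnt(2))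
    show ?thesis
    proof (cases "odd (card K)")
      case True
      have "(if 1 \<le> M then p 1 (M - 1) else 0) = f 0 + f 1"
        "(if q \<le> M then p q (M - q) else 0) = g (q - 1) + g q"
        using True assms(1) by (simp_all add: p_def f_def g_def)
      then have "of_nat (card A) = V 1 M + V 2 M"
        unfolding card_A V1 V2 by (simp only: distrib_left add_ac)
      then show ?thesis using True by simp
    next
      case False
      have "(if 1 \<le> M then p 1 (M - 1) else 0) = f 1" "(if q \<le> M then p q (M - q) else 0) = g q"
        using False by (simp_all add: p_def f_def g_def)
      then show ?thesis using False unfolding card_A V2 by simp
    qed
  qed
  show "odd (card A) \<longleftrightarrow> odd (card {c \<in> K. c [^] q = z}) \<and>
      ((\<exists>e. M = 2 * (1 + 2 * (q - 1) * e) \<and> odd (((q - 1) * e + 1) choose e)) \<or>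
       (odd (card K) \<and> (\<exists>e. M = 1 + 2 * (q - 1) * e \<and> odd (((q - 1) * e + 1) choose e))))"
  proof (cases "odd \<beta>")
    case False
    then have "V 1 M = 0" "V 2 M = 0" by (simp_all add: V_def)
    then have "(of_nat (card A) :: bit) = 0" using c by simp
    then show ?thesis using False of_nat_bit_eq_0_iff unfolding \<beta>_def by blast
  next
    case True
    \<comment> \<open>Only odd exponents occur in w and only even ones in w^2, so the sum of the two
      coefficients is 1 exactly if one of them is.\<close>
    have "W t 1 M = 0 \<or> W t 2 M = 0"
    proof (rule ccontr)
      assume "\<not> ?thesis"
      then obtain e f where e: "M = 1 + 2 * t * e" and f: "M = 2 + 2 * t * f" using W_neq_0_D by metis
      have "odd M" unfolding e by simp
      moreover have "even M" unfolding f by simp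
      ultimately show False by simp
    qed
    moreover have "V = W t" using True by (intro ext) (simp add: V_def)
    ultimately have "(of_nat (card A) :: bit) = 1 \<longleftrightarrow> W t 2 M = 1 \<or> (odd (card K) \<and> W t 1 M = 1)"
      using c by auto
    then show ?thesis
      using True W_1_eq_1_iff[OF t(2), of M] W_2_eq_1_iff[OF t(2,1), of M]
      unfolding of_nat_bit_eq_1_iff \<beta>_def t_def by blast
  qed
qed

end

section \<open>The groups \<open>\<Gamma>\<^sub>m(q)\<close>\<close>

definition gen_class :: "nat \<Rightarrow> nat \<Rightarrow> generator \<Rightarrow> generator word set" where
  "gen_class m q g = word_class (Gamma_rels m q) [(True, g)]"

lemma Gamma_mult [simp]:
  "word_class (Gamma_rels m q) u \<otimes>\<^bsub>Gamma m q\<^esub> word_class (Gamma_rels m q) v =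
    word_class (Gamma_rels m q) (u @ v)"
  by (simp add: Gamma_def mult_word_class)

lemma Gamma_one: "\<one>\<^bsub>Gamma m q\<^esub> = word_class (Gamma_rels m q) []"
  by (simp add: Gamma_def one_presented_group)

lemma Gamma_carrier: "carrier (Gamma m q) = range (word_class (Gamma_rels m q))"
  by (simp add: Gamma_def carrier_presented_group)

lemma word_class_in_Gamma [simp]: "word_class (Gamma_rels m q) u \<in> carrier (Gamma m q)"
  by (simp add: Gamma_carrier)

lemma gen_class_closed [simp]: "gen_class m q g \<in> carrier (Gamma m q)"
  by (simp add: gen_class_def)

lemma word_class_replicate:
  "word_class (Gamma_rels m q) (replicate n (True, g)) = gen_class m q g [^]\<^bsub>Gamma m q\<^esub> n"
proof (induction n)
  case 0
  interpret group "Gamma m q" by (rule group_Gamma)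
  show ?case by (simp add: Gamma_one)
next
  case (Suc n)
  interpret group "Gamma m q" by (rule group_Gamma)
  have "replicate (Suc n) (True, g) = replicate n (True, g) @ [(True, g)]"
    by (simp add: replicate_append_same)
  then have "word_class (Gamma_rels m q) (replicate (Suc n) (True, g)) =
      word_class (Gamma_rels m q) (replicate n (True, g)) \<otimes>\<^bsub>Gamma m q\<^esub> gen_class m q g"
    by (simp only: gen_class_def Gamma_mult)
  then show ?case by (simp add: Suc)
qed

lemma zeta_X: "zeta m q = gen_class m q X [^]\<^bsub>Gamma m q\<^esub> (2::nat)"
  unfolding zeta_def by (rule word_class_replicate)

lemma zeta_Y: "zeta m q = gen_class m q Y [^]\<^bsub>Gamma m q\<^esub> q"
  unfolding zeta_eq_Y by (rule word_class_replicate)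

lemma zeta_pow_order: "zeta m q [^]\<^bsub>Gamma m q\<^esub> m = \<one>\<^bsub>Gamma m q\<^esub>"
proof -
  interpret group "Gamma m q" by (rule group_Gamma)
  have "zeta m q [^]\<^bsub>Gamma m q\<^esub> m = word_class (Gamma_rels m q) (replicate (2 * m) (True, X))"
    unfolding zeta_X word_class_replicate by (simp add: nat_pow_pow)
  also have "\<dots> = word_class (Gamma_rels m q) []"
    unfolding word_class_eq_iff by (rule word_cong.rel) (simp add: Gamma_rels_def)
  finally show ?thesis by (simp only: Gamma_one)
qed

lemma word_class_inverse_letter:
  "word_class (Gamma_rels m q) [(False, g)] = inv\<^bsub>Gamma m q\<^esub> gen_class m q g"
proof -
  interpret group "Gamma m q" by (rule group_Gamma)
  have "word_class (Gamma_rels m q) [(False, g), (True, g)] = word_class (Gamma_rels m q) []"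
    unfolding word_class_eq_iff using word_cong.cancel[of "Gamma_rels m q" False g] by simp
  then have "word_class (Gamma_rels m q) [(False, g)] \<otimes>\<^bsub>Gamma m q\<^esub> gen_class m q g = \<one>\<^bsub>Gamma m q\<^esub>"
    by (simp add: gen_class_def Gamma_one)
  then show ?thesis by (intro inv_equality[symmetric]) auto
qed

text \<open>zeta is a power of either generator, so it commutes with every letter and hence with
  every word.\<close>

lemma zeta_comm:
  assumes "a \<in> carrier (Gamma m q)"
  shows "zeta m q \<otimes>\<^bsub>Gamma m q\<^esub> a = a \<otimes>\<^bsub>Gamma m q\<^esub> zeta m q"
proof -
  interpret group "Gamma m q" by (rule group_Gamma)
  let ?z = "zeta m q"
  have z: "?z \<in> carrier (Gamma m q)" by (rule zeta_in_carrier)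
  have gen: "?z \<otimes>\<^bsub>Gamma m q\<^esub> gen_class m q g = gen_class m q g \<otimes>\<^bsub>Gamma m q\<^esub> ?z" for g
  proof -
    obtain k :: nat where k: "?z = gen_class m q g [^]\<^bsub>Gamma m q\<^esub> k"
      using zeta_X zeta_Y by (cases g) metis+
    show ?thesis unfolding k by (metis gen_class_closed nat_pow_Suc nat_pow_Suc2)
  qed
  have inv: "?z \<otimes>\<^bsub>Gamma m q\<^esub> inv\<^bsub>Gamma m q\<^esub> b = inv\<^bsub>Gamma m q\<^esub> b \<otimes>\<^bsub>Gamma m q\<^esub> ?z"
    if b: "b \<in> carrier (Gamma m q)" "?z \<otimes>\<^bsub>Gamma m q\<^esub> b = b \<otimes>\<^bsub>Gamma m q\<^esub> ?z" for b
  proof -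
    have "b \<otimes>\<^bsub>Gamma m q\<^esub> (?z \<otimes>\<^bsub>Gamma m q\<^esub> inv\<^bsub>Gamma m q\<^esub> b) = ?z"
      using b z by (metis inv_closed m_assoc r_inv r_one)
    then show ?thesis using b z by (metis inv_closed inv_solve_left m_closed)
  qed
  have letter: "?z \<otimes>\<^bsub>Gamma m q\<^esub> word_class (Gamma_rels m q) [l] =
      word_class (Gamma_rels m q) [l] \<otimes>\<^bsub>Gamma m q\<^esub> ?z" for l
  proof -
    obtain b g where l: "l = (b, g)" by force
    show ?thesis
    proof (cases b)
      case True then show ?thesis using gen[of g] unfolding l gen_class_def by simp
    next
      case False
      then show ?thesis using inv[OF gen_class_closed gen, of g] unfolding l word_class_inverse_letter[symmetric] by simp
    qed
  qed
  obtain u where a: "a = word_class (Gamma_rels m q) u" using assms by (auto simp: Gamma_carrier)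
  show ?thesis unfolding a
  proof (induction u)
    case Nil
    show ?case using z by (simp flip: Gamma_one)
  next
    case (Cons l u)
    have "word_class (Gamma_rels m q) (l # u) =
        word_class (Gamma_rels m q) [l] \<otimes>\<^bsub>Gamma m q\<^esub> word_class (Gamma_rels m q) u" by simp
    then show ?case using letter[of l] Cons.IH z
      by (metis m_assoc word_class_in_Gamma)
  qed
qed

lemma zeta_pow_comm:
  assumes "a \<in> carrier (Gamma m q)"
  shows "zeta m q [^]\<^bsub>Gamma m q\<^esub> (i::nat) \<otimes>\<^bsub>Gamma m q\<^esub> a = a \<otimes>\<^bsub>Gamma m q\<^esub> zeta m q [^]\<^bsub>Gamma m q\<^esub> i"
proof -
  interpret group "Gamma m q" by (rule group_Gamma)
  show ?thesis
  proof (induction i)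
    case (Suc i)
    then show ?case using zeta_comm[OF assms] zeta_in_carrier[of m q] assms
      by (metis m_assoc nat_pow_Suc nat_pow_closed)
  qed (use assms in simp)
qed

section \<open>The order of zeta\<close>

text \<open>The weights q of x and 2 of y are chosen so that x^2 and y^q both weigh 2 q.\<close>

fun weight :: "nat \<Rightarrow> generator word \<Rightarrow> int" where
  "weight q [] = 0"
| "weight q ((b, g) # u) = (if b then 1 else -1) * (case g of X \<Rightarrow> int q | Y \<Rightarrow> 2) + weight q u"

lemma weight_append: "weight q (u @ v) = weight q u + weight q v"
  by (induction u) auto

lemma weight_replicate: "weight q (replicate n (True, g)) = int n * (case g of X \<Rightarrow> int q | Y \<Rightarrow> 2)"
  by (induction n) (auto simp: algebra_simps split: generator.splits)

text \<open>\<open>weight\<close> induces a map of \<open>\<Gamma>\<^sub>m(q)\<close> to \<open>\<int>/2qm\<close> sending \<open>\<zeta>\<close> to \<open>2q\<close>;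
  hence \<open>\<zeta>\<close> has order exactly \<open>m\<close>.\<close>

lemma weight_word_cong:
  "word_cong (Gamma_rels m q) u v \<Longrightarrow> [weight q u = weight q v] (mod (2 * int q * int m))"
proof (induction rule: word_cong.induct)
  case (rel u v)
  then have "weight q u - weight q v \<in> {2 * int q * int m, 0}"
    by (auto simp: Gamma_rels_def weight_replicate algebra_simps simp del: replicate_Suc weight.simps(2))
  then show ?case by (auto simp: cong_iff_dvd_diff)
qed (auto simp: weight_append intro: cong_add cong_sym cong_trans)

lemma zeta_pow_eq_one_iff:
  assumes "0 < q"
  shows "zeta m q [^]\<^bsub>Gamma m q\<^esub> (i::nat) = \<one>\<^bsub>Gamma m q\<^esub> \<longleftrightarrow> m dvd i"
proof -
  interpret group "Gamma m q" by (rule group_Gamma)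
  show ?thesis
  proof
    assume "zeta m q [^]\<^bsub>Gamma m q\<^esub> i = \<one>\<^bsub>Gamma m q\<^esub>"
    then have "word_class (Gamma_rels m q) (replicate (2 * i) (True, X)) = word_class (Gamma_rels m q) []"
      unfolding zeta_X word_class_replicate Gamma_one[symmetric] by (simp add: nat_pow_pow)
    then have "[weight q (replicate (2 * i) (True, X)) = weight q []] (mod (2 * int q * int m))"
      unfolding word_class_eq_iff by (rule weight_word_cong)
    then have "2 * int q * int m dvd 2 * int q * int i"
      by (simp add: weight_replicate cong_iff_dvd_diff mult_ac)
    then show "m dvd i" using assms by simp
  next
    assume "m dvd i"
    then obtain k where "i = m * k" by (elim dvdE)
    then show "zeta m q [^]\<^bsub>Gamma m q\<^esub> i = \<one>\<^bsub>Gamma m q\<^esub>"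
      using zeta_pow_order zeta_in_carrier by (metis nat_pow_one nat_pow_pow)
  qed
qed

lemma generate_zeta:
  assumes "0 < m"
  shows "generate (Gamma m q) {zeta m q} = {zeta m q [^]\<^bsub>Gamma m q\<^esub> i | i::nat. True}" (is "?L = ?R")
proof -
  interpret group "Gamma m q" by (rule group_Gamma)
  note z = zeta_in_carrier[of m q]
  have "subgroup ?R (Gamma m q)"
  proof (rule subgroupI)
    show "?R \<subseteq> carrier (Gamma m q)" using z by auto
    show "?R \<noteq> {}" by auto
    show "inv\<^bsub>Gamma m q\<^esub> a \<in> ?R" if aR: "a \<in> ?R" for a
    proof -
      obtain i :: nat where i: "a = zeta m q [^]\<^bsub>Gamma m q\<^esub> i" using aR by auto
      \<comment> \<open>Exponents are natural numbers, so the inverse of zeta^i is written as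
        zeta^(i (m - 1)).\<close>
      have "i * (m - 1) + i = m * i" using assms by (cases m) auto
      then have "zeta m q [^]\<^bsub>Gamma m q\<^esub> (i * (m - 1)) \<otimes>\<^bsub>Gamma m q\<^esub> a = zeta m q [^]\<^bsub>Gamma m q\<^esub> (m * i)"
        unfolding i using nat_pow_mult[OF z] by simp
      also have "\<dots> = \<one>\<^bsub>Gamma m q\<^esub>" using zeta_pow_order z by (metis nat_pow_one nat_pow_pow)
      finally have "inv\<^bsub>Gamma m q\<^esub> a = zeta m q [^]\<^bsub>Gamma m q\<^esub> (i * (m - 1))"
        by (intro inv_equality) (use i z in auto)
      then show ?thesis by auto
    qed
    show "a \<otimes>\<^bsub>Gamma m q\<^esub> b \<in> ?R" if "a \<in> ?R" "b \<in> ?R" for a b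
      using that nat_pow_mult[OF z] by auto
  qed
  moreover have "zeta m q \<in> ?R" using z by (auto intro!: exI[of _ "1::nat"])
  ultimately have "?L \<subseteq> ?R" by (intro generate_subgroup_incl) auto
  moreover have "?R \<subseteq> ?L"
  proof
    fix a assume "a \<in> ?R"
    then obtain i :: nat where i: "a = zeta m q [^]\<^bsub>Gamma m q\<^esub> i" by auto
    have "subgroup ?L (Gamma m q)" using z by (intro generate_is_subgroup) auto
    moreover have "zeta m q \<in> ?L" by (rule generate.incl) simp
    ultimately show "a \<in> ?L" unfolding i by (induction i) (auto simp: subgroup.one_closed subgroup.m_closed)
  qed
  ultimately show ?thesis by blast
qed

lemma card_generate_zeta:
  assumes "0 < m" "0 < q"
  shows "finite (generate (Gamma m q) {zeta m q})" "card (generate (Gamma m q) {zeta m q}) = m"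
proof -
  interpret group "Gamma m q" by (rule group_Gamma)
  note z = zeta_in_carrier[of m q]
  let ?f = "\<lambda>i::nat. zeta m q [^]\<^bsub>Gamma m q\<^esub> i"
  have "generate (Gamma m q) {zeta m q} = ?f ` {..<m}"
  proof -
    have "?f i = ?f (i mod m)" for i
    proof -
      have "?f i = ?f (m * (i div m)) \<otimes>\<^bsub>Gamma m q\<^esub> ?f (i mod m)"
        using nat_pow_mult[OF z] by simp
      moreover have "?f (m * (i div m)) = \<one>\<^bsub>Gamma m q\<^esub>"
        using zeta_pow_order z by (metis nat_pow_one nat_pow_pow)
      ultimately show ?thesis using z by simp
    qed
    then show ?thesis unfolding generate_zeta[OF assms(1)] using assms(1)
      by (auto intro!: image_eqI[of _ _ "_ mod m"])
  qed
  moreover have "inj_on ?f {..<m}"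
  proof (rule linorder_inj_onI)
    fix i j :: nat assume ij: "i < j" "i \<in> {..<m}" "j \<in> {..<m}"
    show "?f i \<noteq> ?f j"
    proof
      assume "?f i = ?f j"
      also have "?f j = ?f i \<otimes>\<^bsub>Gamma m q\<^esub> ?f (j - i)" using nat_pow_mult[OF z] ij by simp
      finally have "?f (j - i) = \<one>\<^bsub>Gamma m q\<^esub>"
        using z by (metis l_cancel_one' nat_pow_closed)
      then have "m dvd j - i" using zeta_pow_eq_one_iff[OF assms(2)] by simp
      then show False using ij dvd_imp_le[of m "j - i"] by auto
    qed
  qed auto
  ultimately show "finite (generate (Gamma m q) {zeta m q})" "card (generate (Gamma m q) {zeta m q}) = m"
    by (simp_all add: card_image)
qed

section \<open>Actions from the presentation\<close>

text \<open>Both f X and f Y have finite order on P, so they are bijections and inverse letters can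
  act. Letters act from left to right, which gives a right action. The clause on r lets a map
  commuting with the generators pass through all words; translation by H is such a map.\<close>

lemma word_action:
  fixes P :: "'p set" and f :: "generator \<Rightarrow> 'p \<Rightarrow> 'p" and s :: "'p \<Rightarrow> 'p"
  assumes P: "finite P" and f_in: "\<And>g p. p \<in> P \<Longrightarrow> f g p \<in> P"
    and fX: "\<And>p. p \<in> P \<Longrightarrow> (f X ^^ 2) p = s p" and fY: "\<And>p. p \<in> P \<Longrightarrow> (f Y ^^ q) p = s p"
    and s: "\<And>p. p \<in> P \<Longrightarrow> (s ^^ m) p = p" and mq: "0 < m" "0 < q"
  obtains w :: "generator word \<Rightarrow> 'p \<Rightarrow> 'p"
    where "\<And>u p. p \<in> P \<Longrightarrow> w u p \<in> P"
      and "\<And>u v p. p \<in> P \<Longrightarrow> w (u @ v) p = w v (w u p)"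
      and "\<And>p. p \<in> P \<Longrightarrow> w [] p = p"
      and "\<And>g p. p \<in> P \<Longrightarrow> w [(True, g)] p = f g p"
      and "\<And>u v p. word_cong (Gamma_rels m q) u v \<Longrightarrow> p \<in> P \<Longrightarrow> w u p = w v p"
      and "\<And>r u p. (\<And>p. p \<in> P \<Longrightarrow> r p \<in> P) \<Longrightarrow> (\<And>g p. p \<in> P \<Longrightarrow> f g (r p) = r (f g p)) \<Longrightarrow>
        p \<in> P \<Longrightarrow> w u (r p) = r (w u p)"
proof -
  have pow_in: "(f g ^^ n) p \<in> P" if "p \<in> P" for g n p
    by (induction n) (use that f_in in auto)
  have pow_s: "(f g ^^ (k * n)) p = (s ^^ n) p \<and> (s ^^ n) p \<in> P"
    if k: "\<And>p. p \<in> P \<Longrightarrow> (f g ^^ k) p = s p" and p: "p \<in> P" for g k n p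
  proof (induction n)
    case (Suc n)
    have "(f g ^^ (k * Suc n)) p = (f g ^^ k) ((f g ^^ (k * n)) p)" by (simp add: funpow_add)
    then show ?case using Suc k pow_in[where p = "(s ^^ n) p" and g = g and n = k] by simp
  qed (use p in simp)
  have period: "\<exists>k. \<forall>p\<in>P. (f g ^^ Suc k) p = p" for g
  proof (cases g)
    case X
    have "(f g ^^ (2 * m)) p = p" if "p \<in> P" for p using pow_s[where g = X and k = 2 and p = p and n = m] fX s that X by simp
    then show ?thesis using mq by (intro exI[of _ "2 * m - 1"]) simp
  next
    case Y
    have "(f g ^^ (q * m)) p = p" if "p \<in> P" for p using pow_s[where g = Y and k = q and p = p and n = m] fY s that Y by simp
    then show ?thesis using mq by (intro exI[of _ "q * m - 1"]) simp
  qed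
  have bij: "bij_betw (f g) P P" for g
  proof -
    obtain k where k: "\<And>p. p \<in> P \<Longrightarrow> (f g ^^ Suc k) p = p" using period by blast
    have "inj_on (f g) P"
    proof (rule inj_on_inverseI)
      show "(f g ^^ k) (f g p) = p" if "p \<in> P" for p using k[OF that] by (simp add: funpow_swap1)
    qed
    then show ?thesis using endo_inj_surj[OF P] f_in by (auto simp: bij_betw_def)
  qed
  define l where "l a = (if fst a then f (snd a) else inv_into P (f (snd a)))" for a :: "bool \<times> generator"
  have l_in: "l a p \<in> P" if "p \<in> P" for a p
    using that f_in bij_betw_apply[OF bij_betw_inv_into[OF bij]] by (auto simp: l_def)
  define w where "w u = fold l u" for u
  have w_in: "w u p \<in> P" if "p \<in> P" for u p
    using that unfolding w_def by (induction u arbitrary: p) (auto simp: l_in)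
  have w_rep: "w (replicate n (True, g)) p = (f g ^^ n) p" for n g p
    unfolding w_def by (induction n arbitrary: p) (auto simp: l_def funpow_swap1)
  have cong: "w u p = w v p" if "word_cong (Gamma_rels m q) u v" "p \<in> P" for u v p
    using that
  proof (induction arbitrary: p rule: word_cong.induct)
    case (rel u v)
    have 1: "w (replicate (2 * m) (True, X)) p = p" "w (replicate (q * m) (True, Y)) p = p"
      "w (replicate 2 (True, X)) p = w (replicate q (True, Y)) p" "w [] p = p"
      unfolding w_rep using pow_s[where g = X and k = 2 and p = p and n = m]
        pow_s[where g = Y and k = q and p = p and n = m] fX fY s rel(2) by (auto simp: w_def)
    from rel(1) consider "u = replicate (2 * m) (True, X)" "v = []"
      | "u = replicate (q * m) (True, Y)" "v = []"
      | "u = replicate 2 (True, X)" "v = replicate q (True, Y)"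
      unfolding Gamma_rels_def by blast
    then show ?case by cases (simp_all only: 1)
  next
    case (cancel b g)
    show ?case using cancel bij_betw_inv_into_left[OF bij] bij_betw_inv_into_right[OF bij]
      by (auto simp: w_def l_def)
  next
    case (append u u' v v')
    then show ?case using w_in by (simp add: w_def)
  qed auto
  have comm: "w u (r p) = r (w u p)"
    if r: "\<And>p. p \<in> P \<Longrightarrow> r p \<in> P" "\<And>g p. p \<in> P \<Longrightarrow> f g (r p) = r (f g p)" and p: "p \<in> P" for r u p
  proof -
    have "l a (r p) = r (l a p)" if "p \<in> P" for a p
    proof (cases "fst a")
      case True then show ?thesis using r(2)[OF that] by (simp add: l_def)
    next
      case False
      have lp: "l a p \<in> P" by (rule l_in[OF that])
      have "f (snd a) (l a p) = p" using False bij_betw_inv_into_right[OF bij that] by (simp add: l_def)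
      then have "f (snd a) (r (l a p)) = r p" using r(2)[OF lp] by simp
      then show ?thesis using False bij_betw_inv_into_left[OF bij r(1)[OF lp], of "snd a"] by (simp add: l_def)
    qed
    then show ?thesis using p unfolding w_def by (induction u arbitrary: p) (auto simp: l_in)
  qed
  show thesis
    by (rule that[of w]) (use w_in cong comm in \<open>auto simp: w_def l_def\<close>)
qed

lemma DirProd_pow:
  "(a, h) [^]\<^bsub>G \<times>\<times> H\<^esub> (n::nat) = (a [^]\<^bsub>G\<^esub> n, h [^]\<^bsub>H\<^esub> n)"
  by (induction n) (simp_all add: nat_pow_def)

text \<open>For \<open>universal\<close>, words act on N x K by \<open>word_action\<close> and H
  acts separately by right translation. The two actions commute and combine to one of the direct
  product.\<close>

lemma coset_exploration_Gamma:
  assumes d: "0 < d" and q: "Factorial_Ring.prime q" and H: "Group.group H" "finite (carrier H)"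
  shows "coset_exploration (Gamma d q \<times>\<times> H) (generate (Gamma d q) {zeta d q} \<times> carrier H)
    (gen_class d q X, \<one>\<^bsub>H\<^esub>) (gen_class d q Y, \<one>\<^bsub>H\<^esub>) q"
proof -
  interpret A: Group.group "Gamma d q" by (rule group_Gamma)
  interpret H: Group.group H by (rule H)
  let ?A = "Gamma d q" and ?Z = "generate (Gamma d q) {zeta d q}"
  let ?G = "?A \<times>\<times> H" and ?K = "?Z \<times> carrier H"
  let ?x = "(gen_class d q X, \<one>\<^bsub>H\<^esub>)" and ?y = "(gen_class d q Y, \<one>\<^bsub>H\<^esub>)"
  let ?W = "generate ?G ({?x, ?y} \<union> ?K)" and ?c = "word_class (Gamma_rels d q)"
  have q0: "0 < q" using q by (rule prime_gt_0_nat)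
  interpret G: Group.group ?G by (rule DirProd_group) (rule group_Gamma, rule H)
  note z = zeta_in_carrier[of d q]
  have subZ: "subgroup ?Z ?A" using z by (intro A.generate_is_subgroup) auto
  have zZ: "zeta d q \<in> ?Z" by (rule generate.incl) simp
  have Zc: "a \<otimes>\<^bsub>?A\<^esub> b = b \<otimes>\<^bsub>?A\<^esub> a" if "a \<in> ?Z" "b \<in> carrier ?A" for a b
    using that zeta_pow_comm unfolding generate_zeta[OF d] by auto
  have xx: "?x \<otimes>\<^bsub>?G\<^esub> ?x = (zeta d q, \<one>\<^bsub>H\<^esub>)"
    unfolding zeta_X by (simp add: numeral_2_eq_2)
  have subK: "subgroup ?K ?G" by (rule DirProd_subgroups[OF group_Gamma subZ H(1) H.subgroup_self])
  have K_in: "k \<in> carrier ?G" if "k \<in> ?K" for k using that subgroup.subset[OF subK] by blast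
  show ?thesis
  proof (intro coset_exploration.intro coset_exploration_axioms.intro)
    show "Group.group ?G" by (rule G.is_group)
    show "subgroup ?K ?G" by (rule subK)
    show "finite ?K" using card_generate_zeta(1)[OF d q0] H(2) by simp
    show "?x \<in> carrier ?G" by simp
    show "?y \<in> carrier ?G" by simp
    show "k \<otimes>\<^bsub>?G\<^esub> ?x = ?x \<otimes>\<^bsub>?G\<^esub> k" if kK: "k \<in> ?K" for k
    proof -
      obtain a h where "k = (a, h)" "a \<in> ?Z" "h \<in> carrier H" using kK by blast
      then show ?thesis using Zc[OF _ gen_class_closed] by simp
    qed
    show "k \<otimes>\<^bsub>?G\<^esub> ?y = ?y \<otimes>\<^bsub>?G\<^esub> k" if kK: "k \<in> ?K" for k
    proof -
      obtain a h where "k = (a, h)" "a \<in> ?Z" "h \<in> carrier H" using kK by blast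
      then show ?thesis using Zc[OF _ gen_class_closed] by simp
    qed
    show "?x \<otimes>\<^bsub>?G\<^esub> ?x \<in> ?K" unfolding xx using zZ by simp
    show "?y [^]\<^bsub>?G\<^esub> q = ?x \<otimes>\<^bsub>?G\<^esub> ?x" unfolding xx DirProd_pow zeta_Y by simp
    show "Factorial_Ring.prime q" by (rule q)
    show "?W = carrier ?G"
    proof
      show "?W \<subseteq> carrier ?G"
        by (rule G.generate_incl) (use K_in in \<open>auto simp: carrier_DirProd\<close>)
      show "carrier ?G \<subseteq> ?W"
      proof
        fix g assume "g \<in> carrier ?G"
        then obtain a h where g: "g = (a, h)" "a \<in> carrier ?A" "h \<in> carrier H"
          by (auto simp: carrier_DirProd)
        obtain u where a: "a = ?c u" using g(2) by (auto simp: Gamma_carrier)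
        have letter: "(?c [l], \<one>\<^bsub>H\<^esub>) \<in> ?W" for l
        proof -
          obtain b e where l: "l = (b, e)" by force
          have ge: "(gen_class d q e, \<one>\<^bsub>H\<^esub>) \<in> {?x, ?y} \<union> ?K" by (cases e) auto
          show ?thesis
          proof (cases b)
            case True then show ?thesis unfolding l using generate.incl[OF ge, of ?G] by (simp add: gen_class_def)
          next
            case False
            have "(?c [l], \<one>\<^bsub>H\<^esub>) = inv\<^bsub>?G\<^esub> (gen_class d q e, \<one>\<^bsub>H\<^esub>)"
              using False unfolding l by (simp add: word_class_inverse_letter inv_DirProd[OF group_Gamma H(1)])
            then show ?thesis using generate.inv[OF ge, of ?G] by simp
          qed
        qed
        have "(?c u, \<one>\<^bsub>H\<^esub>) \<in> ?W"
        proof (induction u)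
          case Nil
          show ?case using generate.one[of ?G] by (simp add: Gamma_one)
        next
          case (Cons l u)
          show ?case using generate.eng[OF letter[of l] Cons.IH] by simp
        qed
        moreover have "(\<one>\<^bsub>?A\<^esub>, h) \<in> ?W"
          by (rule generate.incl) (use g(3) subgroup.one_closed[OF subZ] in auto)
        ultimately have "(a, \<one>\<^bsub>H\<^esub>) \<otimes>\<^bsub>?G\<^esub> (\<one>\<^bsub>?A\<^esub>, h) \<in> ?W"
          unfolding a by (rule generate.eng)
        then show "g \<in> ?W" using g by simp
      qed
    qed
  next
    fix N :: nat and S T :: "nat \<Rightarrow> nat \<times> generator word set \<times> 'a"
    let ?P = "{..<N} \<times> ?K"
    assume S: "\<forall>j<N. fst (S j) < N \<and> snd (S j) \<in> ?K"
      and SS: "\<forall>p\<in>?P. ext_label ?G S (ext_label ?G S p) = (fst p, ?x \<otimes>\<^bsub>?G\<^esub> ?x \<otimes>\<^bsub>?G\<^esub> snd p)"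
      and T: "\<forall>j<N. fst (T j) < N \<and> snd (T j) \<in> ?K"
      and TT: "\<forall>p\<in>?P. (ext_label ?G T ^^ q) p = (fst p, ?x \<otimes>\<^bsub>?G\<^esub> ?x \<otimes>\<^bsub>?G\<^esub> snd p)"
    define f where "f g = (case g of X \<Rightarrow> ext_label ?G S | Y \<Rightarrow> ext_label ?G T)" for g
    define s where "s p = (fst p :: nat, (zeta d q, \<one>\<^bsub>H\<^esub>) \<otimes>\<^bsub>?G\<^esub> snd p)" for p
    have lbl: "fst p < N" "snd p \<in> ?K" "snd p \<in> carrier ?G" if "p \<in> ?P" for p
    proof -
      show "fst p < N" and K: "snd p \<in> ?K" using that by (auto simp only: mem_Times_iff lessThan_iff)
      show "snd p \<in> carrier ?G" by (rule K_in[OF K])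
    qed
    have ST: "fst (S j) < N" "snd (S j) \<in> ?K" "fst (T j) < N" "snd (T j) \<in> ?K" if "j < N" for j
      using S T that by blast+
    have f_in: "f g p \<in> ?P" if p: "p \<in> ?P" for g p
    proof -
      have "snd (S (fst p)) \<otimes>\<^bsub>?G\<^esub> snd p \<in> ?K" "snd (T (fst p)) \<otimes>\<^bsub>?G\<^esub> snd p \<in> ?K"
        by (intro subgroup.m_closed[OF subK] ST(2,4)[OF lbl(1)[OF p]] lbl(2)[OF p])+
      then show ?thesis using ST[OF lbl(1)[OF p]] unfolding f_def ext_label_def by (cases g) simp_all
    qed
    have s_pow: "(s ^^ n) p = (fst p, (zeta d q [^]\<^bsub>?A\<^esub> n, \<one>\<^bsub>H\<^esub>) \<otimes>\<^bsub>?G\<^esub> snd p)" if "p \<in> ?P" for n p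
    proof (induction n)
      case 0
      have "snd p \<in> carrier ?G" by (rule lbl(3)[OF that])
      then have "\<one>\<^bsub>?G\<^esub> \<otimes>\<^bsub>?G\<^esub> snd p = snd p" by (rule G.l_one)
      then show ?case by (simp add: prod_eq_iff)
    next
      case (Suc n)
      have c: "snd p \<in> carrier ?G" "(zeta d q, \<one>\<^bsub>H\<^esub>) \<in> carrier ?G" "(zeta d q [^]\<^bsub>?A\<^esub> n, \<one>\<^bsub>H\<^esub>) \<in> carrier ?G"
        using lbl(3)[OF that] z by simp_all
      have "(zeta d q, \<one>\<^bsub>H\<^esub>) \<otimes>\<^bsub>?G\<^esub> (zeta d q [^]\<^bsub>?A\<^esub> n, \<one>\<^bsub>H\<^esub>) = (zeta d q [^]\<^bsub>?A\<^esub> Suc n, \<one>\<^bsub>H\<^esub>)"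
        using z A.nat_pow_Suc2[of "zeta d q" n] by simp
      then show ?case using Suc G.m_assoc[OF c(2,3,1)] by (simp add: s_def del: mult_DirProd)
    qed
    have fX: "(f X ^^ 2) p = s p" if "p \<in> ?P" for p
      using bspec[OF SS that] unfolding xx by (simp add: f_def s_def numeral_2_eq_2 del: mult_DirProd)
    have fY: "(f Y ^^ q) p = s p" if "p \<in> ?P" for p
      using bspec[OF TT that] unfolding xx by (simp add: f_def s_def del: mult_DirProd)
    have sm: "(s ^^ d) p = p" if "p \<in> ?P" for p
    proof -
      have "snd p \<in> carrier ?G" by (rule lbl(3)[OF that])
      then have "\<one>\<^bsub>?G\<^esub> \<otimes>\<^bsub>?G\<^esub> snd p = snd p" by (rule G.l_one)
      then show ?thesis unfolding s_pow[OF that] zeta_pow_order by (simp add: prod_eq_iff)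
    qed
    have finP: "finite ?P" using card_generate_zeta(1)[OF d q0] H(2) by simp
    obtain w where w_in: "\<And>u p. p \<in> ?P \<Longrightarrow> w u p \<in> ?P"
      and w_app: "\<And>u v p. p \<in> ?P \<Longrightarrow> w (u @ v) p = w v (w u p)"
      and w_Nil: "\<And>p. p \<in> ?P \<Longrightarrow> w [] p = p"
      and w_gen: "\<And>g p. p \<in> ?P \<Longrightarrow> w [(True, g)] p = f g p"
      and w_cong: "\<And>u v p. word_cong (Gamma_rels d q) u v \<Longrightarrow> p \<in> ?P \<Longrightarrow> w u p = w v p"
      and w_comm: "\<And>r u p. (\<And>p. p \<in> ?P \<Longrightarrow> r p \<in> ?P) \<Longrightarrow> (\<And>g p. p \<in> ?P \<Longrightarrow> f g (r p) = r (f g p)) \<Longrightarrow>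
        p \<in> ?P \<Longrightarrow> w u (r p) = r (w u p)"
      by (rule word_action[OF finP f_in fX fY sm d q0]) blast+
    \<comment> \<open>Right translation by H commutes with \<open>f X\<close> and
      \<open>f Y\<close>, which multiply K-labels on the left.\<close>
    define sh where "sh h p = (fst p :: nat, snd p \<otimes>\<^bsub>?G\<^esub> (\<one>\<^bsub>?A\<^esub>, h))" for h p
    have h_in: "(\<one>\<^bsub>?A\<^esub>, h) \<in> ?K" if "h \<in> carrier H" for h
      using that subgroup.one_closed[OF subZ] by simp
    have sh_in: "sh h p \<in> ?P" if "h \<in> carrier H" "p \<in> ?P" for h p
    proof -
      have "snd p \<otimes>\<^bsub>?G\<^esub> (\<one>\<^bsub>?A\<^esub>, h) \<in> ?K"
        by (rule subgroup.m_closed[OF subK lbl(2)[OF that(2)] h_in[OF that(1)]])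
      then show ?thesis using lbl(1)[OF that(2)] by (simp add: sh_def del: mult_DirProd)
    qed
    have f_sh: "f g (sh h p) = sh h (f g p)" if h: "h \<in> carrier H" and p: "p \<in> ?P" for g h p
    proof -
      have "snd (S (fst p)) \<in> carrier ?G" "snd (T (fst p)) \<in> carrier ?G" "snd p \<in> carrier ?G"
        by (intro K_in ST(2,4)[OF lbl(1)[OF p]] lbl(3)[OF p])+
      then show ?thesis using K_in[OF h_in[OF h]]
        by (cases g) (simp_all add: f_def ext_label_def sh_def G.m_assoc del: mult_DirProd)
    qed
    \<comment> \<open>A group element is a class of words; \<open>w_cong\<close> makes the choice of
      the word immaterial.\<close>
    define act where "act g p = sh (snd g) (w (SOME u. u \<in> fst g) p)" for g :: "generator word set \<times> 'a" and p
    have act_eq: "act (?c u, h) p = sh h (w u p)" if "p \<in> ?P" for u h p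
    proof -
      have "u \<in> ?c u" by (simp add: word_class_def word_cong.refl)
      then have "(SOME v. v \<in> ?c u) \<in> ?c u" by (rule someI)
      then show ?thesis using w_cong[OF _ that] by (simp add: act_def word_class_def)
    qed
    have sh_one: "sh \<one>\<^bsub>H\<^esub> p = p" if "p \<in> ?P" for p
    proof -
      have "snd p \<in> carrier ?G" by (rule lbl(3)[OF that])
      then have "snd p \<otimes>\<^bsub>?G\<^esub> \<one>\<^bsub>?G\<^esub> = snd p" by (rule G.r_one)
      then show ?thesis by (simp add: sh_def prod_eq_iff)
    qed
    show "\<exists>act. (\<forall>g\<in>carrier ?G. \<forall>p\<in>?P. act g p \<in> ?P) \<and>
        (\<forall>g\<in>carrier ?G. \<forall>h\<in>carrier ?G. \<forall>p\<in>?P. act (g \<otimes>\<^bsub>?G\<^esub> h) p = act h (act g p)) \<and>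
        (\<forall>p\<in>?P. act ?x p = ext_label ?G S p \<and> act ?y p = ext_label ?G T p \<and>
          (\<forall>k\<in>?K. act k p = (fst p, snd p \<otimes>\<^bsub>?G\<^esub> k)))"
    proof (intro exI[of _ act] conjI ballI)
      fix g p assume "g \<in> carrier ?G" "p \<in> ?P"
      then show "act g p \<in> ?P"
        using sh_in[OF _ w_in] act_eq by (auto simp: carrier_DirProd Gamma_carrier)
    next
      fix g g' p assume g: "g \<in> carrier ?G" and g': "g' \<in> carrier ?G" and p: "p \<in> ?P"
      obtain u h u' h' where e: "g = (?c u, h)" "g' = (?c u', h')"
        "h \<in> carrier H" "h' \<in> carrier H" using g g' by (auto simp: carrier_DirProd Gamma_carrier)
      have wp: "w u p \<in> ?P" "w u' (w u p) \<in> ?P" using w_in p by blast+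
      have sh2: "sh (h \<otimes>\<^bsub>H\<^esub> h') p' = sh h' (sh h p')" if "p' \<in> ?P" for p'
      proof -
        have "snd p' \<in> carrier ?G" by (rule lbl(3)[OF that])
        then have "snd p' \<otimes>\<^bsub>?G\<^esub> (\<one>\<^bsub>?A\<^esub>, h) \<otimes>\<^bsub>?G\<^esub> (\<one>\<^bsub>?A\<^esub>, h') = snd p' \<otimes>\<^bsub>?G\<^esub> ((\<one>\<^bsub>?A\<^esub>, h) \<otimes>\<^bsub>?G\<^esub> (\<one>\<^bsub>?A\<^esub>, h'))"
          using K_in[OF h_in] e(3,4) by (intro G.m_assoc) auto
        then show ?thesis by (simp add: sh_def)
      qed
      have "act (g \<otimes>\<^bsub>?G\<^esub> g') p = sh (h \<otimes>\<^bsub>H\<^esub> h') (w u' (w u p))"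
        unfolding e using act_eq[OF p] w_app[OF p] by simp
      also have "\<dots> = sh h' (sh h (w u' (w u p)))" by (rule sh2[OF wp(2)])
      also have "sh h (w u' (w u p)) = w u' (sh h (w u p))"
        by (rule w_comm[symmetric]) (use sh_in f_sh e(3) wp in auto)
      also have "sh h' (w u' (sh h (w u p))) = act g' (act g p)"
        unfolding e using act_eq[OF p] act_eq[OF sh_in[OF e(3) wp(1)]] by simp
      finally show "act (g \<otimes>\<^bsub>?G\<^esub> g') p = act g' (act g p)" .
    next
      fix p assume p: "p \<in> ?P"
      show "act ?x p = ext_label ?G S p"
        unfolding gen_class_def act_eq[OF p] w_gen[OF p] sh_one[OF f_in[OF p]] by (simp add: f_def)
      show "act ?y p = ext_label ?G T p"
        unfolding gen_class_def act_eq[OF p] w_gen[OF p] sh_one[OF f_in[OF p]] by (simp add: f_def)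
      fix k assume "k \<in> ?K"
      then obtain i :: nat and h where k: "k = (zeta d q [^]\<^bsub>?A\<^esub> i, h)" "h \<in> carrier H"
        unfolding generate_zeta[OF d] by auto
      have w_X: "w (replicate n (True, X)) p' = (f X ^^ n) p'" if "p' \<in> ?P" for n p'
        using that
      proof (induction n arbitrary: p')
        case (Suc n)
        have "w ([(True, X)] @ replicate n (True, X)) p' = (f X ^^ n) (f X p')"
          using w_app[OF Suc.prems, of "[(True, X)]"] w_gen[OF Suc.prems] Suc.IH[OF f_in[OF Suc.prems]] by simp
        then show ?case by (simp add: funpow_swap1)
      qed (use w_Nil in simp)
      have fpow: "(f X ^^ (2 * i)) p = (s ^^ i) p"
      proof (induction i)
        case (Suc i)
        have "(s ^^ i) p \<in> ?P" using Suc w_X[OF p, of "2 * i"] w_in[OF p, of "replicate (2 * i) (True, X)"] by metis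
        then have "(f X ^^ 2) ((s ^^ i) p) = s ((s ^^ i) p)" by (rule fX)
        then show ?case using Suc by (simp add: numeral_2_eq_2)
      qed simp
      have "zeta d q [^]\<^bsub>?A\<^esub> i = ?c (replicate (2 * i) (True, X))"
        unfolding word_class_replicate zeta_X by (simp add: A.nat_pow_pow)
      then have "act k p = sh h ((s ^^ i) p)"
        using act_eq[OF p] w_X[OF p] fpow k(1) by simp
      \<comment> \<open>The powers of s multiply by zeta^i on the left, but \<open>universal\<close>
        asks for right multiplication; zeta is central.\<close>
      also have "\<dots> = (fst p, snd p \<otimes>\<^bsub>?G\<^esub> k)"
      proof -
        obtain j a b where jab: "p = (j, (a, b))" "a \<in> ?Z" "b \<in> carrier H" using p by auto
        have "a \<in> carrier ?A" using jab(2) subgroup.subset[OF subZ] by blast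
        moreover have "(s ^^ i) p = (j, (zeta d q [^]\<^bsub>?A\<^esub> i \<otimes>\<^bsub>?A\<^esub> a, b))"
          using s_pow[OF p, of i] jab by simp
        ultimately show ?thesis unfolding sh_def k(1)
          using z jab(1,3) k(2) zeta_pow_comm[of a d q i] by simp
      qed
      finally show "act k p = (fst p, snd p \<otimes>\<^bsub>?G\<^esub> k)" .
    qed
  qed
qed

section \<open>Subgroups with a homomorphism as subgroups of a direct product\<close>

definition graph_of :: "'a set \<Rightarrow> ('a \<Rightarrow> 'b) \<Rightarrow> ('a \<times> 'b) set" where
  "graph_of D f = (\<lambda>a. (a, f a)) ` D"

lemma graph_of_iff [simp]: "(a, h) \<in> graph_of D f \<longleftrightarrow> a \<in> D \<and> h = f a"
  by (auto simp: graph_of_def)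

locale group_pair = A: Group.group A + H: Group.group H for A (structure) and H (structure)
begin

lemma group_product: "Group.group (A \<times>\<times> H)"
  by (rule DirProd_group[OF A.is_group H.is_group])

lemma hom_restrict:
  assumes D: "subgroup D A" and f: "f \<in> hom (A\<lparr>carrier := D\<rparr>) H"
  shows "a \<in> D \<Longrightarrow> f a \<in> carrier H" "a \<in> D \<Longrightarrow> b \<in> D \<Longrightarrow> f (a \<otimes> b) = f a \<otimes>\<^bsub>H\<^esub> f b"
    "f \<one> = \<one>\<^bsub>H\<^esub>" "a \<in> D \<Longrightarrow> f (inv a) = inv\<^bsub>H\<^esub> f a"
proof -
  show c: "a \<in> D \<Longrightarrow> f a \<in> carrier H" for a using f by (auto simp: hom_def)
  show m: "a \<in> D \<Longrightarrow> b \<in> D \<Longrightarrow> f (a \<otimes> b) = f a \<otimes>\<^bsub>H\<^esub> f b" for a b using f by (auto simp: hom_def)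
  have 1: "\<one> \<in> D" using subgroup.one_closed[OF D] .
  have "f \<one> \<otimes>\<^bsub>H\<^esub> f \<one> = f \<one>" using m[OF 1 1] by simp
  then show one: "f \<one> = \<one>\<^bsub>H\<^esub>"
    by (rule H.l_cancel_one[OF c[OF 1] c[OF 1], THEN iffD1])
  show "f (inv a) = inv\<^bsub>H\<^esub> f a" if a: "a \<in> D"
  proof -
    have i: "inv a \<in> D" using subgroup.m_inv_closed[OF D a] .
    have "f (inv a) \<otimes>\<^bsub>H\<^esub> f a = \<one>\<^bsub>H\<^esub>"
      using m[OF i a] one subgroup.mem_carrier[OF D a] by simp
    then show ?thesis using c[OF a] c[OF i] by (intro H.inv_equality[symmetric]) auto
  qed
qed

lemma subgroup_graph:
  assumes D: "subgroup D A" and f: "f \<in> hom (A\<lparr>carrier := D\<rparr>) H"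
  shows "subgroup (graph_of D f) (A \<times>\<times> H)"
proof -
  interpret P: Group.group "A \<times>\<times> H" by (rule group_product)
  note h = hom_restrict[OF D f] and Dc = subgroup.mem_carrier[OF D]
  show ?thesis
  proof (rule P.subgroupI)
    show "graph_of D f \<subseteq> carrier (A \<times>\<times> H)" using h(1) Dc by (auto simp: graph_of_def)
    show "graph_of D f \<noteq> {}" using subgroup.one_closed[OF D] by (auto simp: graph_of_def)
    show "inv\<^bsub>A \<times>\<times> H\<^esub> p \<in> graph_of D f" if p: "p \<in> graph_of D f" for p
    proof -
      obtain a where a: "a \<in> D" "p = (a, f a)" using p by (auto simp: graph_of_def)
      then have "inv\<^bsub>A \<times>\<times> H\<^esub> p = (inv a, inv\<^bsub>H\<^esub> f a)"
        using h(1) Dc by (simp add: inv_DirProd[OF A.is_group H.is_group])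
      then show ?thesis using a h(4) subgroup.m_inv_closed[OF D] by simp
    qed
    show "p \<otimes>\<^bsub>A \<times>\<times> H\<^esub> r \<in> graph_of D f" if pr: "p \<in> graph_of D f" "r \<in> graph_of D f" for p r
    proof -
      obtain a b where "a \<in> D" "p = (a, f a)" "b \<in> D" "r = (b, f b)"
        using pr by (auto simp: graph_of_def)
      then show ?thesis using h(2) subgroup.m_closed[OF D] by simp
    qed
  qed
qed

text \<open>Over each element of D the graph has a single point, so after fixing representatives r C
  of the cosets of D the second coordinate k is free.\<close>

lemma rcosets_graph:
  assumes D: "subgroup D A" and f: "f \<in> hom (A\<lparr>carrier := D\<rparr>) H"
  shows "\<exists>F. bij_betw F ((rcosets D) \<times> carrier H) (rcosets\<^bsub>A \<times>\<times> H\<^esub> graph_of D f)"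
proof -
  interpret P: Group.group "A \<times>\<times> H" by (rule group_product)
  note h = hom_restrict[OF D f] and Dc = subgroup.mem_carrier[OF D]
  let ?g = "graph_of D f"
  have eq: "?g #>\<^bsub>A \<times>\<times> H\<^esub> (a, k) = ?g #>\<^bsub>A \<times>\<times> H\<^esub> (a', k') \<longleftrightarrow>
      a \<otimes> inv a' \<in> D \<and> k \<otimes>\<^bsub>H\<^esub> inv\<^bsub>H\<^esub> k' = f (a \<otimes> inv a')"
    if "a \<in> carrier A" "a' \<in> carrier A" "k \<in> carrier H" "k' \<in> carrier H" for a a' k k'
    using P.rcoset_eq_iff[OF subgroup_graph[OF D f], of "(a, k)" "(a', k')"] that
    by (simp add: inv_DirProd[OF A.is_group H.is_group])
  have "\<forall>C\<in>rcosets D. \<exists>a. a \<in> carrier A \<and> C = D #> a" by (auto simp: RCOSETS_def)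
  then obtain r where r: "\<And>C. C \<in> rcosets D \<Longrightarrow> r C \<in> carrier A \<and> C = D #> r C"
    by metis
  let ?F = "\<lambda>(C, k). ?g #>\<^bsub>A \<times>\<times> H\<^esub> (r C, k)"
  have "inj_on ?F ((rcosets D) \<times> carrier H)"
  proof (rule inj_onI, clarsimp)
    fix C k C' k' assume C: "C \<in> rcosets D" "C' \<in> rcosets D" and k: "k \<in> carrier H" "k' \<in> carrier H"
      and e: "?g #>\<^bsub>A \<times>\<times> H\<^esub> (r C, k) = ?g #>\<^bsub>A \<times>\<times> H\<^esub> (r C', k')"
    note rC = r[OF C(1)] r[OF C(2)]
    have e': "r C \<otimes> inv r C' \<in> D" "k \<otimes>\<^bsub>H\<^esub> inv\<^bsub>H\<^esub> k' = f (r C \<otimes> inv r C')"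
      using e eq[of "r C" "r C'" k k'] rC k by auto
    then have "D #> r C = D #> r C'" using A.rcoset_eq_iff[OF D] rC by blast
    then have CC: "C = C'" using rC by metis
    then have "k \<otimes>\<^bsub>H\<^esub> inv\<^bsub>H\<^esub> k' = \<one>\<^bsub>H\<^esub>" using e'(2) rC h(3) by simp
    then have "k = k'" using k by (metis H.inv_equality H.inv_inv H.inv_closed)
    then show "C = C' \<and> k = k'" using CC by simp
  qed
  moreover have "?F ` ((rcosets D) \<times> carrier H) = rcosets\<^bsub>A \<times>\<times> H\<^esub> ?g"
  proof
    show "?F ` ((rcosets D) \<times> carrier H) \<subseteq> rcosets\<^bsub>A \<times>\<times> H\<^esub> ?g"
      using r by (auto simp: RCOSETS_def)
    show "rcosets\<^bsub>A \<times>\<times> H\<^esub> ?g \<subseteq> ?F ` ((rcosets D) \<times> carrier H)"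
    proof
      fix E assume "E \<in> rcosets\<^bsub>A \<times>\<times> H\<^esub> ?g"
      then obtain a k where a: "a \<in> carrier A" "k \<in> carrier H" "E = ?g #>\<^bsub>A \<times>\<times> H\<^esub> (a, k)"
        by (auto simp: RCOSETS_def)
      define C where "C = D #> a"
      have C: "C \<in> rcosets D" using a by (auto simp: RCOSETS_def C_def)
      note rC = r[OF C]
      have d: "r C \<otimes> inv a \<in> D" using A.rcoset_eq_iff[OF D, of "r C" a] rC a(1) C_def by metis
      \<comment> \<open>The correction of k that compensates for replacing a by the chosen
        representative of its coset.\<close>
      let ?k = "f (r C \<otimes> inv a) \<otimes>\<^bsub>H\<^esub> k"
      have k: "?k \<in> carrier H" using h(1)[OF d] a(2) by simp
      have "?k \<otimes>\<^bsub>H\<^esub> inv\<^bsub>H\<^esub> k = f (r C \<otimes> inv a)"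
        using h(1)[OF d] a(2) by (simp add: H.m_assoc)
      then have "?g #>\<^bsub>A \<times>\<times> H\<^esub> (r C, ?k) = E" using eq[of "r C" a ?k k] rC a k d by simp
      then show "E \<in> ?F ` ((rcosets D) \<times> carrier H)" using C k by force
    qed
  qed
  ultimately show ?thesis by (auto simp: bij_betw_def intro: exI[of _ ?F])
qed

lemma index_graph:
  assumes D: "subgroup D A" and f: "f \<in> hom (A\<lparr>carrier := D\<rparr>) H" and H: "finite (carrier H)"
  shows "graph_of D f \<in> subgroups_of_index (A \<times>\<times> H) (n * card (carrier H)) \<longleftrightarrow> D \<in> subgroups_of_index A n"
proof -
  obtain F where F: "bij_betw F ((rcosets D) \<times> carrier H) (rcosets\<^bsub>A \<times>\<times> H\<^esub> graph_of D f)"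
    using rcosets_graph[OF D f] by blast
  have ne: "carrier H \<noteq> {}" using H.one_closed by blast
  then have "card (carrier H) > 0" using H by (simp add: card_gt_0_iff)
  moreover have "card (rcosets\<^bsub>A \<times>\<times> H\<^esub> graph_of D f) = card (rcosets D) * card (carrier H)"
    using bij_betw_same_card[OF F] by (simp add: card_cartesian_product)
  moreover have "finite (rcosets\<^bsub>A \<times>\<times> H\<^esub> graph_of D f) \<longleftrightarrow> finite (rcosets D)"
    using bij_betw_finite[OF F] H ne finite_cartesian_productD1[of "rcosets D" "carrier H"] by auto
  ultimately show ?thesis using D subgroup_graph[OF D f] by (auto simp: subgroups_of_index_def)
qed

text \<open>As Z contains the identity, D meets 1 x H trivially, so the first projection is
  injective on D.\<close>

lemma subgroup_is_graph:
  assumes D: "subgroup D (A \<times>\<times> H)" and Z: "\<one> \<in> Z"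
    and DK: "D \<inter> Z \<times> carrier H = {\<one>\<^bsub>A \<times>\<times> H\<^esub>}"
  obtains E f where "subgroup E A" "f \<in> hom (A\<lparr>carrier := E\<rparr>) H \<inter> extensional E"
    "E \<inter> Z = {\<one>}" "D = graph_of E f"
proof -
  interpret P: Group.group "A \<times>\<times> H" by (rule group_product)
  have Dc: "a \<in> carrier A \<and> h \<in> carrier H" if "(a, h) \<in> D" for a h
    using subgroup.mem_carrier[OF D that] by simp
  have Dm: "(a \<otimes> b, h \<otimes>\<^bsub>H\<^esub> k) \<in> D" if "(a, h) \<in> D" "(b, k) \<in> D" for a b h k
    using subgroup.m_closed[OF D that] by simp
  have Di: "(inv a, inv\<^bsub>H\<^esub> h) \<in> D" if "(a, h) \<in> D" for a h
    using subgroup.m_inv_closed[OF D that] Dc[OF that] by (simp add: inv_DirProd[OF A.is_group H.is_group])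
  have D1: "(\<one>, \<one>\<^bsub>H\<^esub>) \<in> D" using subgroup.one_closed[OF D] by simp
  have one: "a = \<one> \<and> h = \<one>\<^bsub>H\<^esub>" if "(a, h) \<in> D" "a \<in> Z" for a h
  proof -
    have "(a, h) \<in> D \<inter> Z \<times> carrier H" using that Dc by blast
    then show ?thesis unfolding DK by simp
  qed
  have uniq: "h = k" if "(a, h) \<in> D" "(a, k) \<in> D" for a h k
  proof -
    have "(\<one>, h \<otimes>\<^bsub>H\<^esub> inv\<^bsub>H\<^esub> k) \<in> D" using Dm[OF that(1) Di[OF that(2)]] Dc that by simp
    then have "h \<otimes>\<^bsub>H\<^esub> inv\<^bsub>H\<^esub> k = \<one>\<^bsub>H\<^esub>" using one Z by blast
    then show ?thesis using Dc that by (metis H.inv_equality H.inv_inv H.inv_closed)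
  qed
  define E where "E = fst ` D"
  have EE: "a \<in> E \<longleftrightarrow> (\<exists>h. (a, h) \<in> D)" for a by (force simp: E_def)
  define f where "f = restrict (\<lambda>a. THE h. (a, h) \<in> D) E"
  have f: "(a, h) \<in> D \<longleftrightarrow> a \<in> E \<and> h = f a" for a h
  proof (cases "a \<in> E")
    case True
    then obtain k where k: "(a, k) \<in> D" using EE by blast
    then have "(THE h. (a, h) \<in> D) = k" using uniq by blast
    then have "f a = k" using True by (simp add: f_def)
    then show ?thesis using k True uniq by blast
  next
    case False
    then show ?thesis using EE by blast
  qed
  have subE: "subgroup E A"
  proof (rule A.subgroupI)
    show "E \<subseteq> carrier A" using Dc EE by blast
    show "E \<noteq> {}" using D1 EE by blast
    show "inv a \<in> E" if "a \<in> E" for a using that Di EE by blast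
    show "a \<otimes> b \<in> E" if "a \<in> E" "b \<in> E" for a b using that Dm EE by blast
  qed
  moreover have "f \<in> hom (A\<lparr>carrier := E\<rparr>) H"
  proof (rule homI)
    show "f a \<in> carrier H" if "a \<in> carrier (A\<lparr>carrier := E\<rparr>)" for a
      using that f[of a "f a"] Dc by simp
    show "f (a \<otimes>\<^bsub>A\<lparr>carrier := E\<rparr>\<^esub> b) = f a \<otimes>\<^bsub>H\<^esub> f b"
      if "a \<in> carrier (A\<lparr>carrier := E\<rparr>)" "b \<in> carrier (A\<lparr>carrier := E\<rparr>)" for a b
    proof -
      have "(a, f a) \<in> D" "(b, f b) \<in> D" using that f by simp_all
      then show ?thesis using Dm f by simp
    qed
  qed
  moreover have "f \<in> extensional E" by (simp add: f_def)
  moreover have "E \<inter> Z = {\<one>}" using one EE D1 Z by blast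
  moreover have "D = graph_of E f" using f by auto
  ultimately show thesis using that by blast
qed

lemma card_pairs:
  fixes n :: nat
  assumes H: "finite (carrier H)" and Z: "\<one> \<in> Z"
  defines "\<D> \<equiv> {D. subgroup D (A \<times>\<times> H) \<and> D \<inter> Z \<times> carrier H = {\<one>\<^bsub>A \<times>\<times> H\<^esub>} \<and>
    finite (rcosets\<^bsub>A \<times>\<times> H\<^esub> D) \<and> card (rcosets\<^bsub>A \<times>\<times> H\<^esub> D) = n * card (carrier H)}"
  assumes fin: "finite \<D>"
  shows "finite {D \<in> subgroups_of_index A n. D \<inter> Z = {\<one>}}"
    and "(\<Sum>D\<in>{D \<in> subgroups_of_index A n. D \<inter> Z = {\<one>}}. card_Hom (A\<lparr>carrier := D\<rparr>) H) = card \<D>"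
proof -
  let ?S = "{D \<in> subgroups_of_index A n. D \<inter> Z = {\<one>}}"
  define Q where "Q D = hom (A\<lparr>carrier := D\<rparr>) H \<inter> extensional D" for D
  have S: "subgroup D A" if "D \<in> ?S" for D using that by (simp add: subgroups_of_index_def)
  have \<D>: "D \<in> \<D> \<longleftrightarrow> D \<in> subgroups_of_index (A \<times>\<times> H) (n * card (carrier H)) \<and>
      D \<inter> Z \<times> carrier H = {\<one>\<^bsub>A \<times>\<times> H\<^esub>}" for D
    by (auto simp: \<D>_def subgroups_of_index_def)
  have bij: "bij_betw (\<lambda>(D, f). graph_of D f) (Sigma ?S Q) \<D>"
  proof (rule bij_betw_imageI)
    show "inj_on (\<lambda>(D, f). graph_of D f) (Sigma ?S Q)"
    proof (rule inj_onI)
      fix u v assume u: "u \<in> Sigma ?S Q" and v: "v \<in> Sigma ?S Q"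
        and e: "(\<lambda>(D, f). graph_of D f) u = (\<lambda>(D, f). graph_of D f) v"
      obtain D f where u': "u = (D, f)" "f \<in> extensional D" using u by (auto simp: Q_def)
      obtain E g where v': "v = (E, g)" "g \<in> extensional E" using v by (auto simp: Q_def)
      have e': "(a, h) \<in> graph_of D f \<longleftrightarrow> (a, h) \<in> graph_of E g" for a h using e u' v' by simp
      have DE: "D = E" using e' by (auto simp: set_eq_iff)
      moreover have "f = g"
      proof (rule extensionalityI)
        show "f \<in> extensional D" by (rule u')
        show "g \<in> extensional D" using v' DE by simp
        show "f a = g a" if "a \<in> D" for a using e'[of a "f a"] that by simp
      qed
      ultimately show "u = v" using u' v' by simp
    qed
    show "(\<lambda>(D, f). graph_of D f) ` Sigma ?S Q = \<D>"
    proof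
      show "(\<lambda>(D, f). graph_of D f) ` Sigma ?S Q \<subseteq> \<D>"
      proof
        fix E assume "E \<in> (\<lambda>(D, f). graph_of D f) ` Sigma ?S Q"
        then obtain D f where Df: "D \<in> ?S" "f \<in> Q D" "E = graph_of D f" by auto
        have f: "f \<in> hom (A\<lparr>carrier := D\<rparr>) H" using Df by (simp add: Q_def)
        have "graph_of D f \<inter> Z \<times> carrier H = {\<one>\<^bsub>A \<times>\<times> H\<^esub>}"
        proof -
          have DZ: "a \<in> D \<and> a \<in> Z \<longleftrightarrow> a = \<one>" for a using Df(1) by blast
          have "(a, h) \<in> graph_of D f \<inter> Z \<times> carrier H \<longleftrightarrow> (a, h) = (\<one>, \<one>\<^bsub>H\<^esub>)" for a h
            using DZ[of a] hom_restrict(3)[OF S[OF Df(1)] f] by auto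
          then show ?thesis unfolding one_DirProd set_eq_iff singleton_iff by (metis surj_pair)
        qed
        moreover have "graph_of D f \<in> subgroups_of_index (A \<times>\<times> H) (n * card (carrier H))"
          using index_graph[OF S[OF Df(1)] f H, of n] Df(1) by blast
        ultimately show "E \<in> \<D>" using Df(3) \<D> by blast
      qed
      show "\<D> \<subseteq> (\<lambda>(D, f). graph_of D f) ` Sigma ?S Q"
      proof
        fix D assume D: "D \<in> \<D>"
        then have "subgroup D (A \<times>\<times> H)" "D \<inter> Z \<times> carrier H = {\<one>\<^bsub>A \<times>\<times> H\<^esub>}" by (auto simp: \<D>_def)
        then obtain E f where E: "subgroup E A" "f \<in> Q E" "E \<inter> Z = {\<one>}" "D = graph_of E f"
          using subgroup_is_graph[OF _ Z] unfolding Q_def by metis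
        have "E \<in> subgroups_of_index A n"
          using index_graph[OF E(1) _ H, of f n] E D \<D> by (simp add: Q_def)
        then have "(E, f) \<in> Sigma ?S Q" using E by blast
        then show "D \<in> (\<lambda>(D, f). graph_of D f) ` Sigma ?S Q" using E(4) by force
      qed
    qed
  qed
  have finS: "finite (Sigma ?S Q)" using bij_betw_finite[OF bij] fin by simp
  \<comment> \<open>Every subgroup carries at least the trivial homomorphism, so finiteness of the
    set of pairs passes to the set of subgroups.\<close>
  have triv: "restrict (\<lambda>_. \<one>\<^bsub>H\<^esub>) D \<in> Q D" if "D \<in> ?S" for D
    using subgroup.m_closed[OF S[OF that]] by (auto simp: Q_def hom_def)
  have "?S \<subseteq> fst ` Sigma ?S Q"
  proof
    fix D assume D: "D \<in> ?S"
    have "(D, restrict (\<lambda>_. \<one>\<^bsub>H\<^esub>) D) \<in> Sigma ?S Q" by (rule SigmaI) (rule D, rule triv[OF D])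
    then show "D \<in> fst ` Sigma ?S Q" by (rule image_eqI[rotated]) simp
  qed
  then show finS1: "finite ?S" by (rule finite_subset[OF _ finite_imageI[OF finS]])
  have "finite (Q D)" if "D \<in> ?S" for D
  proof -
    have "Pair D ` Q D \<subseteq> Sigma ?S Q" using that by blast
    then have "finite (Pair D ` Q D)" by (rule finite_subset[OF _ finS])
    then show ?thesis by (rule finite_imageD) (simp add: inj_on_def)
  qed
  then have "card (Sigma ?S Q) = (\<Sum>D\<in>?S. card (Q D))" using finS1 by simp
  moreover have "card_Hom (A\<lparr>carrier := D\<rparr>) H = card (Q D)" for D
    by (simp add: card_Hom_def Q_def)
  ultimately show "(\<Sum>D\<in>?S. card_Hom (A\<lparr>carrier := D\<rparr>) H) = card \<D>"
    using bij_betw_same_card[OF bij] by simp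
qed

end

section \<open>The parity for a single divisor d\<close>

text \<open>Inversion acts on the q-th roots of 1, and a fixed point has h^2 = 1 and h^q = 1 with q
  odd, so it is 1.\<close>

lemma odd_card_odd_roots:
  fixes q :: nat
  assumes "Group.group H" "finite (carrier H)" "odd q"
  shows "odd (card {h \<in> carrier H. h [^]\<^bsub>H\<^esub> q = \<one>\<^bsub>H\<^esub>})"
proof -
  interpret H: Group.group H by (rule assms(1))
  let ?R = "{h \<in> carrier H. h [^]\<^bsub>H\<^esub> q = \<one>\<^bsub>H\<^esub>}"
  obtain k where q: "q = 2 * k + 1" using assms(3) by (elim oddE)
  have "{h \<in> ?R. inv\<^bsub>H\<^esub> h = h} = {\<one>\<^bsub>H\<^esub>}"
  proof
    show "{h \<in> ?R. inv\<^bsub>H\<^esub> h = h} \<subseteq> {\<one>\<^bsub>H\<^esub>}"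
    proof
      fix h assume "h \<in> {h \<in> ?R. inv\<^bsub>H\<^esub> h = h}"
      then have h: "h \<in> carrier H" "h [^]\<^bsub>H\<^esub> q = \<one>\<^bsub>H\<^esub>" "inv\<^bsub>H\<^esub> h = h" by auto
      have "h \<otimes>\<^bsub>H\<^esub> h = \<one>\<^bsub>H\<^esub>" using H.l_inv[OF h(1)] unfolding h(3) .
      then have "h [^]\<^bsub>H\<^esub> (2::nat) = \<one>\<^bsub>H\<^esub>" using h(1) by (simp add: numeral_2_eq_2)
      then have "h [^]\<^bsub>H\<^esub> (2 * k) = \<one>\<^bsub>H\<^esub>"
        using H.nat_pow_pow[OF h(1), where n = 2 and m = k] by simp
      then show "h \<in> {\<one>\<^bsub>H\<^esub>}" using h(1,2) unfolding q by simp
    qed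
  qed auto
  moreover have "even (card {h \<in> ?R. inv\<^bsub>H\<^esub> h = h}) \<longleftrightarrow> even (card ?R)"
  proof (rule card_fixed_involution)
    show "finite ?R" using assms(2) by simp
    show "inv\<^bsub>H\<^esub> h \<in> ?R \<and> inv\<^bsub>H\<^esub> (inv\<^bsub>H\<^esub> h) = h" if "h \<in> ?R" for h
      using that H.nat_pow_inv[of h q] by simp
  qed
  ultimately show ?thesis by simp
qed

text \<open>In the cyclic group of order d the equation becomes q i = 1 modulo d, and q is
  prime.\<close>

lemma card_zeta_roots:
  assumes d: "0 < d" and q: "Factorial_Ring.prime q"
  shows "card {a \<in> generate (Gamma d q) {zeta d q}. a [^]\<^bsub>Gamma d q\<^esub> q = zeta d q} = of_bool (\<not> q dvd d)"
proof -
  interpret A: Group.group "Gamma d q" by (rule group_Gamma)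
  note z = zeta_in_carrier[of d q]
  have q0: "0 < q" using q by (rule prime_gt_0_nat)
  let ?Z = "generate (Gamma d q) {zeta d q}" and ?p = "\<lambda>i::nat. zeta d q [^]\<^bsub>Gamma d q\<^esub> i"
  let ?R = "{a \<in> ?Z. a [^]\<^bsub>Gamma d q\<^esub> q = zeta d q}"
  have Z: "a \<in> ?Z \<longleftrightarrow> (\<exists>i. a = ?p i)" for a using generate_zeta[OF d] by auto
  have pd: "?p (d * i) = \<one>\<^bsub>Gamma d q\<^esub>" for i using zeta_pow_eq_one_iff[OF q0] by simp
  show ?thesis
  proof (cases "q dvd d")
    case True
    then obtain e where e: "d = q * e" by (elim dvdE)
    have "False" if a: "a \<in> ?R" for a
    proof -
      obtain i where i: "a = ?p i" "a [^]\<^bsub>Gamma d q\<^esub> q = zeta d q" using a Z by blast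
      \<comment> \<open>Raising a^q = zeta to the power e = d/q gives zeta^e = a^d = 1, although 0 <
        e < d.\<close>
      have "?p e = (a [^]\<^bsub>Gamma d q\<^esub> q) [^]\<^bsub>Gamma d q\<^esub> e" unfolding i(2) ..
      also have "\<dots> = ?p (i * q * e)" unfolding i(1) using z by (simp add: A.nat_pow_pow mult.assoc)
      also have "i * q * e = d * i" using e by simp
      finally have "d dvd e" using pd zeta_pow_eq_one_iff[OF q0] by metis
      then show False using d e prime_gt_1_nat[OF q] dvd_imp_le[of d e] by auto
    qed
    then have R: "?R = {}" by (intro equals0I)
    show ?thesis unfolding R using True by simp
  next
    case False
    then have "coprime q d" using q by (simp add: prime_imp_coprime)
    then obtain i0 where "[q * i0 = 1] (mod d)" using cong_solve_coprime_nat by auto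
    \<comment> \<open>The shift by d makes the solution positive, so that q i - 1 is a genuine
      subtraction of naturals; i0 may be 0 when d = 1.\<close>
    have "[q * (i0 + d) = 1] (mod d)"
      using \<open>[q * i0 = 1] (mod d)\<close> by (simp add: cong_def distrib_left)
    moreover define i where "i = i0 + d"
    ultimately have ci: "[q * i = 1] (mod d)" by simp
    have "1 \<le> q * i" using q0 d by (simp add: i_def)
    then have "d dvd q * i - 1" using ci cong_altdef_nat[of 1 "q * i" d] by (simp add: cong_sym_eq)
    then obtain j where j: "q * i = d * j + 1" using \<open>1 \<le> q * i\<close> by (metis dvdE le_add_diff_inverse2)
    have "a \<in> ?R \<longleftrightarrow> a = ?p i" for a
    proof
      assume "a \<in> ?R"
      then obtain k where k: "a = ?p k" "a [^]\<^bsub>Gamma d q\<^esub> q = zeta d q" using Z by blast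
      have "?p i = (a [^]\<^bsub>Gamma d q\<^esub> q) [^]\<^bsub>Gamma d q\<^esub> i" unfolding k(2) ..
      also have "\<dots> = ?p (k * (q * i))" unfolding k(1) using z by (simp add: A.nat_pow_pow mult.assoc)
      also have "k * (q * i) = d * (j * k) + k" unfolding j by (simp add: algebra_simps)
      also have "?p (d * (j * k) + k) = ?p (d * (j * k)) \<otimes>\<^bsub>Gamma d q\<^esub> ?p k"
        using A.nat_pow_mult[OF z] by simp
      also have "\<dots> = a" unfolding pd k(1) using z by simp
      finally show "a = ?p i" by simp
    next
      assume a: "a = ?p i"
      have "a [^]\<^bsub>Gamma d q\<^esub> q = ?p (q * i)" unfolding a using z by (simp add: A.nat_pow_pow mult.commute)
      also have "\<dots> = ?p (d * j) \<otimes>\<^bsub>Gamma d q\<^esub> zeta d q" unfolding j by simp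
      also have "\<dots> = zeta d q" unfolding pd using z by simp
      finally show "a \<in> ?R" using a Z by blast
    qed
    then have R: "?R = {?p i}" unfolding set_eq_iff singleton_iff by (intro allI)
    show ?thesis unfolding R using False by simp
  qed
qed

text \<open>A graph has index n |H|, and freeness makes this a multiple of |K| = d |H|. So n = d M,
  with M the number of K-orbits of cosets. The q-th roots of (zeta, 1) form a product of the roots
  in both factors.\<close>

theorem odd_gen_subgroup_number_Gamma_1:
  assumes d: "0 < d" and n: "0 < n" and q: "Factorial_Ring.prime q" "odd q"
    and H: "Group.group H" "finite (carrier H)"
  shows "finite {D \<in> subgroups_of_index (Gamma d q) n.
      D \<inter> generate (Gamma d q) {zeta d q} = {\<one>\<^bsub>Gamma d q\<^esub>}}"
    and "odd (gen_subgroup_number_Gamma_1 d q H n) \<longleftrightarrow> \<not> q dvd d \<and>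
      ((\<exists>e. n = 2 * d * (1 + 2 * (q - 1) * e) \<and> odd (((q - 1) * e + 1) choose e)) \<or>
       (odd d \<and> odd (card (carrier H)) \<and> (\<exists>e. n = d * (1 + 2 * (q - 1) * e) \<and> odd (((q - 1) * e + 1) choose e))))"
proof -
  let ?A = "Gamma d q" and ?Z = "generate (Gamma d q) {zeta d q}"
  let ?S = "{D \<in> subgroups_of_index ?A n. D \<inter> ?Z = {\<one>\<^bsub>?A\<^esub>}}"
  have q0: "0 < q" using q(1) by (rule prime_gt_0_nat)
  interpret E: coset_exploration "?A \<times>\<times> H" "?Z \<times> carrier H" "(gen_class d q X, \<one>\<^bsub>H\<^esub>)" "(gen_class d q Y, \<one>\<^bsub>H\<^esub>)" q
    by (rule coset_exploration_Gamma[OF d q(1) H])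
  interpret A: Group.group ?A by (rule group_Gamma)
  interpret H: Group.group H by (rule H(1))
  interpret P: group_pair ?A H by unfold_locales
  have Z1: "\<one>\<^bsub>?A\<^esub> \<in> ?Z" by (rule generate.one)
  define h where "h = card (carrier H)"
  have h: "0 < h" using H(2) H.one_closed unfolding h_def by (metis card_gt_0_iff empty_iff)
  have cK: "card (?Z \<times> carrier H) = d * h"
    using card_generate_zeta(2)[OF d q0] by (simp add: card_cartesian_product h_def)
  define \<D> where "\<D> = {D. subgroup D (?A \<times>\<times> H) \<and> D \<inter> ?Z \<times> carrier H = {\<one>\<^bsub>?A \<times>\<times> H\<^esub>} \<and>
    finite (rcosets\<^bsub>?A \<times>\<times> H\<^esub> D) \<and> card (rcosets\<^bsub>?A \<times>\<times> H\<^esub> D) = n * h}"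
  have main: "finite \<D> \<and> (odd (card \<D>) \<longleftrightarrow> \<not> q dvd d \<and>
      ((\<exists>e. n = 2 * d * (1 + 2 * (q - 1) * e) \<and> odd (((q - 1) * e + 1) choose e)) \<or>
       (odd d \<and> odd h \<and> (\<exists>e. n = d * (1 + 2 * (q - 1) * e) \<and> odd (((q - 1) * e + 1) choose e)))))"
  proof (cases "d dvd n")
    case True
    then obtain M where M: "n = d * M" by (elim dvdE)
    have nM: "n * h = M * card (?Z \<times> carrier H)" unfolding cK M by simp
    have \<beta>: "odd (card {c \<in> ?Z \<times> carrier H. c [^]\<^bsub>?A \<times>\<times> H\<^esub> q =
        (gen_class d q X, \<one>\<^bsub>H\<^esub>) \<otimes>\<^bsub>?A \<times>\<times> H\<^esub> (gen_class d q X, \<one>\<^bsub>H\<^esub>)}) \<longleftrightarrow> \<not> q dvd d"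
    proof -
      have z: "(gen_class d q X, \<one>\<^bsub>H\<^esub>) \<otimes>\<^bsub>?A \<times>\<times> H\<^esub> (gen_class d q X, \<one>\<^bsub>H\<^esub>) = (zeta d q, \<one>\<^bsub>H\<^esub>)"
        unfolding zeta_X by (simp add: numeral_2_eq_2)
      have "{c \<in> ?Z \<times> carrier H. c [^]\<^bsub>?A \<times>\<times> H\<^esub> q = (zeta d q, \<one>\<^bsub>H\<^esub>)} =
          {a \<in> ?Z. a [^]\<^bsub>?A\<^esub> q = zeta d q} \<times> {h \<in> carrier H. h [^]\<^bsub>H\<^esub> q = \<one>\<^bsub>H\<^esub>}"
        by (auto simp: DirProd_pow)
      then show ?thesis unfolding z
        using card_zeta_roots[OF d q(1)] odd_card_odd_roots[OF H q(2)] by (simp add: card_cartesian_product)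
    qed
    have e1: "n = 2 * d * k \<longleftrightarrow> M = 2 * k" "n = d * k \<longleftrightarrow> M = k" for k using M d by auto
    show ?thesis
      using E.odd_card_complements_iff[OF q(2), of M] unfolding \<D>_def nM \<beta> e1 cK even_mult_iff by blast
  next
    case False
    have "\<D> = {}"
    proof (rule equals0I)
      fix D assume "D \<in> \<D>"
      then have "d * h dvd n * h" using E.card_K_dvd_index[of D] unfolding cK by (auto simp: \<D>_def)
      then show False using False h by simp
    qed
    then have "finite \<D>" "even (card \<D>)" by simp_all
    moreover have "n \<noteq> 2 * d * k" "n \<noteq> d * k" for k using False by auto
    ultimately show ?thesis by blast
  qed
  have "finite ?S \<and> (\<Sum>D\<in>?S. card_Hom (?A\<lparr>carrier := D\<rparr>) H) = card \<D>"
    using P.card_pairs[OF H(2) Z1, of n] main unfolding \<D>_def h_def by blast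
  then show "finite ?S" and "odd (gen_subgroup_number_Gamma_1 d q H n) \<longleftrightarrow> \<not> q dvd d \<and>
      ((\<exists>e. n = 2 * d * (1 + 2 * (q - 1) * e) \<and> odd (((q - 1) * e + 1) choose e)) \<or>
       (odd d \<and> odd (card (carrier H)) \<and> (\<exists>e. n = d * (1 + 2 * (q - 1) * e) \<and> odd (((q - 1) * e + 1) choose e))))"
    using main unfolding gen_subgroup_number_Gamma_1_def h_def by simp_all
qed

section \<open>Reduction to trivial intersection with \<open>\<langle>\<zeta>\<rangle>\<close>\<close>

locale group_epi = group_hom +
  assumes surj: "h ` carrier G = carrier H"
begin

definition pre where "pre D = {g \<in> carrier G. h g \<in> D}"

lemma subgroup_pre:
  assumes "subgroup D H" shows "subgroup (pre D) G"
proof (rule G.subgroupI)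
  show "pre D \<noteq> {}" using subgroup.one_closed[OF assms] by (auto simp: pre_def intro!: exI[of _ "\<one>\<^bsub>G\<^esub>"])
qed (auto simp: pre_def subgroup.m_closed[OF assms] subgroup.m_inv_closed[OF assms])

lemma image_pre: "D \<subseteq> carrier H \<Longrightarrow> h ` pre D = D"
  using surj by (auto simp: pre_def)

lemma pre_surj:
  assumes "D \<subseteq> carrier H" "b \<in> D" shows "\<exists>a\<in>pre D. h a = b"
proof -
  have "b \<in> h ` pre D" using assms(2) unfolding image_pre[OF assms(1)] .
  then show ?thesis by (rule imageE) (rule bexI, simp_all)
qed

lemma pre_image:
  assumes D: "subgroup D G" and k: "kernel G H h \<subseteq> D" shows "pre (h ` D) = D"
proof
  show "D \<subseteq> pre (h ` D)" using subgroup.subset[OF D] by (auto simp: pre_def)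
  show "pre (h ` D) \<subseteq> D"
  proof
    fix g assume "g \<in> pre (h ` D)"
    then obtain d where g: "g \<in> carrier G" "d \<in> D" "h g = h d" by (auto simp: pre_def)
    have d: "d \<in> carrier G" using subgroup.mem_carrier[OF D g(2)] .
    have "h (g \<otimes> inv d) = \<one>\<^bsub>H\<^esub>" using g d by simp
    then have "g \<otimes> inv d \<in> D" using g d k by (auto simp: kernel_def)
    then have "g \<otimes> inv d \<otimes> d \<in> D" using subgroup.m_closed[OF D] g(2) by blast
    then show "g \<in> D" using g d by (simp add: G.m_assoc)
  qed
qed

lemma subgroup_image: "subgroup D G \<Longrightarrow> subgroup (h ` D) H"
  by (rule subgroup_img_is_subgroup)

lemma rcosets_pre:
  assumes D: "subgroup D H"
  shows "bij_betw ((`) h) (rcosets (pre D)) (rcosets\<^bsub>H\<^esub> D)"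
proof -
  note P = subgroup_pre[OF D] and Dc = subgroup.subset[OF D]
  have img: "h ` (pre D #> g) = D #>\<^bsub>H\<^esub> h g" if g: "g \<in> carrier G" for g
  proof -
    have "h ` (pre D #> g) = (\<lambda>a. a \<otimes>\<^bsub>H\<^esub> h g) ` (h ` pre D)"
      using g by (auto simp: r_coset_def pre_def image_iff)
    then show ?thesis unfolding image_pre[OF Dc] by (auto simp: r_coset_def)
  qed
  show ?thesis
  proof (rule bij_betw_imageI)
    show "inj_on ((`) h) (rcosets (pre D))"
    proof (rule inj_onI)
      fix C E assume "C \<in> rcosets (pre D)" "E \<in> rcosets (pre D)" and e: "h ` C = h ` E"
      then obtain a b where ab: "a \<in> carrier G" "C = pre D #> a" "b \<in> carrier G" "E = pre D #> b"
        by (auto simp: RCOSETS_def)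
      have "D #>\<^bsub>H\<^esub> h a = D #>\<^bsub>H\<^esub> h b" using e ab img by simp
      then have "h a \<otimes>\<^bsub>H\<^esub> inv\<^bsub>H\<^esub> h b \<in> D" using H.rcoset_eq_iff[OF D] ab by simp
      then have "a \<otimes> inv b \<in> pre D" using ab by (simp add: pre_def)
      then show "C = E" using G.rcoset_eq_iff[OF P] ab by simp
    qed
    show "(`) h ` (rcosets (pre D)) = rcosets\<^bsub>H\<^esub> D"
    proof
      show "(`) h ` (rcosets (pre D)) \<subseteq> rcosets\<^bsub>H\<^esub> D"
      proof
        fix E assume "E \<in> (`) h ` (rcosets (pre D))"
        then obtain g where "g \<in> carrier G" "E = h ` (pre D #> g)" by (auto simp: RCOSETS_def)
        then show "E \<in> rcosets\<^bsub>H\<^esub> D" using img by (auto simp: RCOSETS_def)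
      qed
      show "rcosets\<^bsub>H\<^esub> D \<subseteq> (`) h ` (rcosets (pre D))"
      proof
        fix E assume "E \<in> rcosets\<^bsub>H\<^esub> D"
        then obtain b where b: "b \<in> carrier H" "E = D #>\<^bsub>H\<^esub> b" by (auto simp: RCOSETS_def)
        have "b \<in> h ` carrier G" using b(1) unfolding surj .
        then obtain g where g: "b = h g" "g \<in> carrier G" by (rule imageE)
        have "E = h ` (pre D #> g)" unfolding b(2) g(1) img[OF g(2)] ..
        moreover have "pre D #> g \<in> rcosets (pre D)"
          by (rule G.rcosetsI[OF subgroup.subset[OF P] g(2)])
        ultimately show "E \<in> (`) h ` (rcosets (pre D))" by (rule image_eqI)
      qed
    qed
  qed
qed

lemma index_pre:
  assumes D: "subgroup D H"
  shows "pre D \<in> subgroups_of_index G n \<longleftrightarrow> D \<in> subgroups_of_index H n"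
  using bij_betw_same_card[OF rcosets_pre[OF D]] bij_betw_finite[OF rcosets_pre[OF D]] D subgroup_pre[OF D]
  by (simp add: subgroups_of_index_def)

text \<open>By \<open>kill\<close> a homomorphism on the preimage is constant on the fibres of h, so
  it factors through D.\<close>

lemma card_Hom_pre:
  assumes D: "subgroup D H" and L: "Group.group L"
    and kill: "\<And>f k. f \<in> hom (G\<lparr>carrier := pre D\<rparr>) L \<Longrightarrow> k \<in> kernel G H h \<Longrightarrow> f k = \<one>\<^bsub>L\<^esub>"
  shows "card_Hom (G\<lparr>carrier := pre D\<rparr>) L = card_Hom (H\<lparr>carrier := D\<rparr>) L"
proof -
  interpret L: Group.group L by (rule L)
  note P = subgroup_pre[OF D] and Dc = subgroup.subset[OF D]
  have preI: "g \<in> pre D \<longleftrightarrow> g \<in> carrier G \<and> h g \<in> D" for g by (auto simp: pre_def)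
  let ?A = "hom (H\<lparr>carrier := D\<rparr>) L \<inter> extensional D"
  let ?B = "hom (G\<lparr>carrier := pre D\<rparr>) L \<inter> extensional (pre D)"
  let ?F = "\<lambda>f. restrict (f \<circ> h) (pre D)"
  have "bij_betw ?F ?A ?B"
  proof (rule bij_betw_imageI)
    show "inj_on ?F ?A"
    proof (rule inj_onI)
      fix f g assume f: "f \<in> ?A" and g: "g \<in> ?A" and e: "?F f = ?F g"
      show "f = g"
      proof (rule extensionalityI)
        show "f \<in> extensional D" "g \<in> extensional D" using f g by auto
        fix b assume b: "b \<in> D"
        obtain a where "a \<in> pre D" "h a = b" using pre_surj[OF Dc b] by (rule bexE)
        then show "f b = g b" using fun_cong[OF e, of a] by simp
      qed
    qed
    show "?F ` ?A = ?B"
    proof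
      show "?F ` ?A \<subseteq> ?B"
      proof
        fix g assume "g \<in> ?F ` ?A"
        then obtain f where "f \<in> ?A" and gf: "g = ?F f" by (elim imageE)
        then have f: "f \<in> hom (H\<lparr>carrier := D\<rparr>) L" "g = ?F f" by simp_all
        have "g \<in> hom (G\<lparr>carrier := pre D\<rparr>) L"
        proof (rule homI)
          show "g a \<in> carrier L" if "a \<in> carrier (G\<lparr>carrier := pre D\<rparr>)" for a
            using that f hom_in_carrier[OF f(1)] preI by simp
          show "g (a \<otimes>\<^bsub>G\<lparr>carrier := pre D\<rparr>\<^esub> b) = g a \<otimes>\<^bsub>L\<^esub> g b"
            if "a \<in> carrier (G\<lparr>carrier := pre D\<rparr>)" "b \<in> carrier (G\<lparr>carrier := pre D\<rparr>)" for a b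
            using that f Group.hom_mult[OF f(1)] preI subgroup.m_closed[OF P] by simp
        qed
        then show "g \<in> ?B" using f(2) by simp
      qed
      show "?B \<subseteq> ?F ` ?A"
      proof
        fix g assume g: "g \<in> ?B"
        then have gh: "g \<in> hom (G\<lparr>carrier := pre D\<rparr>) L" by blast
        have g_in: "g a \<in> carrier L" if "a \<in> pre D" for a using hom_in_carrier[OF gh] that by simp
        have g_mult: "g (a \<otimes> b) = g a \<otimes>\<^bsub>L\<^esub> g b" if "a \<in> pre D" "b \<in> pre D" for a b
          using Group.hom_mult[OF gh] that by simp
        have g_eq: "g a = g b" if ab: "a \<in> pre D" "b \<in> pre D" and e: "h a = h b" for a b
        proof -
          have c: "a \<in> carrier G" "b \<in> carrier G" using ab preI by auto
          have k: "a \<otimes> inv b \<in> kernel G H h" using c e by (simp add: kernel_def)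
          have "a \<otimes> inv b \<in> pre D" using subgroup.m_closed[OF P ab(1) subgroup.m_inv_closed[OF P ab(2)]] .
          then have "g (a \<otimes> inv b \<otimes> b) = g (a \<otimes> inv b) \<otimes>\<^bsub>L\<^esub> g b" using g_mult ab by blast
          moreover have "a \<otimes> inv b \<otimes> b = a" using c by (simp add: G.m_assoc)
          ultimately show ?thesis using kill[OF gh k] g_in[OF ab(2)] by simp
        qed
        have "\<forall>b\<in>D. \<exists>a. a \<in> pre D \<and> h a = b" using pre_surj[OF Dc] by (metis (no_types))
        then obtain r where r: "\<And>b. b \<in> D \<Longrightarrow> r b \<in> pre D \<and> h (r b) = b" by metis
        define f where "f = restrict (g \<circ> r) D"
        have "f \<in> hom (H\<lparr>carrier := D\<rparr>) L"
        proof (rule homI)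
          show "f a \<in> carrier L" if "a \<in> carrier (H\<lparr>carrier := D\<rparr>)" for a
            using that g_in r by (simp add: f_def)
          show "f (a \<otimes>\<^bsub>H\<lparr>carrier := D\<rparr>\<^esub> b) = f a \<otimes>\<^bsub>L\<^esub> f b"
            if "a \<in> carrier (H\<lparr>carrier := D\<rparr>)" "b \<in> carrier (H\<lparr>carrier := D\<rparr>)" for a b
          proof -
            have ab: "a \<in> D" "b \<in> D" "a \<otimes>\<^bsub>H\<^esub> b \<in> D" using that subgroup.m_closed[OF D] by auto
            have "h (r a \<otimes> r b) = h (r (a \<otimes>\<^bsub>H\<^esub> b))"
              using r[OF ab(1)] r[OF ab(2)] r[OF ab(3)] preI by simp
            then have "g (r (a \<otimes>\<^bsub>H\<^esub> b)) = g (r a \<otimes> r b)"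
              using g_eq r ab subgroup.m_closed[OF P] by metis
            then show ?thesis using g_mult r ab by (simp add: f_def)
          qed
        qed
        moreover have Ff: "?F f = g"
        proof (rule extensionalityI)
          show "?F f \<in> extensional (pre D)" by simp
          show "g \<in> extensional (pre D)" using g by blast
          show "?F f a = g a" if a: "a \<in> pre D" for a
          proof -
            have "h a \<in> D" using a preI by blast
            then have "g (r (h a)) = g a" using g_eq r a by metis
            then show ?thesis using a \<open>h a \<in> D\<close> by (simp add: f_def)
          qed
        qed
        moreover have "f \<in> extensional D" by (simp add: f_def)
        ultimately have "f \<in> ?A" by (intro IntI)
        then have "?F f \<in> ?F ` ?A" by (rule imageI)
        then show "g \<in> ?F ` ?A" unfolding Ff .
      qed
    qed
  qed
  then show ?thesis unfolding card_Hom_def by (simp add: bij_betw_same_card)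
qed

end

section \<open>The projection to a divisor of m and the subgroups it matches\<close>

lemma word_cong_replicate_mult:
  assumes "word_cong R (replicate a x) []"
  shows "word_cong R (replicate (a * k) x) []"
proof (induction k)
  case 0
  show ?case by (simp add: word_cong.refl)
next
  case (Suc k)
  have "replicate (a * Suc k) x = replicate a x @ replicate (a * k) x" by (simp add: replicate_add)
  then show ?case using word_cong.append[OF assms Suc] by simp
qed

lemma word_cong_Gamma_dvd:
  assumes "e dvd m" "word_cong (Gamma_rels m q) u v"
  shows "word_cong (Gamma_rels e q) u v"
  using assms(2)
proof (induction rule: word_cong.induct)
  case (rel u v)
  obtain k where m: "m = e * k" using assms(1) by (elim dvdE)
  have X: "word_cong (Gamma_rels e q) (replicate (2 * e) (True, X)) []"
    and Y: "word_cong (Gamma_rels e q) (replicate (q * e) (True, Y)) []"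
    and XY: "word_cong (Gamma_rels e q) (replicate 2 (True, X)) (replicate q (True, Y))"
    by (rule word_cong.rel, simp add: Gamma_rels_def)+
  have Xm: "word_cong (Gamma_rels e q) (replicate (2 * m) (True, X)) []"
    using word_cong_replicate_mult[OF X, of k] unfolding m mult.assoc .
  have Ym: "word_cong (Gamma_rels e q) (replicate (q * m) (True, Y)) []"
    using word_cong_replicate_mult[OF Y, of k] unfolding m mult.assoc .
  from rel consider "u = replicate (2 * m) (True, X)" "v = []"
    | "u = replicate (q * m) (True, Y)" "v = []"
    | "u = replicate 2 (True, X)" "v = replicate q (True, Y)"
    unfolding Gamma_rels_def by blast
  then show ?case by cases (simp_all only: Xm Ym XY)
qed (auto intro: word_cong.intros)

text \<open>Each use of a relation of \<open>Gamma e q\<close> changes the class in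
  \<open>Gamma m q\<close> by a power of zeta^e, and centrality collects these powers. Thus the
  kernel of the projection is found by induction on the derivation.\<close>

lemma word_cong_Gamma_kernel:
  assumes m: "0 < m" and uv: "word_cong (Gamma_rels e q) u v"
  shows "\<exists>i::nat. word_class (Gamma_rels m q) u =
    word_class (Gamma_rels m q) v \<otimes>\<^bsub>Gamma m q\<^esub> zeta m q [^]\<^bsub>Gamma m q\<^esub> (e * i)"
proof -
  interpret A: Group.group "Gamma m q" by (rule group_Gamma)
  note z = zeta_in_carrier[of m q]
  let ?c = "word_class (Gamma_rels m q)" and ?p = "\<lambda>i::nat. zeta m q [^]\<^bsub>Gamma m q\<^esub> i"
  have c1: "?c w = ?c w \<otimes>\<^bsub>Gamma m q\<^esub> ?p (e * 0)" for w by simp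
  from uv show ?thesis
  proof (induction rule: word_cong.induct)
    case (rel u v)
    have "?c (replicate (2 * e) (True, X)) = ?p e" "?c (replicate (q * e) (True, Y)) = ?p e"
      unfolding word_class_replicate by (simp_all add: zeta_X A.nat_pow_pow zeta_Y[symmetric] flip: A.nat_pow_pow)
    then have "?c (replicate (2 * e) (True, X)) = ?c [] \<otimes>\<^bsub>Gamma m q\<^esub> ?p (e * 1)"
      "?c (replicate (q * e) (True, Y)) = ?c [] \<otimes>\<^bsub>Gamma m q\<^esub> ?p (e * 1)"
      using z by (simp_all flip: Gamma_one)
    moreover have "?c (replicate 2 (True, X)) = ?c (replicate q (True, Y)) \<otimes>\<^bsub>Gamma m q\<^esub> ?p (e * 0)"
      using zeta_def[of m q] zeta_eq_Y[of m q] by simp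
    moreover from rel consider "u = replicate (2 * e) (True, X)" "v = []"
      | "u = replicate (q * e) (True, Y)" "v = []"
      | "u = replicate 2 (True, X)" "v = replicate q (True, Y)"
      unfolding Gamma_rels_def by blast
    ultimately show ?case by cases metis+
  next
    case (cancel b g)
    have "?c [(b, g), (\<not> b, g)] = ?c []" unfolding word_class_eq_iff by (rule word_cong.cancel)
    then show ?case using c1 by metis
  next
    case (refl u) then show ?case using c1 by metis
  next
    case (sym u v)
    then obtain i where i: "?c u = ?c v \<otimes>\<^bsub>Gamma m q\<^esub> ?p (e * i)" by blast
    \<comment> \<open>As zeta^m = 1, the exponent e i (m - 1) undoes e i.\<close>
    have "?p (e * i) \<otimes>\<^bsub>Gamma m q\<^esub> ?p (e * (i * (m - 1))) = ?p (m * (e * i))"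
    proof -
      have "e * i + e * (i * (m - 1)) = m * (e * i)" using m by (cases m) (simp_all add: algebra_simps)
      then show ?thesis using A.nat_pow_mult[OF z] by simp
    qed
    also have "\<dots> = \<one>\<^bsub>Gamma m q\<^esub>" using zeta_pow_order z by (metis A.nat_pow_one A.nat_pow_pow)
    finally have "?c v = ?c u \<otimes>\<^bsub>Gamma m q\<^esub> ?p (e * (i * (m - 1)))"
      unfolding i using z by (simp add: A.m_assoc)
    then show ?case by blast
  next
    case (trans u v w)
    then obtain i j where "?c u = ?c v \<otimes>\<^bsub>Gamma m q\<^esub> ?p (e * i)" "?c v = ?c w \<otimes>\<^bsub>Gamma m q\<^esub> ?p (e * j)" by blast
    then have "?c u = ?c w \<otimes>\<^bsub>Gamma m q\<^esub> (?p (e * j) \<otimes>\<^bsub>Gamma m q\<^esub> ?p (e * i))"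
      using z by (simp add: A.m_assoc)
    also have "?p (e * j) \<otimes>\<^bsub>Gamma m q\<^esub> ?p (e * i) = ?p (e * (j + i))"
      using A.nat_pow_mult[OF z] by (simp add: distrib_left)
    finally show ?case by blast
  next
    case (append u u' v v')
    then obtain i j where i: "?c u = ?c u' \<otimes>\<^bsub>Gamma m q\<^esub> ?p (e * i)" and j: "?c v = ?c v' \<otimes>\<^bsub>Gamma m q\<^esub> ?p (e * j)" by blast
    have pc: "?p k \<in> carrier (Gamma m q)" for k using z by simp
    have "?c (u @ v) = ?c u \<otimes>\<^bsub>Gamma m q\<^esub> ?c v" by simp
    also have "\<dots> = ?c u' \<otimes>\<^bsub>Gamma m q\<^esub> ((?p (e * i) \<otimes>\<^bsub>Gamma m q\<^esub> ?c v') \<otimes>\<^bsub>Gamma m q\<^esub> ?p (e * j))"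
      unfolding i j by (simp only: A.m_assoc A.m_closed pc word_class_in_Gamma)
    also have "?p (e * i) \<otimes>\<^bsub>Gamma m q\<^esub> ?c v' = ?c v' \<otimes>\<^bsub>Gamma m q\<^esub> ?p (e * i)"
      by (rule zeta_pow_comm[OF word_class_in_Gamma])
    also have "?c u' \<otimes>\<^bsub>Gamma m q\<^esub> (?c v' \<otimes>\<^bsub>Gamma m q\<^esub> ?p (e * i) \<otimes>\<^bsub>Gamma m q\<^esub> ?p (e * j)) =
        (?c u' \<otimes>\<^bsub>Gamma m q\<^esub> ?c v') \<otimes>\<^bsub>Gamma m q\<^esub> (?p (e * i) \<otimes>\<^bsub>Gamma m q\<^esub> ?p (e * j))"
      by (simp only: A.m_assoc A.m_closed pc word_class_in_Gamma)
    also have "?p (e * i) \<otimes>\<^bsub>Gamma m q\<^esub> ?p (e * j) = ?p (e * (i + j))"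
      using A.nat_pow_mult[OF z] by (simp add: distrib_left)
    finally show ?case by (metis Gamma_mult)
  qed
qed

definition project :: "nat \<Rightarrow> nat \<Rightarrow> generator word set \<Rightarrow> generator word set" where
  "project e q A = word_class (Gamma_rels e q) (SOME u. u \<in> A)"

lemma project_word_class:
  assumes "e dvd m"
  shows "project e q (word_class (Gamma_rels m q) u) = word_class (Gamma_rels e q) u"
proof -
  have "u \<in> word_class (Gamma_rels m q) u" by (simp add: word_class_def word_cong.refl)
  then have "(SOME v. v \<in> word_class (Gamma_rels m q) u) \<in> word_class (Gamma_rels m q) u" by (rule someI)
  then have "word_cong (Gamma_rels e q) u (SOME v. v \<in> word_class (Gamma_rels m q) u)"
    using word_cong_Gamma_dvd[OF assms] by (simp add: word_class_def)
  then show ?thesis unfolding project_def word_class_eq_iff by (rule word_cong.sym)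
qed

lemma group_epi_project:
  assumes "e dvd m"
  shows "group_epi (Gamma m q) (Gamma e q) (project e q)"
proof (intro group_epi.intro group_hom.intro group_hom_axioms.intro group_epi_axioms.intro group_Gamma)
  show "project e q \<in> hom (Gamma m q) (Gamma e q)"
    using project_word_class[OF assms] by (intro homI) (auto simp: Gamma_carrier)
  show "project e q ` carrier (Gamma m q) = carrier (Gamma e q)"
    using project_word_class[OF assms] by (simp add: Gamma_carrier image_image)
qed

lemma project_zeta_pow:
  assumes "e dvd m"
  shows "project e q (zeta m q [^]\<^bsub>Gamma m q\<^esub> (i::nat)) = zeta e q [^]\<^bsub>Gamma e q\<^esub> i"
proof -
  interpret group_epi "Gamma m q" "Gamma e q" "project e q" by (rule group_epi_project[OF assms])
  have "project e q (zeta m q) = zeta e q" unfolding zeta_def by (rule project_word_class[OF assms])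
  then show ?thesis using hom_nat_pow[OF zeta_in_carrier] by simp
qed

lemma kernel_project:
  assumes "0 < m" "e dvd m" "a \<in> kernel (Gamma m q) (Gamma e q) (project e q)"
  shows "\<exists>i::nat. a = zeta m q [^]\<^bsub>Gamma m q\<^esub> (e * i)"
proof -
  interpret A: Group.group "Gamma m q" by (rule group_Gamma)
  have a: "a \<in> carrier (Gamma m q)" "project e q a = \<one>\<^bsub>Gamma e q\<^esub>" using assms(3) by (auto simp: kernel_def)
  obtain u where u: "a = word_class (Gamma_rels m q) u" using a(1) by (auto simp: Gamma_carrier)
  have "word_cong (Gamma_rels e q) u []"
    using a(2) unfolding u project_word_class[OF assms(2)] Gamma_one word_class_eq_iff .
  then show ?thesis using word_cong_Gamma_kernel[OF assms(1)] zeta_in_carrier[of m q]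
    unfolding u by (metis A.l_one A.nat_pow_closed Gamma_one)
qed

text \<open>The subgroups \<open>\<Delta>\<close> of index \<open>n\<close> with \<open>\<Delta> \<inter> \<langle>\<zeta>\<rangle> = \<langle>\<zeta>\<^sup>e\<rangle>\<close>.\<close>

definition zeta_type where
  "zeta_type m q n e = {D \<in> subgroups_of_index (Gamma m q) n. \<forall>i::nat. zeta m q [^]\<^bsub>Gamma m q\<^esub> i \<in> D \<longleftrightarrow> e dvd i}"

text \<open>The exponents i with zeta^i in D are the multiples of the least positive one, e, and m
  is among them.\<close>

lemma subgroups_zeta_type:
  assumes m: "0 < m"
  shows "subgroups_of_index (Gamma m q) n = (\<Union>e\<in>{e. e dvd m}. zeta_type m q n e)"
proof
  interpret A: Group.group "Gamma m q" by (rule group_Gamma)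
  note z = zeta_in_carrier[of m q]
  let ?p = "\<lambda>i::nat. zeta m q [^]\<^bsub>Gamma m q\<^esub> i"
  show "(\<Union>e\<in>{e. e dvd m}. zeta_type m q n e) \<subseteq> subgroups_of_index (Gamma m q) n"
    by (auto simp: zeta_type_def)
  show "subgroups_of_index (Gamma m q) n \<subseteq> (\<Union>e\<in>{e. e dvd m}. zeta_type m q n e)"
  proof
    fix D assume D: "D \<in> subgroups_of_index (Gamma m q) n"
    then have sD: "subgroup D (Gamma m q)" by (simp add: subgroups_of_index_def)
    define e where "e = (LEAST i. 0 < i \<and> ?p i \<in> D)"
    have "0 < m \<and> ?p m \<in> D" using m zeta_pow_order subgroup.one_closed[OF sD] by simp
    then have e: "0 < e" "?p e \<in> D" unfolding e_def by (metis (mono_tags, lifting) LeastI)+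
    have least: "e \<le> i" if "0 < i" "?p i \<in> D" for i unfolding e_def by (rule Least_le) (use that in simp)
    have mult: "?p (e * k) \<in> D" for k
    proof (induction k)
      case (Suc k)
      have "?p (e * Suc k) = ?p e \<otimes>\<^bsub>Gamma m q\<^esub> ?p (e * k)" using A.nat_pow_mult[OF z] by simp
      then show ?case using subgroup.m_closed[OF sD e(2) Suc] by simp
    qed (use subgroup.one_closed[OF sD] in simp)
    have iff: "?p i \<in> D \<longleftrightarrow> e dvd i" for i
    proof
      assume i: "?p i \<in> D"
      have "?p (e * (i div e)) \<otimes>\<^bsub>Gamma m q\<^esub> ?p (i mod e) = ?p i" using A.nat_pow_mult[OF z] by simp
      then have "?p (i mod e) = inv\<^bsub>Gamma m q\<^esub> ?p (e * (i div e)) \<otimes>\<^bsub>Gamma m q\<^esub> ?p i"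
        using z by (metis A.inv_solve_left A.nat_pow_closed)
      then have "?p (i mod e) \<in> D"
        using subgroup.m_closed[OF sD subgroup.m_inv_closed[OF sD mult] i] by simp
      then have "i mod e = 0" using least[of "i mod e"] mod_less_divisor[OF e(1), of i] by (cases "i mod e = 0") auto
      then show "e dvd i" by auto
    next
      assume "e dvd i"
      then show "?p i \<in> D" using mult by (elim dvdE) simp
    qed
    have "e dvd m" using iff \<open>0 < m \<and> ?p m \<in> D\<close> by blast
    then show "D \<in> (\<Union>e\<in>{e. e dvd m}. zeta_type m q n e)" using D iff by (auto simp: zeta_type_def)
  qed
qed

text \<open>A subgroup of type e contains the powers of zeta^e, hence the kernel, so the
  correspondence theorem applies. Trivial intersection below means that zeta^i lies in D only for
  multiples i of the order e.\<close>

lemma zeta_type_bij: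
  assumes m: "0 < m" and e: "e dvd m" and q: "0 < q"
  shows "bij_betw (group_epi.pre (Gamma m q) (project e q))
    {D \<in> subgroups_of_index (Gamma e q) n. D \<inter> generate (Gamma e q) {zeta e q} = {\<one>\<^bsub>Gamma e q\<^esub>}}
    (zeta_type m q n e)"
proof -
  interpret E: group_epi "Gamma m q" "Gamma e q" "project e q" by (rule group_epi_project[OF e])
  have e0: "0 < e" using e m by (metis dvd_0_left gr0I)
  let ?S = "{D \<in> subgroups_of_index (Gamma e q) n. D \<inter> generate (Gamma e q) {zeta e q} = {\<one>\<^bsub>Gamma e q\<^esub>}}"
  let ?p = "\<lambda>i::nat. zeta e q [^]\<^bsub>Gamma e q\<^esub> i"
  have trivial_iff: "D \<inter> generate (Gamma e q) {zeta e q} = {\<one>\<^bsub>Gamma e q\<^esub>} \<longleftrightarrow> (\<forall>i. ?p i \<in> D \<longleftrightarrow> e dvd i)"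
    if D: "subgroup D (Gamma e q)" for D
  proof
    assume t: "D \<inter> generate (Gamma e q) {zeta e q} = {\<one>\<^bsub>Gamma e q\<^esub>}"
    show "\<forall>i. ?p i \<in> D \<longleftrightarrow> e dvd i"
    proof
      fix i
      have "?p i \<in> generate (Gamma e q) {zeta e q}" unfolding generate_zeta[OF e0] by blast
      then have "?p i \<in> D \<longleftrightarrow> ?p i = \<one>\<^bsub>Gamma e q\<^esub>" using t by blast
      then show "?p i \<in> D \<longleftrightarrow> e dvd i" using zeta_pow_eq_one_iff[OF q] by simp
    qed
  next
    assume t: "\<forall>i. ?p i \<in> D \<longleftrightarrow> e dvd i"
    have "a = \<one>\<^bsub>Gamma e q\<^esub>" if a: "a \<in> D" "a \<in> generate (Gamma e q) {zeta e q}" for a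
    proof -
      obtain i where "a = ?p i" using a(2) unfolding generate_zeta[OF e0] by blast
      then show ?thesis using t a(1) zeta_pow_eq_one_iff[OF q] by simp
    qed
    then show "D \<inter> generate (Gamma e q) {zeta e q} = {\<one>\<^bsub>Gamma e q\<^esub>}"
      using subgroup.one_closed[OF D] generate.one[of "Gamma e q"] by blast
  qed
  have zeta_pre: "zeta m q [^]\<^bsub>Gamma m q\<^esub> i \<in> E.pre D \<longleftrightarrow> ?p i \<in> D" for i :: nat and D
    using zeta_in_carrier[of m q] by (simp add: E.pre_def project_zeta_pow[OF e])
  have S: "subgroup D (Gamma e q)" if "D \<in> ?S" for D using that by (simp add: subgroups_of_index_def)
  show ?thesis
  proof (rule bij_betw_imageI)
    show "inj_on E.pre ?S"
      by (rule inj_on_inverseI[of _ "(`) (project e q)"]) (rule E.image_pre[OF subgroup.subset[OF S]])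
    show "E.pre ` ?S = zeta_type m q n e"
    proof
      show "E.pre ` ?S \<subseteq> zeta_type m q n e"
      proof
        fix E assume "E \<in> E.pre ` ?S"
        then obtain D where D: "D \<in> ?S" "E = E.pre D" by (elim imageE)
        then show "E \<in> zeta_type m q n e"
          using E.index_pre[OF S[OF D(1)], of n] trivial_iff[OF S[OF D(1)]] zeta_pre
          by (simp add: zeta_type_def)
      qed
      show "zeta_type m q n e \<subseteq> E.pre ` ?S"
      proof
        fix D assume D: "D \<in> zeta_type m q n e"
        then have sD: "subgroup D (Gamma m q)" and Di: "D \<in> subgroups_of_index (Gamma m q) n"
          and z: "\<And>i::nat. zeta m q [^]\<^bsub>Gamma m q\<^esub> i \<in> D \<longleftrightarrow> e dvd i"
          by (simp_all add: zeta_type_def subgroups_of_index_def)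
        have "kernel (Gamma m q) (Gamma e q) (project e q) \<subseteq> D"
          using kernel_project[OF m e] z by (metis dvd_triv_left subsetI)
        then have pre: "E.pre (project e q ` D) = D" by (rule E.pre_image[OF sD])
        have sI: "subgroup (project e q ` D) (Gamma e q)" by (rule E.subgroup_image[OF sD])
        have "project e q ` D \<in> ?S"
          using E.index_pre[OF sI, of n] trivial_iff[OF sI] zeta_pre[of _ "project e q ` D"] z Di
          unfolding pre by simp
        then show "D \<in> E.pre ` ?S" by (rule image_eqI[rotated]) (rule pre[symmetric])
      qed
    qed
  qed
qed

text \<open>A kernel element k is a power of zeta, so k^m = 1; the order of its image in H divides
  both m and |H|.\<close>

lemma card_Hom_zeta_type:
  assumes m: "0 < m" and e: "e dvd m" and D: "subgroup D (Gamma e q)"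
    and H: "Group.group H" "coprime m (card (carrier H))"
  shows "card_Hom ((Gamma m q)\<lparr>carrier := group_epi.pre (Gamma m q) (project e q) D\<rparr>) H =
    card_Hom ((Gamma e q)\<lparr>carrier := D\<rparr>) H"
proof -
  interpret E: group_epi "Gamma m q" "Gamma e q" "project e q" by (rule group_epi_project[OF e])
  interpret H: Group.group H by (rule H(1))
  interpret P: group_pair "Gamma m q" H by unfold_locales
  note z = zeta_in_carrier[of m q]
  note sP = E.subgroup_pre[OF D]
  show ?thesis
  proof (rule E.card_Hom_pre[OF D H(1)])
    fix f k assume f: "f \<in> hom ((Gamma m q)\<lparr>carrier := E.pre D\<rparr>) H"
      and k: "k \<in> kernel (Gamma m q) (Gamma e q) (project e q)"
    note hf = P.hom_restrict[OF sP f]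
    have kc: "k \<in> carrier (Gamma m q)" "k \<in> E.pre D"
      using k subgroup.one_closed[OF D] by (auto simp: kernel_def E.pre_def)
    obtain i where i: "k = zeta m q [^]\<^bsub>Gamma m q\<^esub> (e * i)" using kernel_project[OF m e k] by blast
    have "k [^]\<^bsub>Gamma m q\<^esub> m = zeta m q [^]\<^bsub>Gamma m q\<^esub> (m * (e * i))"
      unfolding i using z by (simp add: E.G.nat_pow_pow mult.commute)
    also have "\<dots> = \<one>\<^bsub>Gamma m q\<^esub>" using zeta_pow_order z by (metis E.G.nat_pow_one E.G.nat_pow_pow)
    finally have km: "k [^]\<^bsub>Gamma m q\<^esub> m = \<one>\<^bsub>Gamma m q\<^esub>" .
    have "k [^]\<^bsub>Gamma m q\<^esub> j \<in> E.pre D \<and> f (k [^]\<^bsub>Gamma m q\<^esub> j) = f k [^]\<^bsub>H\<^esub> j" for j :: nat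
    proof (induction j)
      case 0
      show ?case using subgroup.one_closed[OF sP] hf(3) by simp
    next
      case (Suc j)
      then show ?case using hf(2)[OF _ kc(2)] subgroup.m_closed[OF sP _ kc(2)] by simp
    qed
    then have "f k [^]\<^bsub>H\<^esub> m = \<one>\<^bsub>H\<^esub>" using km hf(3) by metis
    then show "f k = \<one>\<^bsub>H\<^esub>" by (rule H.coprime_pow_eq_one[OF hf(1)[OF kc(2)] _ H(2)])
  qed
qed

theorem gen_subgroup_number_Gamma:
  assumes m: "0 < m" and n: "0 < n" and q: "Factorial_Ring.prime q" "odd q"
    and H: "Group.group H" "finite (carrier H)" "coprime m (card (carrier H))"
  shows "gen_subgroup_number (Gamma m q) H n = (\<Sum>d | d dvd m. gen_subgroup_number_Gamma_1 d q H n)"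
proof -
  have q0: "0 < q" using q(1) by (rule prime_gt_0_nat)
  let ?S = "\<lambda>e. {D \<in> subgroups_of_index (Gamma e q) n. D \<inter> generate (Gamma e q) {zeta e q} = {\<one>\<^bsub>Gamma e q\<^esub>}}"
  \<comment> \<open>Splitting the sum needs finite parts; their finiteness is a by-product of the
    parity count.\<close>
  have fin: "finite (zeta_type m q n e)" if "e dvd m" for e
  proof -
    have "0 < e" using that m by (metis dvd_0_left gr0I)
    then show ?thesis
      using odd_gen_subgroup_number_Gamma_1(1)[OF _ n q H(1,2), of e] bij_betw_finite[OF zeta_type_bij[OF m that q0]]
      by blast
  qed
  have "gen_subgroup_number (Gamma m q) H n =
      (\<Sum>D\<in>(\<Union>e\<in>{e. e dvd m}. zeta_type m q n e). card_Hom ((Gamma m q)\<lparr>carrier := D\<rparr>) H)"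
    unfolding gen_subgroup_number_def subgroups_zeta_type[OF m] ..
  also have "\<dots> = (\<Sum>e\<in>{e. e dvd m}. \<Sum>D\<in>zeta_type m q n e. card_Hom ((Gamma m q)\<lparr>carrier := D\<rparr>) H)"
  proof (rule sum.UNION_disjoint)
    show "finite {e. e dvd m}" using m by simp
    show "\<forall>e\<in>{e. e dvd m}. finite (zeta_type m q n e)" using fin by blast
    have "e = e'" if "D \<in> zeta_type m q n e" "D \<in> zeta_type m q n e'" for D e e'
    proof -
      have "e dvd i \<longleftrightarrow> e' dvd i" for i using that unfolding zeta_type_def by blast
      then show ?thesis by (metis dvd_antisym dvd_refl)
    qed
    then show "\<forall>e\<in>{e. e dvd m}. \<forall>e'\<in>{e. e dvd m}. e \<noteq> e' \<longrightarrow> zeta_type m q n e \<inter> zeta_type m q n e' = {}"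
      by blast
  qed
  also have "\<dots> = (\<Sum>e\<in>{e. e dvd m}. gen_subgroup_number_Gamma_1 e q H n)"
  proof (rule sum.cong[OF HOL.refl])
    fix e assume "e \<in> {e. e dvd m}"
    then have e: "e dvd m" by blast
    have "(\<Sum>D\<in>zeta_type m q n e. card_Hom ((Gamma m q)\<lparr>carrier := D\<rparr>) H) =
        (\<Sum>D\<in>?S e. card_Hom ((Gamma m q)\<lparr>carrier := group_epi.pre (Gamma m q) (project e q) D\<rparr>) H)"
      by (rule sum.reindex_bij_betw[OF zeta_type_bij[OF m e q0], symmetric])
    also have "\<dots> = (\<Sum>D\<in>?S e. card_Hom ((Gamma e q)\<lparr>carrier := D\<rparr>) H)"
    proof (rule sum.cong[OF HOL.refl])
      fix D assume "D \<in> ?S e"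
      then have "subgroup D (Gamma e q)" by (simp add: subgroups_of_index_def)
      then show "card_Hom ((Gamma m q)\<lparr>carrier := group_epi.pre (Gamma m q) (project e q) D\<rparr>) H =
          card_Hom ((Gamma e q)\<lparr>carrier := D\<rparr>) H"
        by (rule card_Hom_zeta_type[OF m e _ H(1,3)])
    qed
    finally show "(\<Sum>D\<in>zeta_type m q n e. card_Hom ((Gamma m q)\<lparr>carrier := D\<rparr>) H) =
        gen_subgroup_number_Gamma_1 e q H n" unfolding gen_subgroup_number_Gamma_1_def .
  qed
  finally show ?thesis .
qed

theorem theorem26:
  fixes m n q :: nat and H :: "('h, 'k) monoid_scheme"
  assumes "m \<ge> 1" and "n \<ge> 1"
    and "Factorial_Ring.prime q" and "odd q"
    and "group H" and "finite (carrier H)"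
    and "gcd m (card (carrier H)) = 1"
  shows "gen_subgroup_number (Gamma m q) H n =
           (\<Sum>d | d dvd m. gen_subgroup_number_Gamma_1 d q H n)
    \<and> (\<forall>d. d dvd m \<longrightarrow>
        ([gen_subgroup_number_Gamma_1 d q H n = 1] (mod 2) \<longleftrightarrow>
          (\<not> q dvd d \<and>
            (\<exists>\<eta>::nat. n = 2 * d * (1 + 2 * (q - 1) * \<eta>) \<and>
              binary_digit_sum ((q - 1) * \<eta> + 1) =
                binary_digit_sum \<eta> + binary_digit_sum ((q - 2) * \<eta> + 1)))
          \<or> (\<not> 2 dvd d \<and> \<not> q dvd d \<and> \<not> 2 dvd card (carrier H) \<and>
            (\<exists>\<eta>::nat. n = d * (1 + 2 * (q - 1) * \<eta>) \<and>
              binary_digit_sum ((q - 1) * \<eta> + 1) =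
                binary_digit_sum \<eta> + binary_digit_sum ((q - 2) * \<eta> + 1)))))"
proof (intro conjI allI impI)
  have m: "0 < m" and n: "0 < n" using assms(1,2) by simp_all
  show "gen_subgroup_number (Gamma m q) H n = (\<Sum>d | d dvd m. gen_subgroup_number_Gamma_1 d q H n)"
    by (rule gen_subgroup_number_Gamma[OF m n assms(3,4,5,6)]) (unfold coprime_iff_gcd_eq_1, rule assms(7))
  fix d assume "d dvd m"
  then have d: "0 < d" using m by (metis dvd_0_left gr0I)
  \<comment> \<open>Kummer's criterion for the decomposition of (q - 1) \<eta> + 1 as \<eta> plus (q
    - 2) \<eta> + 1.\<close>
  have digit: "odd (((q - 1) * \<eta> + 1) choose \<eta>) \<longleftrightarrow>
      binary_digit_sum ((q - 1) * \<eta> + 1) = binary_digit_sum \<eta> + binary_digit_sum ((q - 2) * \<eta> + 1)" for \<eta>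
  proof -
    obtain r where "q = Suc (Suc r)" using prime_gt_1_nat[OF assms(3)] by (cases q; cases "q - 1") auto
    then have "(q - 1) * \<eta> + 1 = \<eta> + ((q - 2) * \<eta> + 1)" by simp
    then show ?thesis using odd_choose_iff_digit_sum[of \<eta> "(q - 2) * \<eta> + 1"] by simp
  qed
  have "[gen_subgroup_number_Gamma_1 d q H n = 1] (mod 2) \<longleftrightarrow> odd (gen_subgroup_number_Gamma_1 d q H n)"
    by (simp add: cong_def odd_iff_mod_2_eq_one)
  then show "[gen_subgroup_number_Gamma_1 d q H n = 1] (mod 2) \<longleftrightarrow>
          (\<not> q dvd d \<and>
            (\<exists>\<eta>::nat. n = 2 * d * (1 + 2 * (q - 1) * \<eta>) \<and>
              binary_digit_sum ((q - 1) * \<eta> + 1) =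
                binary_digit_sum \<eta> + binary_digit_sum ((q - 2) * \<eta> + 1)))
          \<or> (\<not> 2 dvd d \<and> \<not> q dvd d \<and> \<not> 2 dvd card (carrier H) \<and>
            (\<exists>\<eta>::nat. n = d * (1 + 2 * (q - 1) * \<eta>) \<and>
              binary_digit_sum ((q - 1) * \<eta> + 1) =
                binary_digit_sum \<eta> + binary_digit_sum ((q - 2) * \<eta> + 1)))"
    unfolding odd_gen_subgroup_number_Gamma_1(2)[OF d n assms(3,4,5,6)] digit by blast
qed

end
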